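(* Let $H$ be a Hopf algebra over a commutative ring $k$, let $M$ be an $R$-firmly projective $k$-module, and consider the associated infinite comatrix coalgebra $M^*\otimes_R M$. Then there is a bijective correspondence between partial corepresentations $\omega:M^*\otimes_R M\to H$ and left $R$-linear maps $\rho:M\to M\otimes H$, $\rho(m)=m^{[0]}\otimes m^{[1]}$, endowing $M$ with the structure of a partial $H$-comodule.
   Context: Tensor products without subscript are over $k$; $M^*=\mathrm{Hom}_k(M,k)$; $S$ is the antipode of $H$. A (possibly non-unital) ring $R$ is firm if multiplication induces an isomorphism $R\otimes_RR\to R$. A left $R$-module $M$ is firm if the action induces an isomorphism $R\otimes_RM\cong M$, whose inverse is written $m\mapsto r\otimes_R m^r$ (summation understood). A $k$-module $M$ is $R$-firmly projective ($R$ a firm ring) if there is a ring morphism $R\to M\otimes M^*$, $r\mapsto e_r\otimes f_r$ (summation understood; the product on $M\otimes M^*$ is $(m\otimes f)(n\otimes g)=mf(n)\otimes g$), such that $M$ is a firm left $R$-module under $r\cdot m=e_rf_r(m)$; hence $e_rf_r(m^r)=m$ for all $m$. $M^*$ is a right $R$-module by $(f\cdot r)(m)=f(r\cdot m)$. The infinite comatrix coalgebra is $M^*\otimes_RM$ with counit $f\otimes_R m\mapsto f(m)$ and comultiplication $f\otimes_R u\mapsto (f\otimes_R e_r)\otimes(f_r\otimes_R u^r)$. $M\otimes H$ is a left $R$-module via the action on $M$. A partial corepresentation of $H$ over a coalgebra $D$ is a linear map $\omega:D\to H$ with, for all $c\in D$: $\epsilon_H(\omega(c))=\epsilon_D(c)$;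 $\omega(c_{(1)})_{(1)}\otimes\omega(c_{(1)})_{(2)}S(\omega(c_{(2)}))=\omega(c_{(1)})\otimes\omega(c_{(2)})S(\omega(c_{(3)}))$; $\omega(c_{(1)})S(\omega(c_{(2)})_{(1)})\otimes\omega(c_{(2)})_{(2)}=\omega(c_{(1)})S(\omega(c_{(2)}))\otimes\omega(c_{(3)})$. A partial (right) $H$-comodule is a $k$-module $M$ with a linear map $\rho:M\to M\otimes H$ such that for all $m$: $m^{[0]}\epsilon(m^{[1]})=m$; $m^{[0][0]}\otimes {m^{[0][1]}}_{(1)}\otimes {m^{[0][1]}}_{(2)}S(m^{[1]})=m^{[0][0][0]}\otimes m^{[0][0][1]}\otimes m^{[0][1]}S(m^{[1]})$; $m^{[0][0]}\otimes m^{[0][1]}S({m^{[1]}}_{(1)})\otimes {m^{[1]}}_{(2)}=m^{[0][0][0]}\otimes m^{[0][0][1]}S(m^{[0][1]})\otimes m^{[1]}$. *)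

theory Defs
  imports "HOL-Algebra.IntRing" "HOL-Algebra.AbelCoset" "HOL-Algebra.Module"
begin

section \<open>Linear maps\<close>

definition linear_maps ::
  "('k, 'x) ring_scheme \<Rightarrow> ('k, 'm, 'y) module_scheme \<Rightarrow> ('k, 'n, 'z) module_scheme \<Rightarrow> ('m \<Rightarrow> 'n) set"
  where "linear_maps k M N = {f \<in> carrier M \<rightarrow> carrier N.
    (\<forall>x\<in>carrier M. \<forall>y\<in>carrier M. f (x \<oplus>\<^bsub>M\<^esub> y) = f x \<oplus>\<^bsub>N\<^esub> f y) \<and>
    (\<forall>a\<in>carrier k. \<forall>x\<in>carrier M. f (a \<odot>\<^bsub>M\<^esub> x) = a \<odot>\<^bsub>N\<^esub> f x)}"

text \<open>A linear map is counted once: functions are normalised to be \<^const>\<open>undefined\<close> outside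
  the carrier of their domain.\<close>

definition Hom ::
  "('k, 'x) ring_scheme \<Rightarrow> ('k, 'm, 'y) module_scheme \<Rightarrow> ('k, 'n, 'z) module_scheme \<Rightarrow> ('m \<Rightarrow> 'n) set"
  where "Hom k M N = linear_maps k M N \<inter> extensional (carrier M)"

definition self_module :: "('k, 'x) ring_scheme \<Rightarrow> ('k, 'k) module"
  where "self_module k = \<lparr>carrier = carrier k, mult = mult k, one = one k,
    zero = zero k, add = add k, smult = mult k\<rparr>"

text \<open>Here and below, the fields \<^const>\<open>mult\<close> and \<^const>\<open>one\<close> of a record that is only used as a module
  are left \<^const>\<open>undefined\<close>.\<close>

definition dual :: "('k, 'x) ring_scheme \<Rightarrow> ('k, 'm, 'y) module_scheme \<Rightarrow> ('k, 'm \<Rightarrow> 'k) module"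
  where "dual k M = \<lparr>carrier = Hom k M (self_module k), mult = undefined, one = undefined,
    zero = (\<lambda>m\<in>carrier M. \<zero>\<^bsub>k\<^esub>),
    add = (\<lambda>f g. \<lambda>m\<in>carrier M. f m \<oplus>\<^bsub>k\<^esub> g m),
    smult = (\<lambda>a f. \<lambda>m\<in>carrier M. a \<otimes>\<^bsub>k\<^esub> f m)\<rparr>"

text \<open>An abelian group as a module over the integers.\<close>

definition int_module :: "('a, 'x) ring_scheme \<Rightarrow> (int, 'a) module"
  where "int_module G = \<lparr>carrier = carrier G, mult = undefined, one = undefined,
    zero = zero G, add = add G, smult = (\<lambda>n x. [n] \<cdot>\<^bsub>G\<^esub> x)\<rparr>"


section \<open>Tensor products\<close>

definition free_module :: "('k, 'x) ring_scheme \<Rightarrow> 'b set \<Rightarrow> ('k, 'b \<Rightarrow> 'k) module"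
  where "free_module k B = \<lparr>
    carrier = {f. range f \<subseteq> carrier k \<and> {b. f b \<noteq> \<zero>\<^bsub>k\<^esub>} \<subseteq> B \<and> finite {b. f b \<noteq> \<zero>\<^bsub>k\<^esub>}},
    mult = undefined, one = undefined,
    zero = (\<lambda>b. \<zero>\<^bsub>k\<^esub>),
    add = (\<lambda>f g b. f b \<oplus>\<^bsub>k\<^esub> g b),
    smult = (\<lambda>a f b. a \<otimes>\<^bsub>k\<^esub> f b)\<rparr>"

definition free_gen :: "('k, 'x) ring_scheme \<Rightarrow> 'b \<Rightarrow> 'b \<Rightarrow> 'k"
  where "free_gen k b = (\<lambda>c. if c = b then \<one>\<^bsub>k\<^esub> else \<zero>\<^bsub>k\<^esub>)"

definition generated_submodule ::
  "('k, 'x) ring_scheme \<Rightarrow> ('k, 'm, 'y) module_scheme \<Rightarrow> 'm set \<Rightarrow> 'm set"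
  where "generated_submodule k M A = \<Inter>{N. submodule N k M \<and> A \<subseteq> N}"

definition quotient_smult :: "('k, 'm, 'y) module_scheme \<Rightarrow> 'm set \<Rightarrow> 'k \<Rightarrow> 'm set \<Rightarrow> 'm set"
  where "quotient_smult M N a X = (\<Union>x\<in>X. N +>\<^bsub>M\<^esub> (a \<odot>\<^bsub>M\<^esub> x))"

text \<open>A tensor product is a module together with its bilinear map \<open>(m, n) \<mapsto> m \<otimes> n\<close>, which is
  written with a box because \<open>\<otimes>\<close> is the multiplication of a ring.\<close>

record ('k, 't, 'm, 'n) tensor_module = "('k, 't) module" +
  tens :: "'m \<Rightarrow> 'n \<Rightarrow> 't" (infixl \<open>\<boxtimes>\<index>\<close> 70)

definition tensor_relations ::
  "('k, 'x) ring_scheme \<Rightarrow> ('k, 'm, 'y) module_scheme \<Rightarrow> ('k, 'n, 'z) module_scheme \<Rightarrow>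
    (('m \<times> 'n) \<times> ('m \<times> 'n)) set \<Rightarrow> ('m \<times> 'n \<Rightarrow> 'k) set"
  where "tensor_relations k M N E =
    (let F = free_module k (carrier M \<times> carrier N); g = (\<lambda>m n. free_gen k (m, n)) in
      {g (m \<oplus>\<^bsub>M\<^esub> m') n \<ominus>\<^bsub>F\<^esub> (g m n \<oplus>\<^bsub>F\<^esub> g m' n) | m m' n.
        m \<in> carrier M \<and> m' \<in> carrier M \<and> n \<in> carrier N} \<union>
      {g m (n \<oplus>\<^bsub>N\<^esub> n') \<ominus>\<^bsub>F\<^esub> (g m n \<oplus>\<^bsub>F\<^esub> g m n') | m n n'.
        m \<in> carrier M \<and> n \<in> carrier N \<and> n' \<in> carrier N} \<union>
      {g (a \<odot>\<^bsub>M\<^esub> m) n \<ominus>\<^bsub>F\<^esub> a \<odot>\<^bsub>F\<^esub> g m n | a m n.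
        a \<in> carrier k \<and> m \<in> carrier M \<and> n \<in> carrier N} \<union>
      {g m (a \<odot>\<^bsub>N\<^esub> n) \<ominus>\<^bsub>F\<^esub> a \<odot>\<^bsub>F\<^esub> g m n | a m n.
        a \<in> carrier k \<and> m \<in> carrier M \<and> n \<in> carrier N} \<union>
      {g m n \<ominus>\<^bsub>F\<^esub> g m' n' | m n m' n'. ((m, n), (m', n')) \<in> E})"

text \<open>The quotient of \<open>M \<otimes>\<^sub>k N\<close> in which \<open>m \<otimes> n\<close> and \<open>m' \<otimes> n'\<close> are identified whenever
  \<open>((m, n), (m', n')) \<in> E\<close>. Its elements are cosets in the free module on pairs.\<close>

definition tensor_mod ::
  "('k, 'x) ring_scheme \<Rightarrow> ('k, 'm, 'y) module_scheme \<Rightarrow> ('k, 'n, 'z) module_scheme \<Rightarrow>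
    (('m \<times> 'n) \<times> ('m \<times> 'n)) set \<Rightarrow> ('k, ('m \<times> 'n \<Rightarrow> 'k) set, 'm, 'n) tensor_module"
  where "tensor_mod k M N E =
    (let F = free_module k (carrier M \<times> carrier N);
         I = generated_submodule k F (tensor_relations k M N E) in
      \<lparr>carrier = a_rcosets\<^bsub>F\<^esub> I, mult = undefined, one = undefined,
       zero = I,
       add = (\<lambda>X Y. X <+>\<^bsub>F\<^esub> Y),
       smult = quotient_smult F I,
       tens = (\<lambda>m n. I +>\<^bsub>F\<^esub> free_gen k (m, n))\<rparr>)"

definition tensor ::
  "('k, 'x) ring_scheme \<Rightarrow> ('k, 'm, 'y) module_scheme \<Rightarrow> ('k, 'n, 'z) module_scheme \<Rightarrow>
    ('k, ('m \<times> 'n \<Rightarrow> 'k) set, 'm, 'n) tensor_module"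
  where "tensor k M N = tensor_mod k M N {}"

text \<open>\<open>tlift k P B\<close> is the linear map from a tensor product to \<open>P\<close> induced by a bilinear
  (and, where applicable, balanced) map \<open>B\<close>, so that \<open>tlift k P B (\<Sum>\<^sub>i m\<^sub>i \<otimes> n\<^sub>i) = \<Sum>\<^sub>i B m\<^sub>i n\<^sub>i\<close>.
  Sweedler notation is rendered by nesting it: for instance \<open>tlift k P (\<lambda>a b. B a b) (\<Delta> c)\<close>
  is \<open>B(c\<^sub>(\<^sub>1\<^sub>), c\<^sub>(\<^sub>2\<^sub>))\<close>.\<close>

definition free_lift ::
  "('k, 'x) ring_scheme \<Rightarrow> ('k, 'p, 'y) module_scheme \<Rightarrow> ('m \<Rightarrow> 'n \<Rightarrow> 'p) \<Rightarrow> ('m \<times> 'n \<Rightarrow> 'k) \<Rightarrow> 'p"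
  where "free_lift k P B x =
    finsum P (\<lambda>(m, n). x (m, n) \<odot>\<^bsub>P\<^esub> B m n) {p. x p \<noteq> \<zero>\<^bsub>k\<^esub>}"

definition tlift ::
  "('k, 'x) ring_scheme \<Rightarrow> ('k, 'p, 'y) module_scheme \<Rightarrow> ('m \<Rightarrow> 'n \<Rightarrow> 'p) \<Rightarrow> ('m \<times> 'n \<Rightarrow> 'k) set \<Rightarrow> 'p"
  where "tlift k P B X = the_elem (free_lift k P B ` X)"


section \<open>Hopf algebras\<close>

record ('k, 'c) coalg = "('k, 'c) module" +
  comult :: "'c \<Rightarrow> ('c \<times> 'c \<Rightarrow> 'k) set" (\<open>\<Delta>\<index>\<close>)
  counit :: "'c \<Rightarrow> 'k" (\<open>\<epsilon>\<index>\<close>)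

record ('k, 'h) hopf = "('k, 'h) coalg" +
  antipode :: "'h \<Rightarrow> 'h" (\<open>\<S>\<index>\<close>)

locale coalgebra = module k C for k (structure) and C (structure) +
  assumes comult_linear: "comult C \<in> linear_maps k C (tensor k C C)"
    and counit_linear: "counit C \<in> linear_maps k C (self_module k)"
    and coassoc: "c \<in> carrier C \<Longrightarrow>
      (let T = tensor k C C; T3 = tensor k C T in
        tlift k T3 (\<lambda>a b. tlift k T3 (\<lambda>a1 a2. a1 \<boxtimes>\<^bsub>T3\<^esub> (a2 \<boxtimes>\<^bsub>T\<^esub> b)) (\<Delta>\<^bsub>C\<^esub> a)) (\<Delta>\<^bsub>C\<^esub> c) =
        tlift k T3 (\<lambda>a b. a \<boxtimes>\<^bsub>T3\<^esub> \<Delta>\<^bsub>C\<^esub> b) (\<Delta>\<^bsub>C\<^esub> c))"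
    and counit_left: "c \<in> carrier C \<Longrightarrow> tlift k C (\<lambda>a b. \<epsilon>\<^bsub>C\<^esub> a \<odot>\<^bsub>C\<^esub> b) (\<Delta>\<^bsub>C\<^esub> c) = c"
    and counit_right: "c \<in> carrier C \<Longrightarrow> tlift k C (\<lambda>a b. \<epsilon>\<^bsub>C\<^esub> b \<odot>\<^bsub>C\<^esub> a) (\<Delta>\<^bsub>C\<^esub> c) = c"

text \<open>The locale \<^locale>\<open>algebra\<close> of the library is restricted to commutative algebras.\<close>

locale assoc_algebra = module k A + A: ring A for k (structure) and A (structure) +
  assumes smult_mult_left: "\<lbrakk>a \<in> carrier k; x \<in> carrier A; y \<in> carrier A\<rbrakk> \<Longrightarrow>
      (a \<odot>\<^bsub>A\<^esub> x) \<otimes>\<^bsub>A\<^esub> y = a \<odot>\<^bsub>A\<^esub> (x \<otimes>\<^bsub>A\<^esub> y)"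
    and smult_mult_right: "\<lbrakk>a \<in> carrier k; x \<in> carrier A; y \<in> carrier A\<rbrakk> \<Longrightarrow>
      x \<otimes>\<^bsub>A\<^esub> (a \<odot>\<^bsub>A\<^esub> y) = a \<odot>\<^bsub>A\<^esub> (x \<otimes>\<^bsub>A\<^esub> y)"

locale bialgebra = assoc_algebra k H + coalgebra k H for k (structure) and H (structure) +
  assumes comult_mult: "\<lbrakk>x \<in> carrier H; y \<in> carrier H\<rbrakk> \<Longrightarrow>
      (let T = tensor k H H in
        \<Delta>\<^bsub>H\<^esub> (x \<otimes>\<^bsub>H\<^esub> y) =
        tlift k T (\<lambda>x1 x2. tlift k T (\<lambda>y1 y2. (x1 \<otimes>\<^bsub>H\<^esub> y1) \<boxtimes>\<^bsub>T\<^esub> (x2 \<otimes>\<^bsub>H\<^esub> y2)) (\<Delta>\<^bsub>H\<^esub> y)) (\<Delta>\<^bsub>H\<^esub> x))"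
    and comult_one: "\<Delta>\<^bsub>H\<^esub> \<one>\<^bsub>H\<^esub> = \<one>\<^bsub>H\<^esub> \<boxtimes>\<^bsub>tensor k H H\<^esub> \<one>\<^bsub>H\<^esub>"
    and counit_mult: "\<lbrakk>x \<in> carrier H; y \<in> carrier H\<rbrakk> \<Longrightarrow>
      \<epsilon>\<^bsub>H\<^esub> (x \<otimes>\<^bsub>H\<^esub> y) = \<epsilon>\<^bsub>H\<^esub> x \<otimes>\<^bsub>k\<^esub> \<epsilon>\<^bsub>H\<^esub> y"
    and counit_one: "\<epsilon>\<^bsub>H\<^esub> \<one>\<^bsub>H\<^esub> = \<one>\<^bsub>k\<^esub>"

locale hopf_algebra = bialgebra k H for k (structure) and H (structure) +
  assumes antipode_linear: "antipode H \<in> linear_maps k H H"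
    and antipode_left: "x \<in> carrier H \<Longrightarrow>
      tlift k H (\<lambda>a b. \<S>\<^bsub>H\<^esub> a \<otimes>\<^bsub>H\<^esub> b) (\<Delta>\<^bsub>H\<^esub> x) = \<epsilon>\<^bsub>H\<^esub> x \<odot>\<^bsub>H\<^esub> \<one>\<^bsub>H\<^esub>"
    and antipode_right: "x \<in> carrier H \<Longrightarrow>
      tlift k H (\<lambda>a b. a \<otimes>\<^bsub>H\<^esub> \<S>\<^bsub>H\<^esub> b) (\<Delta>\<^bsub>H\<^esub> x) = \<epsilon>\<^bsub>H\<^esub> x \<odot>\<^bsub>H\<^esub> \<one>\<^bsub>H\<^esub>"


section \<open>Firm rings and firm modules\<close>

text \<open>Non-unital rings are carried by the type of ring records; the field \<^const>\<open>one\<close> is not used.\<close>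

locale nonunital_ring = abelian_group R for R (structure) +
  assumes mult_closed: "\<lbrakk>r \<in> carrier R; s \<in> carrier R\<rbrakk> \<Longrightarrow> r \<otimes> s \<in> carrier R"
    and mult_assoc: "\<lbrakk>r \<in> carrier R; s \<in> carrier R; t \<in> carrier R\<rbrakk> \<Longrightarrow>
      (r \<otimes> s) \<otimes> t = r \<otimes> (s \<otimes> t)"
    and distrib_right: "\<lbrakk>r \<in> carrier R; s \<in> carrier R; t \<in> carrier R\<rbrakk> \<Longrightarrow>
      (r \<oplus> s) \<otimes> t = r \<otimes> t \<oplus> s \<otimes> t"
    and distrib_left: "\<lbrakk>r \<in> carrier R; s \<in> carrier R; t \<in> carrier R\<rbrakk> \<Longrightarrow>
      r \<otimes> (s \<oplus> t) = r \<otimes> s \<oplus> r \<otimes> t"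

locale nonunital_left_module = R: nonunital_ring R + M: abelian_group M
  for R (structure) and M (structure) and act :: "'r \<Rightarrow> 'm \<Rightarrow> 'm" +
  assumes act_closed: "\<lbrakk>r \<in> carrier R; m \<in> carrier M\<rbrakk> \<Longrightarrow> act r m \<in> carrier M"
    and act_assoc: "\<lbrakk>r \<in> carrier R; s \<in> carrier R; m \<in> carrier M\<rbrakk> \<Longrightarrow>
      act (r \<otimes>\<^bsub>R\<^esub> s) m = act r (act s m)"
    and act_add_left: "\<lbrakk>r \<in> carrier R; s \<in> carrier R; m \<in> carrier M\<rbrakk> \<Longrightarrow>
      act (r \<oplus>\<^bsub>R\<^esub> s) m = act r m \<oplus>\<^bsub>M\<^esub> act s m"
    and act_add_right: "\<lbrakk>r \<in> carrier R; m \<in> carrier M; n \<in> carrier M\<rbrakk> \<Longrightarrow>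
      act r (m \<oplus>\<^bsub>M\<^esub> n) = act r m \<oplus>\<^bsub>M\<^esub> act r n"

text \<open>The abelian group \<open>R \<otimes>\<^sub>R M\<close>, and the map \<open>R \<otimes>\<^sub>R M \<rightarrow> M\<close> induced by the action.\<close>

definition ring_tensor ::
  "('r, 'x) ring_scheme \<Rightarrow> ('m, 'y) ring_scheme \<Rightarrow> ('r \<Rightarrow> 'm \<Rightarrow> 'm) \<Rightarrow>
    (int, ('r \<times> 'm \<Rightarrow> int) set, 'r, 'm) tensor_module"
  where "ring_tensor R M act = tensor_mod \<Z> (int_module R) (int_module M)
    {((r \<otimes>\<^bsub>R\<^esub> s, m), (r, act s m)) | r s m. r \<in> carrier R \<and> s \<in> carrier R \<and> m \<in> carrier M}"

definition act_map :: "('m, 'y) ring_scheme \<Rightarrow> ('r \<Rightarrow> 'm \<Rightarrow> 'm) \<Rightarrow> ('r \<times> 'm \<Rightarrow> int) set \<Rightarrow> 'm"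
  where "act_map M act = tlift \<Z> (int_module M) act"

definition firm_module ::
  "('r, 'x) ring_scheme \<Rightarrow> ('m, 'y) ring_scheme \<Rightarrow> ('r \<Rightarrow> 'm \<Rightarrow> 'm) \<Rightarrow> bool"
  where "firm_module R M act \<longleftrightarrow> nonunital_left_module R M act \<and>
    act_map M act \<in> iso (add_monoid (ring_tensor R M act)) (add_monoid M)"

definition firm_ring :: "('r, 'x) ring_scheme \<Rightarrow> bool"
  where "firm_ring R \<longleftrightarrow> nonunital_ring R \<and>
    act_map R (mult R) \<in> iso (add_monoid (ring_tensor R R (mult R))) (add_monoid R)"

text \<open>The element \<open>r \<otimes>\<^sub>R m\<^sup>r\<close> of \<open>R \<otimes>\<^sub>R M\<close> with \<open>r m\<^sup>r = m\<close>.\<close>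

definition act_inv ::
  "('r, 'x) ring_scheme \<Rightarrow> ('m, 'y) ring_scheme \<Rightarrow> ('r \<Rightarrow> 'm \<Rightarrow> 'm) \<Rightarrow> 'm \<Rightarrow> ('r \<times> 'm \<Rightarrow> int) set"
  where "act_inv R M act = inv_into (carrier (ring_tensor R M act)) (act_map M act)"


section \<open>Firmly projective modules and comatrix coalgebras\<close>

text \<open>\<open>M \<otimes> M\<^sup>*\<close> with the product \<open>(m \<otimes> f)(n \<otimes> g) = m f(n) \<otimes> g\<close>; it is non-unital in general.\<close>

definition matrix_ring ::
  "('k, 'x) ring_scheme \<Rightarrow> ('k, 'm, 'y) module_scheme \<Rightarrow>
    ('k, ('m \<times> ('m \<Rightarrow> 'k) \<Rightarrow> 'k) set, 'm, 'm \<Rightarrow> 'k) tensor_module"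
  where "matrix_ring k M = (let T = tensor k M (dual k M) in
    T\<lparr>mult := (\<lambda>X Y. tlift k T (\<lambda>m f. tlift k T (\<lambda>n g. (f n \<odot>\<^bsub>M\<^esub> m) \<boxtimes>\<^bsub>T\<^esub> g) Y) X)\<rparr>)"

definition nonunital_ring_hom :: "('r, 'x) ring_scheme \<Rightarrow> ('s, 'y) ring_scheme \<Rightarrow> ('r \<Rightarrow> 's) set"
  where "nonunital_ring_hom R S = {h \<in> carrier R \<rightarrow> carrier S.
    (\<forall>r\<in>carrier R. \<forall>s\<in>carrier R. h (r \<oplus>\<^bsub>R\<^esub> s) = h r \<oplus>\<^bsub>S\<^esub> h s \<and> h (r \<otimes>\<^bsub>R\<^esub> s) = h r \<otimes>\<^bsub>S\<^esub> h s)}"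

text \<open>In what follows \<open>\<iota> r = e\<^sub>r \<otimes> f\<^sub>r\<close>, and \<open>iota_act k M \<iota> r m\<close> is \<open>r \<cdot> m = e\<^sub>r f\<^sub>r(m)\<close>.\<close>

definition iota_act ::
  "('k, 'x) ring_scheme \<Rightarrow> ('k, 'm, 'y) module_scheme \<Rightarrow>
    ('r \<Rightarrow> ('m \<times> ('m \<Rightarrow> 'k) \<Rightarrow> 'k) set) \<Rightarrow> 'r \<Rightarrow> 'm \<Rightarrow> 'm"
  where "iota_act k M \<iota> r m = tlift k M (\<lambda>e f. f m \<odot>\<^bsub>M\<^esub> e) (\<iota> r)"

locale firmly_projective = module k M for k (structure) and M (structure) and R (structure) and \<iota> +
  assumes firm_ring: "firm_ring R"
    and iota_hom: "\<iota> \<in> nonunital_ring_hom R (matrix_ring k M)"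
    and firm_module: "firm_module R M (iota_act k M \<iota>)"

text \<open>\<open>M\<^sup>* \<otimes>\<^sub>R M\<close>, where \<open>(f \<cdot> r)(m) = f(r \<cdot> m)\<close>. Since \<open>R\<close> is just a ring here, the tensor product is
  taken to be balanced over \<open>k\<close> as well, that is, it is a quotient of \<open>M\<^sup>* \<otimes>\<^sub>k M\<close>; this is what makes
  it a \<open>k\<close>-module. If \<open>R\<close> is a \<open>k\<close>-algebra and \<open>\<iota>\<close> is \<open>k\<close>-linear, firmness of \<open>M\<close> makes the balancing
  over \<open>k\<close> automatic.\<close>

definition comatrix_module ::
  "('k, 'x) ring_scheme \<Rightarrow> ('k, 'm, 'y) module_scheme \<Rightarrow> ('r, 'z) ring_scheme \<Rightarrow>
    ('r \<Rightarrow> ('m \<times> ('m \<Rightarrow> 'k) \<Rightarrow> 'k) set) \<Rightarrow>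
    ('k, (('m \<Rightarrow> 'k) \<times> 'm \<Rightarrow> 'k) set, 'm \<Rightarrow> 'k, 'm) tensor_module"
  where "comatrix_module k M R \<iota> = tensor_mod k (dual k M) M
    {((\<lambda>n\<in>carrier M. f (iota_act k M \<iota> r n), m), (f, iota_act k M \<iota> r m)) | f r m.
      f \<in> carrier (dual k M) \<and> r \<in> carrier R \<and> m \<in> carrier M}"

text \<open>\<open>\<Delta>(f \<otimes>\<^sub>R u) = (f \<otimes>\<^sub>R e\<^sub>r) \<otimes> (f\<^sub>r \<otimes>\<^sub>R u\<^sup>r)\<close> and \<open>\<epsilon>(f \<otimes>\<^sub>R u) = f(u)\<close>.\<close>

definition comatrix_comult ::
  "('k, 'x) ring_scheme \<Rightarrow> ('k, 'm, 'y) module_scheme \<Rightarrow> ('r, 'z) ring_scheme \<Rightarrow>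
    ('r \<Rightarrow> ('m \<times> ('m \<Rightarrow> 'k) \<Rightarrow> 'k) set) \<Rightarrow> (('m \<Rightarrow> 'k) \<times> 'm \<Rightarrow> 'k) set \<Rightarrow>
    ((('m \<Rightarrow> 'k) \<times> 'm \<Rightarrow> 'k) set \<times> (('m \<Rightarrow> 'k) \<times> 'm \<Rightarrow> 'k) set \<Rightarrow> 'k) set"
  where "comatrix_comult k M R \<iota> =
    (let D = comatrix_module k M R \<iota>; T = tensor k D D in
      tlift k T (\<lambda>f u. tlift \<Z> (int_module T)
        (\<lambda>r v. tlift k T (\<lambda>e g. (f \<boxtimes>\<^bsub>D\<^esub> e) \<boxtimes>\<^bsub>T\<^esub> (g \<boxtimes>\<^bsub>D\<^esub> v)) (\<iota> r))
        (act_inv R M (iota_act k M \<iota>) u)))"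

definition comatrix_coalgebra ::
  "('k, 'x) ring_scheme \<Rightarrow> ('k, 'm, 'y) module_scheme \<Rightarrow> ('r, 'z) ring_scheme \<Rightarrow>
    ('r \<Rightarrow> ('m \<times> ('m \<Rightarrow> 'k) \<Rightarrow> 'k) set) \<Rightarrow> ('k, (('m \<Rightarrow> 'k) \<times> 'm \<Rightarrow> 'k) set) coalg"
  where "comatrix_coalgebra k M R \<iota> =
    (let D = comatrix_module k M R \<iota> in
      \<lparr>carrier = carrier D, mult = undefined, one = undefined,
       zero = zero D, add = add D, smult = smult D,
       comult = comatrix_comult k M R \<iota>,
       counit = tlift k (self_module k) (\<lambda>f m. f m)\<rparr>)"


section \<open>Partial corepresentations and partial comodules\<close>

definition partial_coreps ::
  "('k, 'x) ring_scheme \<Rightarrow> ('k, 'd, 'y) coalg_scheme \<Rightarrow> ('k, 'h, 'z) hopf_scheme \<Rightarrow> ('d \<Rightarrow> 'h) set"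
  where "partial_coreps k D H = {\<omega> \<in> Hom k D H. \<forall>c\<in>carrier D. let T = tensor k H H in
    \<epsilon>\<^bsub>H\<^esub> (\<omega> c) = \<epsilon>\<^bsub>D\<^esub> c \<and>
    tlift k T (\<lambda>c1 c2. tlift k T (\<lambda>a b. a \<boxtimes>\<^bsub>T\<^esub> (b \<otimes>\<^bsub>H\<^esub> \<S>\<^bsub>H\<^esub> (\<omega> c2))) (\<Delta>\<^bsub>H\<^esub> (\<omega> c1))) (\<Delta>\<^bsub>D\<^esub> c) =
    tlift k T (\<lambda>d c3. tlift k T (\<lambda>c1 c2. \<omega> c1 \<boxtimes>\<^bsub>T\<^esub> (\<omega> c2 \<otimes>\<^bsub>H\<^esub> \<S>\<^bsub>H\<^esub> (\<omega> c3))) (\<Delta>\<^bsub>D\<^esub> d)) (\<Delta>\<^bsub>D\<^esub> c) \<and>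
    tlift k T (\<lambda>c1 c2. tlift k T (\<lambda>a b. (\<omega> c1 \<otimes>\<^bsub>H\<^esub> \<S>\<^bsub>H\<^esub> a) \<boxtimes>\<^bsub>T\<^esub> b) (\<Delta>\<^bsub>H\<^esub> (\<omega> c2))) (\<Delta>\<^bsub>D\<^esub> c) =
    tlift k T (\<lambda>d c3. tlift k T (\<lambda>c1 c2. (\<omega> c1 \<otimes>\<^bsub>H\<^esub> \<S>\<^bsub>H\<^esub> (\<omega> c2)) \<boxtimes>\<^bsub>T\<^esub> \<omega> c3) (\<Delta>\<^bsub>D\<^esub> d)) (\<Delta>\<^bsub>D\<^esub> c)}"

text \<open>In the nested lifts below, \<open>\<rho> m = m0 \<otimes> m1\<close>, \<open>\<rho> m0 = m00 \<otimes> m01\<close> and \<open>\<rho> m00 = m000 \<otimes> m001\<close>.\<close>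

definition partial_comodule_structures ::
  "('k, 'x) ring_scheme \<Rightarrow> ('k, 'm, 'y) module_scheme \<Rightarrow> ('k, 'h, 'z) hopf_scheme \<Rightarrow>
    ('m \<Rightarrow> ('m \<times> 'h \<Rightarrow> 'k) set) set"
  where "partial_comodule_structures k M H = {\<rho> \<in> Hom k M (tensor k M H). \<forall>m\<in>carrier M.
    let T = tensor k H H; T3 = tensor k M T in
    tlift k M (\<lambda>m0 m1. \<epsilon>\<^bsub>H\<^esub> m1 \<odot>\<^bsub>M\<^esub> m0) (\<rho> m) = m \<and>
    tlift k T3 (\<lambda>m0 m1. tlift k T3 (\<lambda>m00 m01. tlift k T3
        (\<lambda>a b. m00 \<boxtimes>\<^bsub>T3\<^esub> (a \<boxtimes>\<^bsub>T\<^esub> (b \<otimes>\<^bsub>H\<^esub> \<S>\<^bsub>H\<^esub> m1))) (\<Delta>\<^bsub>H\<^esub> m01)) (\<rho> m0)) (\<rho> m) =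
    tlift k T3 (\<lambda>m0 m1. tlift k T3 (\<lambda>m00 m01. tlift k T3
        (\<lambda>m000 m001. m000 \<boxtimes>\<^bsub>T3\<^esub> (m001 \<boxtimes>\<^bsub>T\<^esub> (m01 \<otimes>\<^bsub>H\<^esub> \<S>\<^bsub>H\<^esub> m1))) (\<rho> m00)) (\<rho> m0)) (\<rho> m) \<and>
    tlift k T3 (\<lambda>m0 m1. tlift k T3 (\<lambda>m00 m01. tlift k T3
        (\<lambda>a b. m00 \<boxtimes>\<^bsub>T3\<^esub> ((m01 \<otimes>\<^bsub>H\<^esub> \<S>\<^bsub>H\<^esub> a) \<boxtimes>\<^bsub>T\<^esub> b)) (\<Delta>\<^bsub>H\<^esub> m1)) (\<rho> m0)) (\<rho> m) =
    tlift k T3 (\<lambda>m0 m1. tlift k T3 (\<lambda>m00 m01. tlift k T3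
        (\<lambda>m000 m001. m000 \<boxtimes>\<^bsub>T3\<^esub> ((m001 \<otimes>\<^bsub>H\<^esub> \<S>\<^bsub>H\<^esub> m01) \<boxtimes>\<^bsub>T\<^esub> m1)) (\<rho> m00)) (\<rho> m0)) (\<rho> m)}"

text \<open>Left \<open>R\<close>-linearity of a map \<open>\<rho> : M \<rightarrow> M \<otimes> H\<close>, with \<open>r \<cdot> (m \<otimes> h) = (r \<cdot> m) \<otimes> h\<close>.\<close>

definition left_R_linear ::
  "('k, 'x) ring_scheme \<Rightarrow> ('k, 'm, 'y) module_scheme \<Rightarrow> ('r, 'w) ring_scheme \<Rightarrow>
    ('r \<Rightarrow> ('m \<times> ('m \<Rightarrow> 'k) \<Rightarrow> 'k) set) \<Rightarrow> ('k, 'h, 'z) module_scheme \<Rightarrow>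
    ('m \<Rightarrow> ('m \<times> 'h \<Rightarrow> 'k) set) \<Rightarrow> bool"
  where "left_R_linear k M R \<iota> H \<rho> \<longleftrightarrow> (let T = tensor k M H in
    (\<forall>m\<in>carrier M. \<forall>n\<in>carrier M. \<rho> (m \<oplus>\<^bsub>M\<^esub> n) = \<rho> m \<oplus>\<^bsub>T\<^esub> \<rho> n) \<and>
    (\<forall>r\<in>carrier R. \<forall>m\<in>carrier M.
      \<rho> (iota_act k M \<iota> r m) = tlift k T (\<lambda>n h. iota_act k M \<iota> r n \<boxtimes>\<^bsub>T\<^esub> h) (\<rho> m)))"

end

theory Submission
  imports Defs
begin

text \<open>For a functional \<open>f\<close> on \<open>M\<close> write \<open>contract f\<close> for the map \<open>f \<otimes> N : M \<otimes> N \<rightarrow> N\<close>. A linear map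
  \<open>\<chi> : M\<^sup>* \<otimes>\<^sub>R M \<rightarrow> N\<close> and an \<open>R\<close>-linear map \<open>q : M \<rightarrow> M \<otimes> N\<close> correspond to each other if
  \<open>contract f (q m) = \<chi>(f \<otimes>\<^sub>R m)\<close>. Each \<open>\<chi>\<close> comes from \<open>q m = e\<^sub>r \<otimes> \<chi>(f\<^sub>r \<otimes>\<^sub>R m\<^sup>r)\<close>, and each determines
  the other, because \<open>r \<cdot> X = e\<^sub>r \<otimes> contract f\<^sub>r X\<close> for \<open>X \<in> M \<otimes> N\<close> and \<open>M\<close> is spanned by the
  elements \<open>r \<cdot> m\<close>. If \<open>\<rho> : M \<rightarrow> M \<otimes> H\<close> corresponds to \<open>\<omega>\<close>, then
  \<open>\<omega>(c\<^sub>1) \<otimes> \<omega>(c\<^sub>2) = contract f ((\<rho> \<otimes> H)(\<rho> m))\<close> for \<open>c = f \<otimes>\<^sub>R m\<close>. Hence both sides of each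
  axiom for \<open>\<rho>\<close> are \<open>R\<close>-linear maps corresponding to the two sides of the matching axiom for \<open>\<omega>\<close>,
  and one axiom holds if and only if the other does.\<close>


section \<open>Linear and bilinear maps\<close>

text \<open>The obstacle: functionals on \<open>M\<close> are not known to separate the points of
  \<open>M \<otimes> N\<close>, so equal contractions alone say nothing about two unrelated tensors.
  \<open>R\<close>-linearity repairs this, because it expresses the value of a coaction at
  \<open>r \<cdot> m\<close> through the contractions of its value at \<open>m\<close>. The integers
  enter because \<open>R\<close> is only a ring: the firmness isomorphism is one of abelian groups,
  so a coaction is first built as an additive map, and its \<open>k\<close>-linearity is recovered
  afterwards on the elements \<open>r \<cdot> m\<close>. The formula for
  \<open>\<omega>(c\<^sub>1) \<otimes> \<omega>(c\<^sub>2)\<close> rests on a universal case: the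
  identity of \<open>D\<close> corresponds to a coaction \<open>coact_D\<close>, every
  \<open>\<rho>\<close> is the image of \<open>coact_D\<close> under
  \<open>M \<otimes> \<omega>\<close>, and \<open>\<Delta>(f \<otimes> m)\<close> is
  \<open>coact_D m\<close> with \<open>f\<close> attached on the left. Finally, \<open>tlift\<close>
  accepts any function as its body but has its meaning only for bilinear balanced ones; hence each
  rearrangement of a nested Sweedler sum brings its own bilinearity obligation.\<close>

lemma linear_mapsI:
  assumes "\<And>x. x \<in> carrier M \<Longrightarrow> f x \<in> carrier N"
    and "\<And>x y. \<lbrakk>x \<in> carrier M; y \<in> carrier M\<rbrakk> \<Longrightarrow> f (x \<oplus>\<^bsub>M\<^esub> y) = f x \<oplus>\<^bsub>N\<^esub> f y"
    and "\<And>a x. \<lbrakk>a \<in> carrier k; x \<in> carrier M\<rbrakk> \<Longrightarrow> f (a \<odot>\<^bsub>M\<^esub> x) = a \<odot>\<^bsub>N\<^esub> f x"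
  shows "f \<in> linear_maps k M N"
  using assms by (auto simp: linear_maps_def)

lemma linear_closed: "\<lbrakk>f \<in> linear_maps k M N; x \<in> carrier M\<rbrakk> \<Longrightarrow> f x \<in> carrier N"
  by (auto simp: linear_maps_def)

lemma linear_add:
  "\<lbrakk>f \<in> linear_maps k M N; x \<in> carrier M; y \<in> carrier M\<rbrakk> \<Longrightarrow> f (x \<oplus>\<^bsub>M\<^esub> y) = f x \<oplus>\<^bsub>N\<^esub> f y"
  by (auto simp: linear_maps_def)

lemma linear_smult:
  "\<lbrakk>f \<in> linear_maps k M N; a \<in> carrier k; x \<in> carrier M\<rbrakk> \<Longrightarrow> f (a \<odot>\<^bsub>M\<^esub> x) = a \<odot>\<^bsub>N\<^esub> f x"
  by (auto simp: linear_maps_def)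

text \<open>Stated for additive maps, because the map induced by the action and the coactions built
  over the integers need their value at zero before anything is known about scalars.\<close>

lemma additive_zero:
  assumes "abelian_group M" "abelian_group N" "\<And>x. x \<in> carrier M \<Longrightarrow> f x \<in> carrier N"
    "\<And>x y. \<lbrakk>x \<in> carrier M; y \<in> carrier M\<rbrakk> \<Longrightarrow> f (x \<oplus>\<^bsub>M\<^esub> y) = f x \<oplus>\<^bsub>N\<^esub> f y"
  shows "f \<zero>\<^bsub>M\<^esub> = \<zero>\<^bsub>N\<^esub>"
proof -
  interpret M: abelian_group M by fact
  interpret N: abelian_group N by fact
  have "f \<zero>\<^bsub>M\<^esub> \<oplus>\<^bsub>N\<^esub> f \<zero>\<^bsub>M\<^esub> = f \<zero>\<^bsub>M\<^esub>"
    using assms(4)[of "\<zero>\<^bsub>M\<^esub>" "\<zero>\<^bsub>M\<^esub>"] by simp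
  then show ?thesis
    using assms(3) N.add.r_cancel_one' by (metis M.zero_closed)
qed

lemma linear_zero:
  assumes "module k M" "module k N" "f \<in> linear_maps k M N"
  shows "f \<zero>\<^bsub>M\<^esub> = \<zero>\<^bsub>N\<^esub>"
  using assms by (intro additive_zero) (auto simp: module_def linear_closed linear_add)

lemma linear_uminus:
  assumes "module k M" "module k N" "f \<in> linear_maps k M N" "x \<in> carrier M"
  shows "f (\<ominus>\<^bsub>M\<^esub> x) = \<ominus>\<^bsub>N\<^esub> f x"
proof -
  interpret M: module k M by fact
  interpret N: module k N by fact
  have "f (\<ominus>\<^bsub>M\<^esub> x) \<oplus>\<^bsub>N\<^esub> f x = \<zero>\<^bsub>N\<^esub>"
    using linear_add[OF assms(3), of "\<ominus>\<^bsub>M\<^esub> x" x] linear_zero[OF assms(1-3)] assms(4)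
    by (simp add: M.l_neg)
  then show ?thesis
    using assms linear_closed[OF assms(3)] by (intro N.add.inv_equality[symmetric]) auto
qed

lemma linear_minus:
  assumes "module k M" "module k N" "f \<in> linear_maps k M N" "x \<in> carrier M" "y \<in> carrier M"
  shows "f (x \<ominus>\<^bsub>M\<^esub> y) = f x \<ominus>\<^bsub>N\<^esub> f y"
proof -
  interpret M: module k M by fact
  interpret N: module k N by fact
  show ?thesis
    using assms by (simp add: a_minus_def linear_add linear_uminus)
qed

text \<open>A module carrier is closed under both operations, so only values on it enter. This lets
  a normalised function and an unnormalised one replace each other.\<close>

lemma linear_cong:
  assumes "\<And>x. x \<in> carrier M \<Longrightarrow> f x = g x" "module k M"
  shows "f \<in> linear_maps k M N \<longleftrightarrow> g \<in> linear_maps k M N"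
proof -
  interpret M: module k M by fact
  show ?thesis using assms by (auto simp: linear_maps_def Pi_def)
qed

lemma linear_id: "(\<lambda>x. x) \<in> linear_maps k M M"
  by (auto simp: linear_maps_def)

lemma linear_comp:
  "\<lbrakk>g \<in> linear_maps k N P; f \<in> linear_maps k M N\<rbrakk> \<Longrightarrow> (\<lambda>x. g (f x)) \<in> linear_maps k M P"
  by (auto simp: linear_maps_def Pi_def)

lemma self_module_simps [simp]:
  "carrier (self_module k) = carrier k" "zero (self_module k) = \<zero>\<^bsub>k\<^esub>"
  "add (self_module k) = add k" "smult (self_module k) = mult k"
  by (simp_all add: self_module_def)

lemma module_self:
  assumes "cring k"
  shows "module k (self_module k)"
proof -
  interpret cring k by fact
  show ?thesis
    by (intro moduleI abelian_groupI)
      (auto simp: l_distr r_distr m_assoc a_ac assms l_neg intro!: bexI[of _ "\<ominus>\<^bsub>k\<^esub> _"])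
qed

lemma linear_smult_left:
  assumes "module k N" "f \<in> linear_maps k M (self_module k)" "n \<in> carrier N"
  shows "(\<lambda>x. f x \<odot>\<^bsub>N\<^esub> n) \<in> linear_maps k M N"
proof -
  interpret N: module k N by fact
  show ?thesis
    using assms linear_closed[OF assms(2)] linear_add[OF assms(2)] linear_smult[OF assms(2)]
    by (intro linear_mapsI) (auto simp: N.smult_l_distr N.smult_assoc1)
qed

lemma linear_smult_right:
  assumes "module k N" "f \<in> linear_maps k M N" "a \<in> carrier k"
  shows "(\<lambda>x. a \<odot>\<^bsub>N\<^esub> f x) \<in> linear_maps k M N"
proof -
  interpret N: module k N by fact
  show ?thesis
    using assms linear_closed[OF assms(2)] linear_add[OF assms(2)] linear_smult[OF assms(2)]
    by (intro linear_mapsI)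
      (auto simp: N.smult_r_distr N.smult_assoc1[symmetric] N.m_comm)
qed

lemma linear_plus:
  assumes "module k N" "f \<in> linear_maps k M N" "g \<in> linear_maps k M N"
  shows "(\<lambda>x. f x \<oplus>\<^bsub>N\<^esub> g x) \<in> linear_maps k M N"
proof -
  interpret N: module k N by fact
  note f = linear_closed[OF assms(2)] linear_add[OF assms(2)] linear_smult[OF assms(2)]
  note g = linear_closed[OF assms(3)] linear_add[OF assms(3)] linear_smult[OF assms(3)]
  show ?thesis by (intro linear_mapsI) (simp_all add: f g N.smult_r_distr N.a_ac)
qed

section \<open>Bilinear and balanced maps\<close>

definition bilinear_maps ::
  "('k, 'x) ring_scheme \<Rightarrow> ('k, 'm, 'y) module_scheme \<Rightarrow> ('k, 'n, 'z) module_scheme \<Rightarrow>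
    ('k, 'p, 'w) module_scheme \<Rightarrow> ('m \<Rightarrow> 'n \<Rightarrow> 'p) set"
  where "bilinear_maps k M N P = {B. (\<forall>m\<in>carrier M. (\<lambda>n. B m n) \<in> linear_maps k N P) \<and>
    (\<forall>n\<in>carrier N. (\<lambda>m. B m n) \<in> linear_maps k M P)}"

lemma bilinear_mapsI:
  assumes "\<And>m. m \<in> carrier M \<Longrightarrow> (\<lambda>n. B m n) \<in> linear_maps k N P"
    and "\<And>n. n \<in> carrier N \<Longrightarrow> (\<lambda>m. B m n) \<in> linear_maps k M P"
  shows "B \<in> bilinear_maps k M N P"
  using assms by (auto simp: bilinear_maps_def)

lemma bilinear_right:
  "\<lbrakk>B \<in> bilinear_maps k M N P; m \<in> carrier M\<rbrakk> \<Longrightarrow> (\<lambda>n. B m n) \<in> linear_maps k N P"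
  by (auto simp: bilinear_maps_def)

lemma bilinear_left:
  "\<lbrakk>B \<in> bilinear_maps k M N P; n \<in> carrier N\<rbrakk> \<Longrightarrow> (\<lambda>m. B m n) \<in> linear_maps k M P"
  by (auto simp: bilinear_maps_def)

lemma bilinear_closed:
  "\<lbrakk>B \<in> bilinear_maps k M N P; m \<in> carrier M; n \<in> carrier N\<rbrakk> \<Longrightarrow> B m n \<in> carrier P"
  by (auto simp: bilinear_maps_def linear_maps_def)

lemma linear_bilinear_left:
  "\<lbrakk>B \<in> bilinear_maps k M N P; f \<in> linear_maps k C M; n \<in> carrier N\<rbrakk> \<Longrightarrow>
    (\<lambda>x. B (f x) n) \<in> linear_maps k C P"
  by (rule linear_comp[OF bilinear_left])

lemma linear_bilinear_right:
  "\<lbrakk>B \<in> bilinear_maps k M N P; f \<in> linear_maps k C N; m \<in> carrier M\<rbrakk> \<Longrightarrow>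
    (\<lambda>x. B m (f x)) \<in> linear_maps k C P"
  by (rule linear_comp[OF bilinear_right])

lemma bilinear_comp:
  "\<lbrakk>g \<in> linear_maps k P Q; B \<in> bilinear_maps k M N P\<rbrakk> \<Longrightarrow>
    (\<lambda>m n. g (B m n)) \<in> bilinear_maps k M N Q"
  by (auto simp: bilinear_maps_def intro: linear_comp)

lemma bilinear_comp2:
  assumes "B \<in> bilinear_maps k M N P" "f \<in> linear_maps k M' M" "g \<in> linear_maps k N' N"
  shows "(\<lambda>m n. B (f m) (g n)) \<in> bilinear_maps k M' N' P"
  using assms
  by (intro bilinear_mapsI linear_bilinear_left[OF assms(1)] linear_bilinear_right[OF assms(1)])
    (auto intro: linear_closed)

lemma bilinear_cong:
  assumes "\<And>m n. \<lbrakk>m \<in> carrier M; n \<in> carrier N\<rbrakk> \<Longrightarrow> B m n = B' m n" "module k M" "module k N"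
  shows "B \<in> bilinear_maps k M N P \<longleftrightarrow> B' \<in> bilinear_maps k M N P"
proof -
  have "(\<lambda>n. B m n) \<in> linear_maps k N P \<longleftrightarrow> (\<lambda>n. B' m n) \<in> linear_maps k N P"
    if "m \<in> carrier M" for m using assms that by (intro linear_cong) auto
  moreover have "(\<lambda>m. B m n) \<in> linear_maps k M P \<longleftrightarrow> (\<lambda>m. B' m n) \<in> linear_maps k M P"
    if "n \<in> carrier N" for n using assms that by (intro linear_cong) auto
  ultimately show ?thesis by (auto simp: bilinear_maps_def)
qed

text \<open>The pairs are the ones identified in \<open>tensor_mod\<close>; this is the condition
  under which a bilinear map descends to that quotient.\<close>

definition balanced :: "(('m \<times> 'n) \<times> ('m \<times> 'n)) set \<Rightarrow> ('m \<Rightarrow> 'n \<Rightarrow> 'p) \<Rightarrow> bool"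
  where "balanced E B \<longleftrightarrow> (\<forall>((m, n), (m', n')) \<in> E. B m n = B m' n')"

lemma balanced_empty [simp]: "balanced {} B"
  by (simp add: balanced_def)


section \<open>Free modules\<close>

lemma free_module_simps:
  "zero (free_module k B) = (\<lambda>b. \<zero>\<^bsub>k\<^esub>)"
  "add (free_module k B) = (\<lambda>f g b. f b \<oplus>\<^bsub>k\<^esub> g b)"
  "smult (free_module k B) = (\<lambda>a f b. a \<otimes>\<^bsub>k\<^esub> f b)"
  by (simp_all add: free_module_def)

lemma free_module_carrier:
  "f \<in> carrier (free_module k B) \<longleftrightarrow> (\<forall>b. f b \<in> carrier k) \<and>
    {b. f b \<noteq> \<zero>\<^bsub>k\<^esub>} \<subseteq> B \<and> finite {b. f b \<noteq> \<zero>\<^bsub>k\<^esub>}"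
  by (auto simp: free_module_def)

lemma module_free_module:
  assumes "cring k"
  shows "module k (free_module k B)"
proof -
  interpret cring k by fact
  have add: "(\<lambda>b. f b \<oplus>\<^bsub>k\<^esub> g b) \<in> carrier (free_module k B)"
    if "f \<in> carrier (free_module k B)" "g \<in> carrier (free_module k B)" for f g
  proof -
    have "{b. f b \<oplus>\<^bsub>k\<^esub> g b \<noteq> \<zero>\<^bsub>k\<^esub>} \<subseteq> {b. f b \<noteq> \<zero>\<^bsub>k\<^esub>} \<union> {b. g b \<noteq> \<zero>\<^bsub>k\<^esub>}" by auto
    moreover from this have "finite {b. f b \<oplus>\<^bsub>k\<^esub> g b \<noteq> \<zero>\<^bsub>k\<^esub>}"
      by (rule finite_subset) (use that in \<open>simp add: free_module_carrier\<close>)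
    ultimately show ?thesis using that by (simp add: free_module_carrier) blast
  qed
  have smult: "(\<lambda>b. a \<otimes>\<^bsub>k\<^esub> f b) \<in> carrier (free_module k B)"
    if "f \<in> carrier (free_module k B)" "a \<in> carrier k" for f a
  proof -
    have "{b. a \<otimes>\<^bsub>k\<^esub> f b \<noteq> \<zero>\<^bsub>k\<^esub>} \<subseteq> {b. f b \<noteq> \<zero>\<^bsub>k\<^esub>}" using that by auto
    then have "finite {b. a \<otimes>\<^bsub>k\<^esub> f b \<noteq> \<zero>\<^bsub>k\<^esub>}"
      by (rule finite_subset) (use that in \<open>simp add: free_module_carrier\<close>)
    then show ?thesis using that by (auto simp: free_module_carrier)
  qed
  \<comment> \<open>The negative is taken as the multiple by minus one, so that \<open>smult\<close>
    already places it in the carrier.\<close>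
  have uminus: "\<exists>g\<in>carrier (free_module k B). g \<oplus>\<^bsub>free_module k B\<^esub> f = \<zero>\<^bsub>free_module k B\<^esub>"
    if "f \<in> carrier (free_module k B)" for f
    using that smult[OF that, of "\<ominus>\<^bsub>k\<^esub> \<one>\<^bsub>k\<^esub>"]
    by (intro bexI[of _ "\<lambda>b. \<ominus>\<^bsub>k\<^esub> \<one>\<^bsub>k\<^esub> \<otimes>\<^bsub>k\<^esub> f b"])
      (auto simp: free_module_carrier free_module_simps l_minus l_neg)
  have zero: "(\<lambda>b. \<zero>\<^bsub>k\<^esub>) \<in> carrier (free_module k B)" by (simp add: free_module_carrier)
  have val: "f b \<in> carrier k" if "f \<in> carrier (free_module k B)" for f b
    using that by (simp add: free_module_carrier)
  show ?thesis
    by (intro moduleI abelian_groupI uminus)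
      (simp_all add: assms free_module_simps add smult zero val a_ac l_distr r_distr m_assoc)
qed

lemma free_gen_closed:
  assumes "cring k" "b \<in> B"
  shows "free_gen k b \<in> carrier (free_module k B)"
proof -
  interpret cring k by fact
  have "{c. free_gen k b c \<noteq> \<zero>\<^bsub>k\<^esub>} \<subseteq> {b}" by (auto simp: free_gen_def)
  then show ?thesis using assms
    by (auto simp: free_module_carrier dest: finite_subset) (auto simp: free_gen_def)
qed

lemma free_module_induct [consumes 2, case_names zero add_smult_gen]:
  assumes k: "cring k" and x: "x \<in> carrier (free_module k B)"
    and zero: "P (\<lambda>b. \<zero>\<^bsub>k\<^esub>)"
    and step: "\<And>a b y. \<lbrakk>a \<in> carrier k; b \<in> B; y \<in> carrier (free_module k B); P y\<rbrakk> \<Longrightarrow>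
      P ((a \<odot>\<^bsub>free_module k B\<^esub> free_gen k b) \<oplus>\<^bsub>free_module k B\<^esub> y)"
  shows "P x"
proof -
  interpret cring k by fact
  have "P x" if "finite S" "x \<in> carrier (free_module k B)" "{b. x b \<noteq> \<zero>\<^bsub>k\<^esub>} \<subseteq> S" for S x
    using that
  proof (induction S arbitrary: x rule: finite_induct)
    case empty
    then have "x = (\<lambda>b. \<zero>\<^bsub>k\<^esub>)" by auto
    then show ?case using zero by simp
  next
    case (insert b S)
    show ?case
    proof (cases "x b = \<zero>\<^bsub>k\<^esub>")
      case True
      then show ?thesis using insert.prems insert.IH by blast
    next
      case False
      \<comment> \<open>Erasing the value at \<open>b\<close> leaves a function supported in
        \<open>S\<close>; adding back \<open>x b\<close> times the generator of \<open>b\<close>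
        restores \<open>x\<close>.\<close>
      define y where "y = x(b := \<zero>\<^bsub>k\<^esub>)"
      have supp: "{c. y c \<noteq> \<zero>\<^bsub>k\<^esub>} \<subseteq> {c. x c \<noteq> \<zero>\<^bsub>k\<^esub>}" "{c. y c \<noteq> \<zero>\<^bsub>k\<^esub>} \<subseteq> S"
        using insert.prems by (auto simp: y_def)
      have "finite {c. y c \<noteq> \<zero>\<^bsub>k\<^esub>}"
        using finite_subset[OF supp(1)] insert.prems(1) by (simp add: free_module_carrier)
      then have y: "y \<in> carrier (free_module k B)"
        using insert.prems(1) by (auto simp: free_module_carrier y_def)
      have "b \<in> B" "x b \<in> carrier k" using False insert.prems(1) by (auto simp: free_module_carrier)
      moreover have "x = ((x b \<odot>\<^bsub>free_module k B\<^esub> free_gen k b) \<oplus>\<^bsub>free_module k B\<^esub> y)"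
        using y insert.prems(1) by (auto simp: free_gen_def free_module_carrier free_module_simps y_def)
      ultimately show ?thesis
        using step[OF _ _ y insert.IH[OF y supp(2)], of "x b" b] by simp
    qed
  qed
  then show ?thesis using x by (auto simp: free_module_carrier)
qed

text \<open>The defining sum ranges over the exact support, which changes under addition and
  scaling. Padding it with zero terms allows a common index set for several functions.\<close>

lemma free_lift_eq:
  assumes "module k P" "finite S" "{p. x p \<noteq> \<zero>\<^bsub>k\<^esub>} \<subseteq> S"
    "\<And>m n. (m, n) \<in> S \<Longrightarrow> x (m, n) \<in> carrier k" "\<And>m n. (m, n) \<in> S \<Longrightarrow> B m n \<in> carrier P"
  shows "free_lift k P B x = finsum P (\<lambda>(m, n). x (m, n) \<odot>\<^bsub>P\<^esub> B m n) S"
proof -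
  interpret P: module k P by fact
  show ?thesis
    unfolding free_lift_def using assms
    by (intro P.add.finprod_mono_neutral_cong_left) auto
qed

lemma free_lift_linear:
  fixes k :: "('k, 'x) ring_scheme" and P :: "('k, 'p, 'y) module_scheme" and U :: "('m \<times> 'n) set"
  assumes P: "module k P" and B: "\<And>m n. (m, n) \<in> U \<Longrightarrow> B m n \<in> carrier P"
  shows "free_lift k P B \<in> linear_maps k (free_module k U) P"
proof -
  interpret P: module k P by fact
  let ?F = "free_module k U" and ?s = "\<lambda>x. {p. x p \<noteq> \<zero>\<^bsub>k\<^esub>}"
  interpret F: module k ?F by (rule module_free_module) unfold_locales
  have eq: "free_lift k P B x = finsum P (\<lambda>(m, n). x (m, n) \<odot>\<^bsub>P\<^esub> B m n) S"
    if "x \<in> carrier ?F" "?s x \<subseteq> S" "finite S" "S \<subseteq> U" for x S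
    using that B by (intro free_lift_eq P) (auto simp: free_module_carrier)
  have cl: "(\<lambda>(m, n). x (m, n) \<odot>\<^bsub>P\<^esub> B m n) \<in> S \<rightarrow> carrier P"
    if "x \<in> carrier ?F" "S \<subseteq> U" for x S
    using that B by (auto simp: free_module_carrier)
  show ?thesis
  proof (rule linear_mapsI)
    fix x assume x: "x \<in> carrier ?F"
    then show "free_lift k P B x \<in> carrier P"
      using eq[OF x subset_refl] cl[OF x, of "?s x"] P.finsum_closed
      by (auto simp: free_module_carrier)
  next
    fix x y assume xy: "x \<in> carrier ?F" "y \<in> carrier ?F"
    let ?S = "?s x \<union> ?s y"
    have S: "finite ?S" "?S \<subseteq> U" using xy by (auto simp: free_module_carrier)
    have "?s (x \<oplus>\<^bsub>?F\<^esub> y) \<subseteq> ?S" by (auto simp: free_module_simps)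
    then have "free_lift k P B (x \<oplus>\<^bsub>?F\<^esub> y) =
        finsum P (\<lambda>(m, n). (x \<oplus>\<^bsub>?F\<^esub> y) (m, n) \<odot>\<^bsub>P\<^esub> B m n) ?S"
      using xy by (intro eq S F.a_closed)
    also have "\<dots> = finsum P (\<lambda>p. (\<lambda>(m, n). x (m, n) \<odot>\<^bsub>P\<^esub> B m n) p \<oplus>\<^bsub>P\<^esub>
        (\<lambda>(m, n). y (m, n) \<odot>\<^bsub>P\<^esub> B m n) p) ?S"
      using S xy B by (intro P.add.finprod_cong')
        (auto simp: free_module_carrier free_module_simps P.smult_l_distr subset_iff)
    also have "\<dots> = free_lift k P B x \<oplus>\<^bsub>P\<^esub> free_lift k P B y"
      using S xy eq[of x ?S] eq[of y ?S] by (subst P.finsum_addf[OF cl cl]) auto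
    finally show "free_lift k P B (x \<oplus>\<^bsub>?F\<^esub> y) = free_lift k P B x \<oplus>\<^bsub>P\<^esub> free_lift k P B y" .
  next
    fix a x assume ax: "a \<in> carrier k" "x \<in> carrier ?F"
    let ?S = "?s x"
    have S: "finite ?S" "?S \<subseteq> U" using ax by (auto simp: free_module_carrier)
    have "?s (a \<odot>\<^bsub>?F\<^esub> x) \<subseteq> ?S" using ax by (auto simp: free_module_simps)
    then have "free_lift k P B (a \<odot>\<^bsub>?F\<^esub> x) =
        finsum P (\<lambda>(m, n). (a \<odot>\<^bsub>?F\<^esub> x) (m, n) \<odot>\<^bsub>P\<^esub> B m n) ?S"
      using ax by (intro eq S F.smult_closed)
    also have "\<dots> = finsum P (\<lambda>p. a \<odot>\<^bsub>P\<^esub> (\<lambda>(m, n). x (m, n) \<odot>\<^bsub>P\<^esub> B m n) p) ?S"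
      using S ax B by (intro P.add.finprod_cong')
        (auto simp: free_module_carrier free_module_simps P.smult_assoc1 subset_iff)
    also have "\<dots> = a \<odot>\<^bsub>P\<^esub> free_lift k P B x"
      using S ax by (simp add: P.finsum_smult_ldistr[OF _ _ cl] eq[of x ?S])
    finally show "free_lift k P B (a \<odot>\<^bsub>?F\<^esub> x) = a \<odot>\<^bsub>P\<^esub> free_lift k P B x" .
  qed
qed

lemma free_lift_gen:
  assumes "module k P" "B m n \<in> carrier P"
  shows "free_lift k P B (free_gen k (m, n)) = B m n"
proof -
  interpret P: module k P by fact
  have "free_lift k P B (free_gen k (m, n)) =
      finsum P (\<lambda>(m', n'). free_gen k (m, n) (m', n') \<odot>\<^bsub>P\<^esub> B m' n') {(m, n)}"
    using assms by (intro free_lift_eq) (auto simp: free_gen_def)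
  also have "\<dots> = B m n" using assms by (simp add: free_gen_def)
  finally show ?thesis .
qed

text \<open>Submodules are closed under intersection, and the whole carrier keeps the family
  nonempty.\<close>

lemma generated_submodule_submodule:
  assumes "module k M" "A \<subseteq> carrier M"
  shows "submodule (generated_submodule k M A) k M"
proof -
  interpret M: module k M by fact
  note * = M.carrier_is_submodule
  show ?thesis
    using * assms(2) M.submoduleE[of _] subgroup.one_closed[OF submodule.axioms(1)]
    by (intro M.submoduleI) (auto simp: generated_submodule_def dest: M.submoduleE)
qed

lemma generated_submodule_incl: "A \<subseteq> generated_submodule k M A"
  by (auto simp: generated_submodule_def)

lemma generated_submodule_least:
  "\<lbrakk>submodule N k M; A \<subseteq> N\<rbrakk> \<Longrightarrow> generated_submodule k M A \<subseteq> N"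
  by (auto simp: generated_submodule_def)

lemma kernel_submodule:
  assumes "module k M" "module k N" "f \<in> linear_maps k M N"
  shows "submodule {x \<in> carrier M. f x = \<zero>\<^bsub>N\<^esub>} k M"
proof -
  interpret M: module k M by fact
  interpret N: module k N by fact
  show ?thesis using linear_zero[OF assms] linear_uminus[OF assms] linear_add[OF assms(3)]
     linear_smult[OF assms(3)]
    by (intro M.submoduleI) (auto simp:)
qed


section \<open>Tensor products\<close>

lemma abelian_group_of_module: "module k M \<Longrightarrow> abelian_group M"
  by (rule module.axioms)

lemma cring_of_module: "module k M \<Longrightarrow> cring k"
  by (rule module.axioms)

text \<open>One setting serves three quotients: \<open>E = {}\<close> gives the plain tensor
  product, the integers as base ring give \<open>R \<otimes>\<^sub>R M\<close>, and \<open>k\<close>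
  with the pairs \<open>balancing\<close> gives the comatrix module.\<close>

locale tensor_product = M: module k M + N: module k N
  for k :: "('k, 'x) ring_scheme" and M :: "('k, 'm, 'y) module_scheme"
    and N :: "('k, 'n, 'z) module_scheme" +
  fixes E :: "(('m \<times> 'n) \<times> ('m \<times> 'n)) set"
  assumes E_sub: "E \<subseteq> (carrier M \<times> carrier N) \<times> (carrier M \<times> carrier N)"
begin

abbreviation "T \<equiv> tensor_mod k M N E"
abbreviation "F \<equiv> free_module k (carrier M \<times> carrier N)"
abbreviation "I \<equiv> generated_submodule k F (tensor_relations k M N E)"
abbreviation "gen m n \<equiv> free_gen k (m, n)"

lemma module_F: "module k F"
  by (rule module_free_module[OF M.is_cring])

sublocale F: module k F
  by (rule module_F)

lemma gen_closed: "\<lbrakk>m \<in> carrier M; n \<in> carrier N\<rbrakk> \<Longrightarrow> gen m n \<in> carrier F"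
  by (intro free_gen_closed M.is_cring) simp

lemma relations_closed: "tensor_relations k M N E \<subseteq> carrier F"
  unfolding tensor_relations_def Let_def using E_sub
  by (safe; intro F.minus_closed F.a_closed F.smult_closed gen_closed) auto

lemma submodule_I: "submodule I k F"
  by (rule generated_submodule_submodule[OF module_F relations_closed])

lemma I_subset: "I \<subseteq> carrier F"
  using F.submoduleE(1)[OF submodule_I] .

sublocale I: abelian_subgroup I F
  by (intro abelian_subgroupI3 additive_subgroupI submodule.axioms[OF submodule_I]
      abelian_group_of_module[OF module_F])

lemma coset_eqI:
  assumes "x \<in> carrier F" "y \<in> carrier F" "x \<ominus>\<^bsub>F\<^esub> y \<in> I"
  shows "I +>\<^bsub>F\<^esub> x = I +>\<^bsub>F\<^esub> y"
proof -
  have "(x \<ominus>\<^bsub>F\<^esub> y) \<oplus>\<^bsub>F\<^esub> y = x"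
    using assms(1,2) by (simp add: F.minus_eq F.a_assoc F.l_neg)
  then have "x \<in> I +>\<^bsub>F\<^esub> y" using assms I_subset F.a_rcosI by metis
  then show ?thesis
    using F.a_repr_independence[OF _ assms(2) I.a_subgroup] by simp
qed

lemma carrier_T: "carrier T = a_rcosets\<^bsub>F\<^esub> I"
  by (simp add: tensor_mod_def Let_def)

lemma coset_closed: "x \<in> carrier F \<Longrightarrow> I +>\<^bsub>F\<^esub> x \<in> carrier T"
  by (simp add: carrier_T F.a_rcosetsI[OF I_subset])

lemma T_cases:
  assumes "X \<in> carrier T"
  obtains x where "x \<in> carrier F" "X = I +>\<^bsub>F\<^esub> x"
  using assms by (auto simp: carrier_T A_RCOSETS_def')

lemma T_zero: "\<zero>\<^bsub>T\<^esub> = I +>\<^bsub>F\<^esub> \<zero>\<^bsub>F\<^esub>"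
  using F.a_coset_add_zero[OF I_subset] by (simp add: tensor_mod_def Let_def)

lemma T_add:
  assumes "x \<in> carrier F" "y \<in> carrier F"
  shows "(I +>\<^bsub>F\<^esub> x) \<oplus>\<^bsub>T\<^esub> (I +>\<^bsub>F\<^esub> y) = I +>\<^bsub>F\<^esub> (x \<oplus>\<^bsub>F\<^esub> y)"
  using I.a_rcos_sum[OF assms] by (simp add: tensor_mod_def Let_def)

text \<open>The scalar action is defined as a union over all representatives of a coset. All of them
  yield the same coset because \<open>I\<close> is stable under scalars, and \<open>x\<close> itself
  is a representative, so the union is exactly that coset.\<close>

lemma T_smult:
  assumes a: "a \<in> carrier k" and x: "x \<in> carrier F"
  shows "a \<odot>\<^bsub>T\<^esub> (I +>\<^bsub>F\<^esub> x) = I +>\<^bsub>F\<^esub> (a \<odot>\<^bsub>F\<^esub> x)"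
proof -
  have eq: "I +>\<^bsub>F\<^esub> (a \<odot>\<^bsub>F\<^esub> y) = I +>\<^bsub>F\<^esub> (a \<odot>\<^bsub>F\<^esub> x)" if y: "y \<in> I +>\<^bsub>F\<^esub> x" for y
  proof -
    obtain i where i: "i \<in> I" "y = i \<oplus>\<^bsub>F\<^esub> x" using y by (auto simp: a_r_coset_def')
    have iF: "i \<in> carrier F" using i I_subset by auto
    have "a \<odot>\<^bsub>F\<^esub> y = (a \<odot>\<^bsub>F\<^esub> i) \<oplus>\<^bsub>F\<^esub> (a \<odot>\<^bsub>F\<^esub> x)"
      unfolding i(2) by (rule F.smult_r_distr[OF a iF x])
    moreover have "a \<odot>\<^bsub>F\<^esub> i \<in> I" using F.submoduleE(4)[OF submodule_I a] i by simp
    ultimately have "a \<odot>\<^bsub>F\<^esub> y \<in> I +>\<^bsub>F\<^esub> (a \<odot>\<^bsub>F\<^esub> x)" by (auto simp: a_r_coset_def')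
    then show ?thesis
      using F.a_repr_independence[OF _ F.smult_closed[OF a x] I.a_subgroup] by simp
  qed
  have "x \<in> I +>\<^bsub>F\<^esub> x" by (rule I.a_rcos_self[OF x])
  have "a \<odot>\<^bsub>T\<^esub> (I +>\<^bsub>F\<^esub> x) = (\<Union>y\<in>I +>\<^bsub>F\<^esub> x. I +>\<^bsub>F\<^esub> (a \<odot>\<^bsub>F\<^esub> y))"
    by (simp add: tensor_mod_def Let_def quotient_smult_def)
  also have "\<dots> = I +>\<^bsub>F\<^esub> (a \<odot>\<^bsub>F\<^esub> x)"
    using eq \<open>x \<in> I +>\<^bsub>F\<^esub> x\<close> by blast
  finally show ?thesis .
qed

lemma tens_eq: "m \<boxtimes>\<^bsub>T\<^esub> n = I +>\<^bsub>F\<^esub> gen m n"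
  by (simp add: tensor_mod_def Let_def)

lemma module_T: "module k T"
proof (intro moduleI abelian_groupI M.is_cring)
  fix X Y Z assume X: "X \<in> carrier T"
  then obtain x where x: "x \<in> carrier F" "X = I +>\<^bsub>F\<^esub> x" by (rule T_cases)
  show "\<zero>\<^bsub>T\<^esub> \<oplus>\<^bsub>T\<^esub> X = X" using x T_add[OF F.zero_closed x(1)] F.l_zero[OF x(1)]
    by (simp only: T_zero)
  show "\<one>\<^bsub>k\<^esub> \<odot>\<^bsub>T\<^esub> X = X" using x T_smult[OF M.one_closed x(1)] F.smult_one[OF x(1)] by metis
  show "\<exists>Y\<in>carrier T. Y \<oplus>\<^bsub>T\<^esub> X = \<zero>\<^bsub>T\<^esub>"
    using T_add[OF F.a_inv_closed[OF x(1)] x(1)] F.l_neg[OF x(1)] x(2) T_zero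
      coset_closed[OF F.a_inv_closed[OF x(1)]] by metis
  assume "Y \<in> carrier T"
  then obtain y where y: "y \<in> carrier F" "Y = I +>\<^bsub>F\<^esub> y" by (rule T_cases)
  show "X \<oplus>\<^bsub>T\<^esub> Y \<in> carrier T"
    using T_add[OF x(1) y(1)] coset_closed[OF F.a_closed[OF x(1) y(1)]] x y by simp
  show "X \<oplus>\<^bsub>T\<^esub> Y = Y \<oplus>\<^bsub>T\<^esub> X"
    using T_add[OF x(1) y(1)] T_add[OF y(1) x(1)] F.a_comm[OF x(1) y(1)] x y by metis
  assume "Z \<in> carrier T"
  then obtain z where z: "z \<in> carrier F" "Z = I +>\<^bsub>F\<^esub> z" by (rule T_cases)
  show "(X \<oplus>\<^bsub>T\<^esub> Y) \<oplus>\<^bsub>T\<^esub> Z = X \<oplus>\<^bsub>T\<^esub> (Y \<oplus>\<^bsub>T\<^esub> Z)"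
    using T_add[OF x(1) y(1)] T_add[OF y(1) z(1)] T_add[OF F.a_closed[OF x(1) y(1)] z(1)]
      T_add[OF x(1) F.a_closed[OF y(1) z(1)]] F.a_assoc[OF x(1) y(1) z(1)] x y z by metis
next
  fix a X assume a: "a \<in> carrier k" and X: "X \<in> carrier T"
  then obtain x where x: "x \<in> carrier F" "X = I +>\<^bsub>F\<^esub> x" by (auto elim: T_cases)
  show "a \<odot>\<^bsub>T\<^esub> X \<in> carrier T"
    using T_smult[OF a x(1)] coset_closed[OF F.smult_closed[OF a x(1)]] x by simp
  {
    fix b assume b: "b \<in> carrier k"
    show "(a \<oplus>\<^bsub>k\<^esub> b) \<odot>\<^bsub>T\<^esub> X = a \<odot>\<^bsub>T\<^esub> X \<oplus>\<^bsub>T\<^esub> b \<odot>\<^bsub>T\<^esub> X"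
      using T_smult[OF a x(1)] T_smult[OF b x(1)] T_smult[OF M.R.a_closed[OF a b] x(1)]
        T_add[OF F.smult_closed[OF a x(1)] F.smult_closed[OF b x(1)]]
        F.smult_l_distr[OF a b x(1)] x by metis
    show "(a \<otimes>\<^bsub>k\<^esub> b) \<odot>\<^bsub>T\<^esub> X = a \<odot>\<^bsub>T\<^esub> (b \<odot>\<^bsub>T\<^esub> X)"
      using T_smult[OF b x(1)] T_smult[OF a F.smult_closed[OF b x(1)]]
        T_smult[OF M.R.m_closed[OF a b] x(1)] F.smult_assoc1[OF a b x(1)] x by metis
  }
  fix Y assume "Y \<in> carrier T"
  then obtain y where y: "y \<in> carrier F" "Y = I +>\<^bsub>F\<^esub> y" by (rule T_cases)
  show "a \<odot>\<^bsub>T\<^esub> (X \<oplus>\<^bsub>T\<^esub> Y) = a \<odot>\<^bsub>T\<^esub> X \<oplus>\<^bsub>T\<^esub> a \<odot>\<^bsub>T\<^esub> Y"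
    using T_smult[OF a x(1)] T_smult[OF a y(1)] T_smult[OF a F.a_closed[OF x(1) y(1)]]
      T_add[OF F.smult_closed[OF a x(1)] F.smult_closed[OF a y(1)]] T_add[OF x(1) y(1)]
      F.smult_r_distr[OF a x(1) y(1)] x y by metis
qed (simp add: T_zero coset_closed)

sublocale T: module k T
  by (rule module_T)

lemma relation_coset_eq:
  assumes "x \<ominus>\<^bsub>F\<^esub> y \<in> tensor_relations k M N E" "x \<in> carrier F" "y \<in> carrier F"
  shows "I +>\<^bsub>F\<^esub> x = I +>\<^bsub>F\<^esub> y"
  using coset_eqI[OF assms(2,3)] assms(1) generated_submodule_incl[of _ k F] by auto

lemma tens_closed: "\<lbrakk>m \<in> carrier M; n \<in> carrier N\<rbrakk> \<Longrightarrow> m \<boxtimes>\<^bsub>T\<^esub> n \<in> carrier T"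
  by (simp add: tens_eq coset_closed gen_closed)

lemma tens_bilinear: "tens T \<in> bilinear_maps k M N T"
proof (intro bilinear_mapsI linear_mapsI tens_closed)
  fix m n n' assume *: "m \<in> carrier M" "n \<in> carrier N" "n' \<in> carrier N"
  have "gen m (n \<oplus>\<^bsub>N\<^esub> n') \<ominus>\<^bsub>F\<^esub> (gen m n \<oplus>\<^bsub>F\<^esub> gen m n') \<in> tensor_relations k M N E"
    using * unfolding tensor_relations_def Let_def by blast
  from relation_coset_eq[OF this] * show "m \<boxtimes>\<^bsub>T\<^esub> (n \<oplus>\<^bsub>N\<^esub> n') = m \<boxtimes>\<^bsub>T\<^esub> n \<oplus>\<^bsub>T\<^esub> m \<boxtimes>\<^bsub>T\<^esub> n'"
    unfolding tens_eq by (subst T_add) (auto intro!: gen_closed F.a_closed)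
next
  fix m n a assume *: "m \<in> carrier M" "n \<in> carrier N" "a \<in> carrier k"
  have "gen m (a \<odot>\<^bsub>N\<^esub> n) \<ominus>\<^bsub>F\<^esub> (a \<odot>\<^bsub>F\<^esub> gen m n) \<in> tensor_relations k M N E"
    using * unfolding tensor_relations_def Let_def by blast
  from relation_coset_eq[OF this] * show "m \<boxtimes>\<^bsub>T\<^esub> (a \<odot>\<^bsub>N\<^esub> n) = a \<odot>\<^bsub>T\<^esub> (m \<boxtimes>\<^bsub>T\<^esub> n)"
    unfolding tens_eq by (subst T_smult) (auto intro!: gen_closed F.smult_closed)
next
  fix m m' n assume *: "m \<in> carrier M" "m' \<in> carrier M" "n \<in> carrier N"
  have "gen (m \<oplus>\<^bsub>M\<^esub> m') n \<ominus>\<^bsub>F\<^esub> (gen m n \<oplus>\<^bsub>F\<^esub> gen m' n) \<in> tensor_relations k M N E"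
    using * unfolding tensor_relations_def Let_def by blast
  from relation_coset_eq[OF this] * show "(m \<oplus>\<^bsub>M\<^esub> m') \<boxtimes>\<^bsub>T\<^esub> n = m \<boxtimes>\<^bsub>T\<^esub> n \<oplus>\<^bsub>T\<^esub> m' \<boxtimes>\<^bsub>T\<^esub> n"
    unfolding tens_eq by (subst T_add) (auto intro!: gen_closed F.a_closed)
next
  fix m n a assume *: "m \<in> carrier M" "n \<in> carrier N" "a \<in> carrier k"
  have "gen (a \<odot>\<^bsub>M\<^esub> m) n \<ominus>\<^bsub>F\<^esub> (a \<odot>\<^bsub>F\<^esub> gen m n) \<in> tensor_relations k M N E"
    using * unfolding tensor_relations_def Let_def by blast
  from relation_coset_eq[OF this] * show "(a \<odot>\<^bsub>M\<^esub> m) \<boxtimes>\<^bsub>T\<^esub> n = a \<odot>\<^bsub>T\<^esub> (m \<boxtimes>\<^bsub>T\<^esub> n)"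
    unfolding tens_eq by (subst T_smult) (auto intro!: gen_closed F.smult_closed)
qed

lemma tens_balanced: "balanced E (tens T)"
  unfolding balanced_def
proof clarify
  fix m n m' n' assume *: "((m, n), (m', n')) \<in> E"
  then have "gen m n \<ominus>\<^bsub>F\<^esub> gen m' n' \<in> tensor_relations k M N E"
    unfolding tensor_relations_def Let_def by blast
  from relation_coset_eq[OF this] * E_sub show "m \<boxtimes>\<^bsub>T\<^esub> n = m' \<boxtimes>\<^bsub>T\<^esub> n'"
    unfolding tens_eq by (auto intro!: gen_closed)
qed

text \<open>Multiples of pure tensors need no case of their own: a coefficient is absorbed by
  \<open>a (m \<otimes> n) = (a m) \<otimes> n\<close>.\<close>

lemma tensor_induct [consumes 1, case_names zero add tens]:
  assumes X: "X \<in> carrier T" and zero: "P \<zero>\<^bsub>T\<^esub>"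
    and add: "\<And>X Y. \<lbrakk>X \<in> carrier T; Y \<in> carrier T; P X; P Y\<rbrakk> \<Longrightarrow> P (X \<oplus>\<^bsub>T\<^esub> Y)"
    and tens: "\<And>m n. \<lbrakk>m \<in> carrier M; n \<in> carrier N\<rbrakk> \<Longrightarrow> P (m \<boxtimes>\<^bsub>T\<^esub> n)"
  shows "P X"
proof -
  have "P (I +>\<^bsub>F\<^esub> x)" if "x \<in> carrier F" for x
    using M.is_cring that
  proof (induction rule: free_module_induct)
    case zero
    then show ?case using assms(2) by (simp add: T_zero free_module_simps)
  next
    case (add_smult_gen a b y)
    obtain m n where b: "b = (m, n)" "m \<in> carrier M" "n \<in> carrier N"
      using add_smult_gen by auto
    have ag: "a \<odot>\<^bsub>F\<^esub> gen m n \<in> carrier F"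
      using add_smult_gen b by (intro F.smult_closed gen_closed)
    have "I +>\<^bsub>F\<^esub> (a \<odot>\<^bsub>F\<^esub> gen m n) = (a \<odot>\<^bsub>M\<^esub> m) \<boxtimes>\<^bsub>T\<^esub> n"
      using linear_smult[OF bilinear_left[OF tens_bilinear b(3)] add_smult_gen(1) b(2)]
        T_smult[OF add_smult_gen(1) gen_closed[OF b(2,3)]] unfolding tens_eq by simp
    then have "P (I +>\<^bsub>F\<^esub> (a \<odot>\<^bsub>F\<^esub> gen m n))"
      using tens[OF M.smult_closed[OF add_smult_gen(1) b(2)] b(3)] by simp
    then show ?case
      using add[OF coset_closed[OF ag] coset_closed[OF add_smult_gen(3)]] add_smult_gen
        T_add[OF ag add_smult_gen(3)] by (simp add: b(1))
  qed
  then show ?thesis using X by (auto elim: T_cases)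
qed

context
  fixes P :: "('k, 'p, 'w) module_scheme" and B
  assumes P: "module k P" and B: "B \<in> bilinear_maps k M N P" "balanced E B"
begin

interpretation P: module k P by (rule P)

lemma free_lift_lin: "free_lift k P B \<in> linear_maps k F P"
  using P B by (intro free_lift_linear) (auto intro: bilinear_closed)

lemma free_lift_relations:
  assumes "x \<in> tensor_relations k M N E"
  shows "free_lift k P B x = \<zero>\<^bsub>P\<^esub>"
proof -
  have gen: "free_lift k P B (gen m n) = B m n" if "m \<in> carrier M" "n \<in> carrier N" for m n
    using that by (intro free_lift_gen P bilinear_closed[OF B(1)])
  note lin = linear_add[OF free_lift_lin] linear_smult[OF free_lift_lin] gen gen_closed F.a_closed F.smult_closed bilinear_closed[OF B(1)]
  have *: "free_lift k P B (x \<ominus>\<^bsub>F\<^esub> y) = \<zero>\<^bsub>P\<^esub>"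
    if "free_lift k P B x = free_lift k P B y" "x \<in> carrier F" "y \<in> carrier F" for x y
    using linear_minus[OF module_F P free_lift_lin that(2,3)] that
      linear_closed[OF free_lift_lin that(3)] by (simp add: P.minus_eq P.r_neg)
  note lr = linear_add[OF bilinear_left[OF B(1)]] linear_add[OF bilinear_right[OF B(1)]]
    linear_smult[OF bilinear_left[OF B(1)]] linear_smult[OF bilinear_right[OF B(1)]]
  show ?thesis
    using assms unfolding tensor_relations_def Let_def
  proof safe
    fix m n m' n' assume E: "((m, n), (m', n')) \<in> E"
    then have "B m n = B m' n'" using B(2) by (auto simp: balanced_def)
    then show "free_lift k P B (gen m n \<ominus>\<^bsub>F\<^esub> gen m' n') = \<zero>\<^bsub>P\<^esub>"
      using E E_sub by (intro *) (auto simp: lin)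
  qed (intro *; simp add: lin lr M.smult_closed N.smult_closed)+
qed

text \<open>The kernel of the free lift is a submodule containing the relations, hence contains the
  submodule they generate.\<close>

lemma free_lift_I: "x \<in> I \<Longrightarrow> free_lift k P B x = \<zero>\<^bsub>P\<^esub>"
  using generated_submodule_least[OF kernel_submodule[OF module_F P free_lift_lin]]
    relations_closed free_lift_relations by blast

text \<open>The free lift vanishes on \<open>I\<close> and is therefore constant on a coset. Its
  image there is a singleton, which gives \<open>the_elem\<close> in the definition of
  \<open>tlift\<close> its intended value.\<close>

lemma tlift_coset:
  assumes x: "x \<in> carrier F"
  shows "tlift k P B (I +>\<^bsub>F\<^esub> x) = free_lift k P B x"
proof -
  have "free_lift k P B y = free_lift k P B x" if y: "y \<in> I +>\<^bsub>F\<^esub> x" for y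
  proof -
    obtain i where i: "i \<in> I" "y = i \<oplus>\<^bsub>F\<^esub> x" using y by (auto simp: a_r_coset_def')
    then show ?thesis
      using linear_add[OF free_lift_lin _ x, of i] free_lift_I[OF i(1)] I_subset
        linear_closed[OF free_lift_lin x] by auto
  qed
  then have "free_lift k P B ` (I +>\<^bsub>F\<^esub> x) = {free_lift k P B x}"
    using I.a_rcos_self[OF x] by blast
  then show ?thesis by (simp add: tlift_def)
qed

lemma tlift_linear: "tlift k P B \<in> linear_maps k T P"
proof (rule linear_mapsI)
  fix X assume X: "X \<in> carrier T"
  then obtain x where x: "x \<in> carrier F" "X = I +>\<^bsub>F\<^esub> x" by (rule T_cases)
  show "tlift k P B X \<in> carrier P"
    using x linear_closed[OF free_lift_lin] by (simp add: tlift_coset)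
  show "tlift k P B (a \<odot>\<^bsub>T\<^esub> X) = a \<odot>\<^bsub>P\<^esub> tlift k P B X" if a: "a \<in> carrier k" for a
    using x a T_smult[OF a x(1)] linear_smult[OF free_lift_lin a x(1)]
      tlift_coset[OF x(1)] tlift_coset[OF F.smult_closed[OF a x(1)]] by simp
  fix Y assume "Y \<in> carrier T"
  then obtain y where y: "y \<in> carrier F" "Y = I +>\<^bsub>F\<^esub> y" by (rule T_cases)
  show "tlift k P B (X \<oplus>\<^bsub>T\<^esub> Y) = tlift k P B X \<oplus>\<^bsub>P\<^esub> tlift k P B Y"
    using x y T_add[OF x(1) y(1)] linear_add[OF free_lift_lin x(1) y(1)]
      tlift_coset[OF x(1)] tlift_coset[OF y(1)] tlift_coset[OF F.a_closed[OF x(1) y(1)]] by simp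
qed

lemma tlift_tens:
  assumes "m \<in> carrier M" "n \<in> carrier N"
  shows "tlift k P B (m \<boxtimes>\<^bsub>T\<^esub> n) = B m n"
  unfolding tens_eq using assms
  by (simp add: tlift_coset gen_closed free_lift_gen P bilinear_closed[OF B(1)])

end

lemma tlift_closed:
  "\<lbrakk>module k P; B \<in> bilinear_maps k M N P; balanced E B; X \<in> carrier T\<rbrakk> \<Longrightarrow>
    tlift k P B X \<in> carrier P"
  by (rule linear_closed[OF tlift_linear])

lemma tlift_add:
  "\<lbrakk>module k P; B \<in> bilinear_maps k M N P; balanced E B; X \<in> carrier T; Y \<in> carrier T\<rbrakk> \<Longrightarrow>
    tlift k P B (X \<oplus>\<^bsub>T\<^esub> Y) = tlift k P B X \<oplus>\<^bsub>P\<^esub> tlift k P B Y"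
  by (rule linear_add[OF tlift_linear])

lemma tlift_zero:
  "\<lbrakk>module k P; B \<in> bilinear_maps k M N P; balanced E B\<rbrakk> \<Longrightarrow> tlift k P B \<zero>\<^bsub>T\<^esub> = \<zero>\<^bsub>P\<^esub>"
  by (rule linear_zero[OF module_T _ tlift_linear])

lemma additive_eqI:
  assumes "abelian_group P" "X \<in> carrier T"
    and "\<And>X. X \<in> carrier T \<Longrightarrow> f X \<in> carrier P" "\<And>X. X \<in> carrier T \<Longrightarrow> g X \<in> carrier P"
    and "\<And>X Y. \<lbrakk>X \<in> carrier T; Y \<in> carrier T\<rbrakk> \<Longrightarrow> f (X \<oplus>\<^bsub>T\<^esub> Y) = f X \<oplus>\<^bsub>P\<^esub> f Y"
    and "\<And>X Y. \<lbrakk>X \<in> carrier T; Y \<in> carrier T\<rbrakk> \<Longrightarrow> g (X \<oplus>\<^bsub>T\<^esub> Y) = g X \<oplus>\<^bsub>P\<^esub> g Y"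
    and "\<And>m n. \<lbrakk>m \<in> carrier M; n \<in> carrier N\<rbrakk> \<Longrightarrow> f (m \<boxtimes>\<^bsub>T\<^esub> n) = g (m \<boxtimes>\<^bsub>T\<^esub> n)"
  shows "f X = g X"
  using assms(2)
proof (induction rule: tensor_induct)
  case zero
  show ?case
    using additive_zero[OF T.abelian_group_axioms assms(1) assms(3) assms(5)]
      additive_zero[OF T.abelian_group_axioms assms(1) assms(4) assms(6)] by simp
qed (simp_all add: assms)

lemma linear_eqI:
  assumes "module k P" "X \<in> carrier T" "f \<in> linear_maps k T P" "g \<in> linear_maps k T P"
    and "\<And>m n. \<lbrakk>m \<in> carrier M; n \<in> carrier N\<rbrakk> \<Longrightarrow> f (m \<boxtimes>\<^bsub>T\<^esub> n) = g (m \<boxtimes>\<^bsub>T\<^esub> n)"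
  shows "f X = g X"
  by (rule additive_eqI[OF abelian_group_of_module[OF assms(1)] assms(2) linear_closed[OF assms(3)]
      linear_closed[OF assms(4)] linear_add[OF assms(3)] linear_add[OF assms(4)] assms(5)])

lemma tlift_comp:
  assumes "module k P" "module k Q" "g \<in> linear_maps k P Q"
    and "B \<in> bilinear_maps k M N P" "balanced E B" "X \<in> carrier T"
  shows "g (tlift k P B X) = tlift k Q (\<lambda>m n. g (B m n)) X"
proof -
  have B': "(\<lambda>m n. g (B m n)) \<in> bilinear_maps k M N Q" "balanced E (\<lambda>m n. g (B m n))"
    using assms bilinear_comp by (auto simp: balanced_def)
  show ?thesis
    by (rule linear_eqI[OF assms(2,6) linear_comp[OF assms(3) tlift_linear[OF assms(1,4,5)]]
        tlift_linear[OF assms(2) B']])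
      (simp add: tlift_tens assms B')
qed

text \<open>Bilinearity and balancedness are demanded of \<open>B\<close> only. Both pass to
  \<open>B'\<close>, since they depend on values on the carriers and \<open>E\<close> stays inside
  them; so the body of a lift can be rewritten with knowledge of one side.\<close>

lemma tlift_cong:
  assumes "\<And>m n. \<lbrakk>m \<in> carrier M; n \<in> carrier N\<rbrakk> \<Longrightarrow> B m n = B' m n"
    and "module k P" "B \<in> bilinear_maps k M N P" "balanced E B" "X \<in> carrier T"
  shows "tlift k P B X = tlift k P B' X"
proof -
  have B': "B' \<in> bilinear_maps k M N P"
    by (rule iffD1[OF bilinear_cong[OF assms(1) M.module_axioms N.module_axioms] assms(3)])
  moreover have "balanced E B'"
    unfolding balanced_def
  proof clarify
    fix m n m' n' assume e: "((m, n), (m', n')) \<in> E"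
    then have "m \<in> carrier M" "n \<in> carrier N" "m' \<in> carrier M" "n' \<in> carrier N"
      using E_sub by auto
    moreover have "B m n = B m' n'" using assms(4) e by (auto simp: balanced_def)
    ultimately show "B' m n = B' m' n'" using assms(1) by metis
  qed
  ultimately show ?thesis
    by (intro linear_eqI[OF assms(2,5) tlift_linear[OF assms(2-4)] tlift_linear[OF assms(2)]])
      (simp_all add: tlift_tens assms)
qed

text \<open>Here the tensor \<open>X\<close> is fixed and the body varies, so the linearity of a
  lift in its tensor does not help; induction on \<open>X\<close> reduces the claim to pure tensors.
  This is the device that makes nested lifts bilinear.\<close>

lemma tlift_param_linear:
  assumes "module k C" "module k P"
    and "\<And>c. c \<in> carrier C \<Longrightarrow> B c \<in> bilinear_maps k M N P"
    and "\<And>c. c \<in> carrier C \<Longrightarrow> balanced E (B c)"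
    and "\<And>m n. \<lbrakk>m \<in> carrier M; n \<in> carrier N\<rbrakk> \<Longrightarrow> (\<lambda>c. B c m n) \<in> linear_maps k C P"
    and "X \<in> carrier T"
  shows "(\<lambda>c. tlift k P (B c) X) \<in> linear_maps k C P"
proof -
  interpret C: module k C by fact
  interpret P: module k P by fact
  show ?thesis
    using assms(6)
  proof (induction rule: tensor_induct)
    case zero
    then show ?case using assms by (intro linear_mapsI) (auto simp: tlift_zero)
  next
    case (add X Y)
    then have "(\<lambda>c. tlift k P (B c) (X \<oplus>\<^bsub>T\<^esub> Y)) \<in> linear_maps k C P \<longleftrightarrow>
        (\<lambda>c. tlift k P (B c) X \<oplus>\<^bsub>P\<^esub> tlift k P (B c) Y) \<in> linear_maps k C P"
      by (intro linear_cong) (auto simp: tlift_add assms)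
    then show ?case using add linear_plus[OF assms(2)] by blast
  next
    case (tens m n)
    have "(\<lambda>c. tlift k P (B c) (m \<boxtimes>\<^bsub>T\<^esub> n)) \<in> linear_maps k C P \<longleftrightarrow>
        (\<lambda>c. B c m n) \<in> linear_maps k C P"
      using assms tens by (intro linear_cong) (auto simp: tlift_tens)
    then show ?case using assms(5) tens by simp
  qed
qed

end

section \<open>Plain tensor products, without balancing pairs\<close>

lemma tensor_product_empty:
  "\<lbrakk>module k M; module k N\<rbrakk> \<Longrightarrow> tensor_product k M N {}"
  by (simp add: tensor_product_def tensor_product_axioms_def)

lemmas module_tensor = tensor_product.module_T[OF tensor_product_empty, folded tensor_def]
lemmas tensor_tens_bilinear = tensor_product.tens_bilinear[OF tensor_product_empty, folded tensor_def]
lemmas tensor_tlift_linear =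
  tensor_product.tlift_linear[OF tensor_product_empty _ _ balanced_empty, folded tensor_def]
lemmas tensor_tlift_tens =
  tensor_product.tlift_tens[OF tensor_product_empty _ _ balanced_empty, folded tensor_def]
lemmas tensor_tlift_comp =
  tensor_product.tlift_comp[OF tensor_product_empty _ _ _ _ balanced_empty, folded tensor_def]
lemmas tensor_tlift_cong =
  tensor_product.tlift_cong[OF tensor_product_empty _ _ _ balanced_empty, folded tensor_def]
lemmas tensor_tlift_param_linear =
  tensor_product.tlift_param_linear[OF tensor_product_empty _ _ _ balanced_empty, folded tensor_def]
lemmas tensor_linear_eqI = tensor_product.linear_eqI[OF tensor_product_empty, folded tensor_def]

lemma bilinear_smult:
  assumes "module k N" "f \<in> linear_maps k M (self_module k)"
  shows "(\<lambda>m n. f m \<odot>\<^bsub>N\<^esub> n) \<in> bilinear_maps k M N N"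
proof (rule bilinear_mapsI)
  fix m assume "m \<in> carrier M"
  then have "f m \<in> carrier k" using linear_closed[OF assms(2)] by simp
  then show "(\<lambda>n. f m \<odot>\<^bsub>N\<^esub> n) \<in> linear_maps k N N"
    by (rule linear_smult_right[OF assms(1) linear_id])
next
  fix n assume "n \<in> carrier N"
  then show "(\<lambda>m. f m \<odot>\<^bsub>N\<^esub> n) \<in> linear_maps k M N" by (rule linear_smult_left[OF assms])
qed

section \<open>The dual module and evaluation\<close>

lemma dual_carrier: "carrier (dual k M) = Hom k M (self_module k)"
  by (simp add: dual_def)

lemma dual_linear: "f \<in> carrier (dual k M) \<Longrightarrow> f \<in> linear_maps k M (self_module k)"
  by (simp add: dual_carrier Hom_def)

lemma dual_closed: "\<lbrakk>f \<in> carrier (dual k M); m \<in> carrier M\<rbrakk> \<Longrightarrow> f m \<in> carrier k"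
  using linear_closed[OF dual_linear] by fastforce

text \<open>Elements of the dual are \<open>undefined\<close> off the carrier, so a linear
  functional enters it only after restriction, with its linearity unaffected.\<close>

lemma dual_restrict:
  assumes "module k M" "f \<in> linear_maps k M (self_module k)"
  shows "(\<lambda>m\<in>carrier M. f m) \<in> carrier (dual k M)"
proof -
  have "(\<lambda>m\<in>carrier M. f m) \<in> linear_maps k M (self_module k)"
    by (rule iffD2[OF linear_cong[OF _ assms(1)] assms(2)]) simp
  then show ?thesis by (simp add: dual_carrier Hom_def)
qed

lemma dual_eqI:
  assumes "f \<in> carrier (dual k M)" "g \<in> carrier (dual k M)"
    and "\<And>m. m \<in> carrier M \<Longrightarrow> f m = g m"
  shows "f = g"
  using assms by (auto simp: dual_carrier Hom_def intro: extensionalityI)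

lemma dual_add [simp]: "m \<in> carrier M \<Longrightarrow> (f \<oplus>\<^bsub>dual k M\<^esub> g) m = f m \<oplus>\<^bsub>k\<^esub> g m"
  by (simp add: dual_def)

lemma dual_smult [simp]: "m \<in> carrier M \<Longrightarrow> (a \<odot>\<^bsub>dual k M\<^esub> f) m = a \<otimes>\<^bsub>k\<^esub> f m"
  by (simp add: dual_def)

lemma dual_zero [simp]: "m \<in> carrier M \<Longrightarrow> \<zero>\<^bsub>dual k M\<^esub> m = \<zero>\<^bsub>k\<^esub>"
  by (simp add: dual_def)

lemma module_dual:
  assumes M: "module k M"
  shows "module k (dual k M)"
proof -
  interpret M: module k M by fact
  note self = module_self[OF M.is_cring]
  have add: "f \<oplus>\<^bsub>dual k M\<^esub> g \<in> carrier (dual k M)"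
    if "f \<in> carrier (dual k M)" "g \<in> carrier (dual k M)" for f g
    using dual_restrict[OF M linear_plus[OF self that[THEN dual_linear]]]
    by (simp add: dual_def)
  have smult: "a \<odot>\<^bsub>dual k M\<^esub> f \<in> carrier (dual k M)"
    if "f \<in> carrier (dual k M)" "a \<in> carrier k" for f a
    using dual_restrict[OF M linear_smult_right[OF self dual_linear[OF that(1)] that(2)]]
    by (simp add: dual_def)
  have zero: "\<zero>\<^bsub>dual k M\<^esub> \<in> carrier (dual k M)"
    using dual_restrict[OF M, of "\<lambda>_. \<zero>\<^bsub>k\<^esub>"] by (simp add: linear_maps_def dual_def)
  have neg: "\<exists>g\<in>carrier (dual k M). g \<oplus>\<^bsub>dual k M\<^esub> f = \<zero>\<^bsub>dual k M\<^esub>"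
    if f: "f \<in> carrier (dual k M)" for f
  proof (rule bexI)
    show n: "\<ominus>\<^bsub>k\<^esub> \<one>\<^bsub>k\<^esub> \<odot>\<^bsub>dual k M\<^esub> f \<in> carrier (dual k M)" using smult[OF f] by simp
    show "\<ominus>\<^bsub>k\<^esub> \<one>\<^bsub>k\<^esub> \<odot>\<^bsub>dual k M\<^esub> f \<oplus>\<^bsub>dual k M\<^esub> f = \<zero>\<^bsub>dual k M\<^esub>"
      by (rule dual_eqI[OF add[OF n f] zero])
        (simp add: dual_closed[OF f] M.R.l_minus M.R.l_neg)
  qed
  show ?thesis
    by (intro moduleI abelian_groupI M.is_cring add smult zero neg dual_eqI[of _ k M])
      (simp_all add: add smult zero dual_closed M.R.l_distr M.R.r_distr M.R.m_assoc M.R.a_ac)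
qed

lemma dual_eval_bilinear:
  "module k M \<Longrightarrow> (\<lambda>f m. f m) \<in> bilinear_maps k (dual k M) M (self_module k)"
  by (intro bilinear_mapsI dual_linear linear_mapsI) (simp_all add: dual_closed)


section \<open>Abelian groups as modules over the integers\<close>

lemma int_module_simps [simp]:
  "carrier (int_module G) = carrier G" "zero (int_module G) = \<zero>\<^bsub>G\<^esub>"
  "add (int_module G) = add G" "smult (int_module G) = (\<lambda>n x. [n] \<cdot>\<^bsub>G\<^esub> x)"
  by (simp_all add: int_module_def)

lemma module_int_module:
  assumes "abelian_group G"
  shows "module \<Z> (int_module G)"
proof -
  interpret G: abelian_group G by fact
  \<comment> \<open>Integer multiples are integer powers in the additive monoid, so the module laws
    are the power laws of a commutative group.\<close>
  have pow: "[n] \<cdot>\<^bsub>G\<^esub> x = x [^]\<^bsub>add_monoid G\<^esub> n" for n :: int and x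
    by (simp add: add_pow_def)
  have "abelian_group (int_module G)"
  proof (rule abelian_groupI)
    show "\<exists>y\<in>carrier (int_module G). y \<oplus>\<^bsub>int_module G\<^esub> x = \<zero>\<^bsub>int_module G\<^esub>"
      if "x \<in> carrier (int_module G)" for x
      using that G.l_neg[of x] G.a_inv_closed[of x] by auto
  qed (simp_all add: G.a_ac)
  moreover have "[n] \<cdot>\<^bsub>G\<^esub> x \<in> carrier G" if "x \<in> carrier G" for n :: int and x
    unfolding pow using group.int_pow_closed[OF G.a_group] that by simp
  moreover have "[(n + m)] \<cdot>\<^bsub>G\<^esub> x = [n] \<cdot>\<^bsub>G\<^esub> x \<oplus>\<^bsub>G\<^esub> [m] \<cdot>\<^bsub>G\<^esub> x" if "x \<in> carrier G" for n m :: int and x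
    unfolding pow using group.int_pow_mult[OF G.a_group, of x n m] that by simp
  moreover have "[n] \<cdot>\<^bsub>G\<^esub> (x \<oplus>\<^bsub>G\<^esub> y) = [n] \<cdot>\<^bsub>G\<^esub> x \<oplus>\<^bsub>G\<^esub> [n] \<cdot>\<^bsub>G\<^esub> y"
    if "x \<in> carrier G" "y \<in> carrier G" for n :: int and x y
    unfolding pow using comm_group.int_pow_distrib[OF G.a_comm_group, of x y n] that by simp
  moreover have "[(n * m)] \<cdot>\<^bsub>G\<^esub> x = [n] \<cdot>\<^bsub>G\<^esub> ([m] \<cdot>\<^bsub>G\<^esub> x)" if "x \<in> carrier G" for n m :: int and x
    unfolding pow using group.int_pow_pow[OF G.a_group, of x m n] that by (simp add: mult.commute)
  moreover have "[(1 :: int)] \<cdot>\<^bsub>G\<^esub> x = x" if "x \<in> carrier G" for x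
    unfolding pow using group.int_pow_1[OF G.a_group, of x] that by simp
  ultimately show ?thesis
    by (intro moduleI int_is_cring) simp_all
qed

text \<open>A group homomorphism commutes with integer powers, so additivity alone gives linearity
  over the integers.\<close>

lemma int_linearI:
  assumes "abelian_group G" "abelian_group G'"
    and "\<And>x. x \<in> carrier G \<Longrightarrow> f x \<in> carrier G'"
    and "\<And>x y. \<lbrakk>x \<in> carrier G; y \<in> carrier G\<rbrakk> \<Longrightarrow> f (x \<oplus>\<^bsub>G\<^esub> y) = f x \<oplus>\<^bsub>G'\<^esub> f y"
  shows "f \<in> linear_maps \<Z> (int_module G) (int_module G')"
proof -
  interpret G: abelian_group G by fact
  interpret G': abelian_group G' by fact
  have "f \<in> hom (add_monoid G) (add_monoid G')" using assms by (auto simp: hom_def)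
  then have "f ([n] \<cdot>\<^bsub>G\<^esub> x) = [n] \<cdot>\<^bsub>G'\<^esub> f x" if "x \<in> carrier G" for n :: int and x
    using hom_int_pow[of f "add_monoid G" "add_monoid G'" x n] that G.a_group G'.a_group
    by (simp add: add_pow_def)
  then show ?thesis using assms by (intro linear_mapsI) auto
qed

lemma int_linear_of_linear:
  assumes "module k M" "module k N" "f \<in> linear_maps k M N"
  shows "f \<in> linear_maps \<Z> (int_module M) (int_module N)"
  using assms by (intro int_linearI) (auto simp: abelian_group_of_module linear_closed linear_add)

lemma (in nonunital_left_module) ring_tensor_product:
  "tensor_product \<Z> (int_module R) (int_module M)
    {((r \<otimes>\<^bsub>R\<^esub> s, m), (r, act s m)) | r s m. r \<in> carrier R \<and> s \<in> carrier R \<and> m \<in> carrier M}"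
  by (intro tensor_product.intro tensor_product_axioms.intro module_int_module
      R.abelian_group_axioms M.abelian_group_axioms)
    (auto simp: R.mult_closed act_closed)

lemma (in nonunital_left_module) act_bilinear:
  "act \<in> bilinear_maps \<Z> (int_module R) (int_module M) (int_module M)"
  by (intro bilinear_mapsI int_linearI R.abelian_group_axioms M.abelian_group_axioms)
    (auto simp: act_closed act_add_left act_add_right)

lemma (in nonunital_left_module) act_balanced:
  "balanced {((r \<otimes>\<^bsub>R\<^esub> s, m), (r, act s m)) | r s m.
    r \<in> carrier R \<and> s \<in> carrier R \<and> m \<in> carrier M} act"
  by (auto simp: balanced_def act_assoc)


section \<open>Firmly projective modules\<close>

definition contract ::
  "('k, 'x) ring_scheme \<Rightarrow> ('k, 'n, 'y) module_scheme \<Rightarrow> ('m \<Rightarrow> 'k) \<Rightarrow> ('m \<times> 'n \<Rightarrow> 'k) set \<Rightarrow> 'n"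
  where "contract k N f = tlift k N (\<lambda>m n. f m \<odot>\<^bsub>N\<^esub> n)"

definition tensor_act ::
  "('k, 'x) ring_scheme \<Rightarrow> ('k, 'm, 'y) module_scheme \<Rightarrow>
    ('r \<Rightarrow> ('m \<times> ('m \<Rightarrow> 'k) \<Rightarrow> 'k) set) \<Rightarrow> ('k, 'n, 'z) module_scheme \<Rightarrow>
    'r \<Rightarrow> ('m \<times> 'n \<Rightarrow> 'k) set \<Rightarrow> ('m \<times> 'n \<Rightarrow> 'k) set"
  where "tensor_act k M \<iota> N r =
    tlift k (tensor k M N) (\<lambda>m n. iota_act k M \<iota> r m \<boxtimes>\<^bsub>tensor k M N\<^esub> n)"

text \<open>This is \<open>e\<^sub>r \<otimes> W(f\<^sub>r, v)\<close>, the value that the coaction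
  below takes at \<open>r \<cdot> v\<close>. It has to be balanced in \<open>r\<close> and
  \<open>v\<close> for the coaction to make sense.\<close>

definition coact_rep ::
  "('k, 'x) ring_scheme \<Rightarrow> ('k, 'm, 'y) module_scheme \<Rightarrow>
    ('r \<Rightarrow> ('m \<times> ('m \<Rightarrow> 'k) \<Rightarrow> 'k) set) \<Rightarrow> ('k, 'n, 'z) module_scheme \<Rightarrow>
    (('m \<Rightarrow> 'k) \<Rightarrow> 'm \<Rightarrow> 'n) \<Rightarrow> 'r \<Rightarrow> 'm \<Rightarrow> ('m \<times> 'n \<Rightarrow> 'k) set"
  where "coact_rep k M \<iota> N W r v =
    tlift k (tensor k M N) (\<lambda>e g. e \<boxtimes>\<^bsub>tensor k M N\<^esub> W g v) (\<iota> r)"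

text \<open>For a bilinear and balanced map \<open>W : M\<^sup>* \<times> M \<rightarrow> N\<close>, this is \<open>m \<mapsto> e\<^sub>r \<otimes> W(f\<^sub>r, m\<^sup>r)\<close>.\<close>

definition coact ::
  "('k, 'x) ring_scheme \<Rightarrow> ('k, 'm, 'y) module_scheme \<Rightarrow> ('r, 'u) ring_scheme \<Rightarrow>
    ('r \<Rightarrow> ('m \<times> ('m \<Rightarrow> 'k) \<Rightarrow> 'k) set) \<Rightarrow> ('k, 'n, 'z) module_scheme \<Rightarrow>
    (('m \<Rightarrow> 'k) \<Rightarrow> 'm \<Rightarrow> 'n) \<Rightarrow> 'm \<Rightarrow> ('m \<times> 'n \<Rightarrow> 'k) set"
  where "coact k M R \<iota> N W m = tlift \<Z> (int_module (tensor k M N)) (coact_rep k M \<iota> N W)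
    (act_inv R M (iota_act k M \<iota>) m)"

lemma contract_linear:
  assumes "module k M" "module k N" "f \<in> carrier (dual k M)"
  shows "contract k N f \<in> linear_maps k (tensor k M N) N"
  unfolding contract_def
  by (rule tensor_tlift_linear[OF assms(1,2,2) bilinear_smult[OF assms(2) dual_linear[OF assms(3)]]])

lemma contract_tens:
  assumes "module k M" "module k N" "f \<in> carrier (dual k M)" "m \<in> carrier M" "n \<in> carrier N"
  shows "contract k N f (m \<boxtimes>\<^bsub>tensor k M N\<^esub> n) = f m \<odot>\<^bsub>N\<^esub> n"
  unfolding contract_def
  by (rule tensor_tlift_tens[OF assms(1,2,2) bilinear_smult[OF assms(2) dual_linear[OF assms(3)]]
      assms(4,5)])

text \<open>Linearity in the functional is what makes \<open>e \<otimes> contract f X\<close>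
  bilinear in \<open>e\<close> and \<open>f\<close>, so that it can be summed over
  \<open>\<iota> r\<close>.\<close>

lemma contract_linear_dual:
  assumes "module k M" "module k N" "X \<in> carrier (tensor k M N)"
  shows "(\<lambda>f. contract k N f X) \<in> linear_maps k (dual k M) N"
  unfolding contract_def
proof (rule tensor_tlift_param_linear[OF assms(1,2) module_dual[OF assms(1)] assms(2) _ _ assms(3)])
  show "(\<lambda>m n. f m \<odot>\<^bsub>N\<^esub> n) \<in> bilinear_maps k M N N" if "f \<in> carrier (dual k M)" for f
    by (rule bilinear_smult[OF assms(2) dual_linear[OF that]])
  show "(\<lambda>f. f m \<odot>\<^bsub>N\<^esub> n) \<in> linear_maps k (dual k M) N" if "m \<in> carrier M" "n \<in> carrier N" for m n
    by (rule linear_smult_left[OF assms(2) bilinear_left[OF dual_eval_bilinear[OF assms(1)] that(1)]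
        that(2)])
qed

lemma contract_comp:
  assumes "module k M" "module k N" "f \<in> carrier (dual k M)" "B \<in> bilinear_maps k A C (tensor k M N)"
    and "module k A" "module k C" "X \<in> carrier (tensor k A C)"
  shows "contract k N f (tlift k (tensor k M N) B X) = tlift k N (\<lambda>a c. contract k N f (B a c)) X"
  by (rule tensor_tlift_comp[OF assms(5,6) module_tensor[OF assms(1,2)] assms(2)
      contract_linear[OF assms(1,2,3)] assms(4,7)])

locale comatrix = firmly_projective k M R \<iota>
  for k :: "('k, 'x) ring_scheme" and M :: "('k, 'm, 'y) module_scheme"
    and R :: "('r, 'u) ring_scheme" and \<iota> :: "'r \<Rightarrow> ('m \<times> ('m \<Rightarrow> 'k) \<Rightarrow> 'k) set"
begin

abbreviation "act \<equiv> iota_act k M \<iota>"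
abbreviation "MM \<equiv> tensor k M (dual k M)"

lemma module_M: "module k M" ..

lemmas module_Md = module_dual[OF module_M]

sublocale act: nonunital_left_module R M act
  using firm_module by (simp add: firm_module_def)

lemma matrix_ring_simps:
  "carrier (matrix_ring k M) = carrier MM" "add (matrix_ring k M) = add MM"
  "X \<otimes>\<^bsub>matrix_ring k M\<^esub> Y =
    tlift k MM (\<lambda>m f. tlift k MM (\<lambda>n g. (f n \<odot>\<^bsub>M\<^esub> m) \<boxtimes>\<^bsub>MM\<^esub> g) Y) X"
  by (simp_all add: matrix_ring_def Let_def)

lemma iota_closed: "r \<in> carrier R \<Longrightarrow> \<iota> r \<in> carrier MM"
  using iota_hom by (auto simp: nonunital_ring_hom_def matrix_ring_simps)

lemma iota_add:
  "\<lbrakk>r \<in> carrier R; s \<in> carrier R\<rbrakk> \<Longrightarrow> \<iota> (r \<oplus>\<^bsub>R\<^esub> s) = \<iota> r \<oplus>\<^bsub>MM\<^esub> \<iota> s"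
  using iota_hom by (auto simp: nonunital_ring_hom_def matrix_ring_simps)

lemma iota_mult:
  "\<lbrakk>r \<in> carrier R; s \<in> carrier R\<rbrakk> \<Longrightarrow>
    \<iota> (r \<otimes>\<^bsub>R\<^esub> s) = tlift k MM (\<lambda>m f. tlift k MM (\<lambda>n g. (f n \<odot>\<^bsub>M\<^esub> m) \<boxtimes>\<^bsub>MM\<^esub> g) (\<iota> s)) (\<iota> r)"
  using iota_hom by (auto simp: nonunital_ring_hom_def matrix_ring_simps)

lemma eval_smult_bilinear:
  assumes "m \<in> carrier M"
  shows "(\<lambda>e f. f m \<odot>\<^bsub>M\<^esub> e) \<in> bilinear_maps k M (dual k M) M"
  using assms bilinear_left[OF dual_eval_bilinear[OF module_M] assms]
  by (intro bilinear_mapsI linear_smult_left[OF module_M] linear_smult_right[OF module_M] linear_id)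
    (auto intro: dual_closed)

text \<open>Scalars commute with the ring action because \<open>e\<^sub>r f\<^sub>r(m)\<close>
  depends on \<open>m\<close> only through the linear functionals \<open>f\<^sub>r\<close>.\<close>

lemma act_linear:
  assumes "r \<in> carrier R"
  shows "act r \<in> linear_maps k M M"
  unfolding iota_act_def
proof (rule tensor_tlift_param_linear[OF module_M module_Md module_M module_M eval_smult_bilinear _
      iota_closed[OF assms]])
  show "(\<lambda>m. f m \<odot>\<^bsub>M\<^esub> e) \<in> linear_maps k M M" if "e \<in> carrier M" "f \<in> carrier (dual k M)" for e f
    by (rule linear_smult_left[OF module_M dual_linear[OF that(2)] that(1)])
qed

section \<open>The action map, its inverse, and induction over the elements
  \<open>r \<cdot> m\<close>\<close>

lemma act_map_tens:
  assumes "r \<in> carrier R" "m \<in> carrier M"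
  shows "act_map M act (r \<boxtimes>\<^bsub>ring_tensor R M act\<^esub> m) = act r m"
  unfolding act_map_def ring_tensor_def
  by (rule tensor_product.tlift_tens[OF act.ring_tensor_product
      module_int_module[OF M.abelian_group_axioms] act.act_bilinear act.act_balanced])
    (simp_all add: assms)

lemma act_map_bij: "bij_betw (act_map M act) (carrier (ring_tensor R M act)) (carrier M)"
  and act_map_add: "\<lbrakk>X \<in> carrier (ring_tensor R M act); Y \<in> carrier (ring_tensor R M act)\<rbrakk> \<Longrightarrow>
    act_map M act (X \<oplus>\<^bsub>ring_tensor R M act\<^esub> Y) = act_map M act X \<oplus>\<^bsub>M\<^esub> act_map M act Y"
  using firm_module by (auto simp: firm_module_def iso_def hom_def)

lemma act_inv_closed: "m \<in> carrier M \<Longrightarrow> act_inv R M act m \<in> carrier (ring_tensor R M act)"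
  using act_map_bij unfolding act_inv_def by (metis bij_betw_def inv_into_into)

text \<open>Injectivity of the action map: any preimage in the carrier is the one chosen by
  \<open>inv_into\<close>. Additivity of the inverse and its value at \<open>r \<cdot> m\<close>
  follow by exhibiting preimages.\<close>

lemma act_inv_eqI:
  "\<lbrakk>X \<in> carrier (ring_tensor R M act); act_map M act X = m\<rbrakk> \<Longrightarrow> act_inv R M act m = X"
  using act_map_bij unfolding act_inv_def by (auto simp: bij_betw_def)

lemma act_map_inv: "m \<in> carrier M \<Longrightarrow> act_map M act (act_inv R M act m) = m"
  using act_map_bij unfolding act_inv_def by (metis bij_betw_def f_inv_into_f)

lemma ring_tensor_closed:
  "\<lbrakk>r \<in> carrier R; m \<in> carrier M\<rbrakk> \<Longrightarrow> r \<boxtimes>\<^bsub>ring_tensor R M act\<^esub> m \<in> carrier (ring_tensor R M act)"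
  unfolding ring_tensor_def
  by (rule tensor_product.tens_closed[OF act.ring_tensor_product]) simp_all

lemma act_inv_act:
  "\<lbrakk>r \<in> carrier R; m \<in> carrier M\<rbrakk> \<Longrightarrow> act_inv R M act (act r m) = r \<boxtimes>\<^bsub>ring_tensor R M act\<^esub> m"
  by (rule act_inv_eqI[OF ring_tensor_closed act_map_tens])

lemma ring_tensor_module: "module \<Z> (ring_tensor R M act)"
  unfolding ring_tensor_def by (rule tensor_product.module_T[OF act.ring_tensor_product])

lemma act_inv_add:
  assumes "m \<in> carrier M" "n \<in> carrier M"
  shows "act_inv R M act (m \<oplus>\<^bsub>M\<^esub> n) = act_inv R M act m \<oplus>\<^bsub>ring_tensor R M act\<^esub> act_inv R M act n"
proof -
  interpret RT: module \<Z> "ring_tensor R M act" by (rule ring_tensor_module)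
  show ?thesis
    using assms by (intro act_inv_eqI) (simp_all add: act_inv_closed act_map_add act_map_inv)
qed

text \<open>Firmness presents \<open>m\<close> as the image of \<open>act_inv R M act m\<close>
  under the action map; tensor induction on that preimage yields the three cases.\<close>

lemma act_induct [consumes 1, case_names zero add act]:
  assumes "m \<in> carrier M" "P \<zero>\<^bsub>M\<^esub>"
    and "\<And>m n. \<lbrakk>m \<in> carrier M; n \<in> carrier M; P m; P n\<rbrakk> \<Longrightarrow> P (m \<oplus>\<^bsub>M\<^esub> n)"
    and "\<And>r m. \<lbrakk>r \<in> carrier R; m \<in> carrier M\<rbrakk> \<Longrightarrow> P (act r m)"
  shows "P m"
proof -
  interpret RT: module \<Z> "ring_tensor R M act" by (rule ring_tensor_module)
  have closed: "act_map M act X \<in> carrier M" if "X \<in> carrier (ring_tensor R M act)" for X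
    using act_map_bij that by (auto simp: bij_betw_def)
  have "P (act_map M act X)" if X: "X \<in> carrier (ring_tensor R M act)" for X
  proof (rule tensor_product.tensor_induct[OF act.ring_tensor_product, folded ring_tensor_def,
        where P = "\<lambda>X. P (act_map M act X)", OF X])
    have "act_map M act \<zero>\<^bsub>ring_tensor R M act\<^esub> = \<zero>\<^bsub>M\<^esub>"
      by (rule additive_zero[OF RT.abelian_group_axioms M.abelian_group_axioms])
        (simp_all add: closed act_map_add)
    then show "P (act_map M act \<zero>\<^bsub>ring_tensor R M act\<^esub>)" using assms(2) by simp
  qed (simp_all add: assms act_map_add closed act_map_tens)
  from this[OF act_inv_closed[OF assms(1)]] show ?thesis by (simp add: act_map_inv assms(1))
qed

subsection \<open>The module \<open>M \<otimes> N\<close>\<close>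

context
  fixes N :: "('k, 'n, 'w) module_scheme"
  assumes N: "module k N"
begin

interpretation N: module k N by (rule N)

lemmas module_MN = module_tensor[OF module_M N]
lemmas MN_bilinear = tensor_tens_bilinear[OF module_M N]

lemma act_tens_bilinear:
  "r \<in> carrier R \<Longrightarrow> (\<lambda>m n. act r m \<boxtimes>\<^bsub>tensor k M N\<^esub> n) \<in> bilinear_maps k M N (tensor k M N)"
  by (rule bilinear_comp2[OF MN_bilinear act_linear linear_id])

lemma tensor_act_linear: "r \<in> carrier R \<Longrightarrow> tensor_act k M \<iota> N r \<in> linear_maps k (tensor k M N) (tensor k M N)"
  unfolding tensor_act_def
  by (rule tensor_tlift_linear[OF module_M N module_MN act_tens_bilinear])

lemma tensor_act_tens:
  "\<lbrakk>r \<in> carrier R; m \<in> carrier M; n \<in> carrier N\<rbrakk> \<Longrightarrow>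
    tensor_act k M \<iota> N r (m \<boxtimes>\<^bsub>tensor k M N\<^esub> n) = act r m \<boxtimes>\<^bsub>tensor k M N\<^esub> n"
  unfolding tensor_act_def
  by (rule tensor_tlift_tens[OF module_M N module_MN act_tens_bilinear])

lemma tens_contract_bilinear:
  assumes "X \<in> carrier (tensor k M N)"
  shows "(\<lambda>e f. e \<boxtimes>\<^bsub>tensor k M N\<^esub> contract k N f X) \<in> bilinear_maps k M (dual k M) (tensor k M N)"
  by (rule bilinear_comp2[OF MN_bilinear linear_id contract_linear_dual[OF module_M N assms]])

text \<open>On a pure tensor the scalar crosses the tensor sign: \<open>e\<^sub>r f\<^sub>r(m)
  \<otimes> n = e\<^sub>r \<otimes> f\<^sub>r(m) n\<close>, and \<open>f\<^sub>r(m) n\<close> is the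
  contraction of \<open>m \<otimes> n\<close>.\<close>

lemma tensor_act_eq:
  assumes r: "r \<in> carrier R" and X: "X \<in> carrier (tensor k M N)"
  shows "tensor_act k M \<iota> N r X = tlift k (tensor k M N) (\<lambda>e f. e \<boxtimes>\<^bsub>tensor k M N\<^esub> contract k N f X) (\<iota> r)"
proof (rule tensor_linear_eqI[OF module_M N module_MN X tensor_act_linear[OF r]])
  show "(\<lambda>X. tlift k (tensor k M N) (\<lambda>e f. e \<boxtimes>\<^bsub>tensor k M N\<^esub> contract k N f X) (\<iota> r)) \<in> linear_maps k (tensor k M N) (tensor k M N)"
    by (rule tensor_tlift_param_linear[OF module_M module_Md module_MN module_MN
          tens_contract_bilinear _ iota_closed[OF r]])
      (auto intro: linear_bilinear_right[OF MN_bilinear contract_linear[OF module_M N]])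
next
  fix m n assume m: "m \<in> carrier M" and n: "n \<in> carrier N"
  have "act r m \<boxtimes>\<^bsub>tensor k M N\<^esub> n = tlift k (tensor k M N) (\<lambda>e f. (f m \<odot>\<^bsub>M\<^esub> e) \<boxtimes>\<^bsub>tensor k M N\<^esub> n) (\<iota> r)"
    unfolding iota_act_def
    by (rule tensor_tlift_comp[OF module_M module_Md module_M module_MN
          bilinear_left[OF MN_bilinear n] eval_smult_bilinear[OF m] iota_closed[OF r]])
  also have "\<dots> = tlift k (tensor k M N) (\<lambda>e f. e \<boxtimes>\<^bsub>tensor k M N\<^esub> contract k N f (m \<boxtimes>\<^bsub>tensor k M N\<^esub> n)) (\<iota> r)"
  proof (rule tensor_tlift_cong[OF module_M module_Md _ module_MN
        bilinear_comp[OF bilinear_left[OF MN_bilinear n] eval_smult_bilinear[OF m]] iota_closed[OF r]])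
    fix e f assume e: "e \<in> carrier M" and f: "f \<in> carrier (dual k M)"
    show "(f m \<odot>\<^bsub>M\<^esub> e) \<boxtimes>\<^bsub>tensor k M N\<^esub> n = e \<boxtimes>\<^bsub>tensor k M N\<^esub> contract k N f (m \<boxtimes>\<^bsub>tensor k M N\<^esub> n)"
      using linear_smult[OF bilinear_left[OF MN_bilinear n] dual_closed[OF f m] e]
        linear_smult[OF bilinear_right[OF MN_bilinear e] dual_closed[OF f m] n]
      by (simp add: contract_tens[OF module_M N f m n])
  qed
  finally show "tensor_act k M \<iota> N r (m \<boxtimes>\<^bsub>tensor k M N\<^esub> n) =
      tlift k (tensor k M N) (\<lambda>e f. e \<boxtimes>\<^bsub>tensor k M N\<^esub> contract k N f (m \<boxtimes>\<^bsub>tensor k M N\<^esub> n)) (\<iota> r)"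
    by (simp add: tensor_act_tens r m n)
qed

text \<open>By \<open>tensor_act_eq\<close> each map takes at \<open>r \<cdot> m\<close> the value
  \<open>e\<^sub>r \<otimes> contract f\<^sub>r\<close> of its value at \<open>m\<close>, so equal
  contractions at \<open>m\<close> force equality at \<open>r \<cdot> m\<close>, even if
  \<open>p m = q m\<close> is not yet known.\<close>

lemma contract_determines:
  assumes p: "\<And>m. m \<in> carrier M \<Longrightarrow> p m \<in> carrier (tensor k M N)"
    "\<And>m n. \<lbrakk>m \<in> carrier M; n \<in> carrier M\<rbrakk> \<Longrightarrow> p (m \<oplus>\<^bsub>M\<^esub> n) = p m \<oplus>\<^bsub>tensor k M N\<^esub> p n"
    "\<And>r m. \<lbrakk>r \<in> carrier R; m \<in> carrier M\<rbrakk> \<Longrightarrow> p (act r m) = tensor_act k M \<iota> N r (p m)"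
    and q: "\<And>m. m \<in> carrier M \<Longrightarrow> q m \<in> carrier (tensor k M N)"
    "\<And>m n. \<lbrakk>m \<in> carrier M; n \<in> carrier M\<rbrakk> \<Longrightarrow> q (m \<oplus>\<^bsub>M\<^esub> n) = q m \<oplus>\<^bsub>tensor k M N\<^esub> q n"
    "\<And>r m. \<lbrakk>r \<in> carrier R; m \<in> carrier M\<rbrakk> \<Longrightarrow> q (act r m) = tensor_act k M \<iota> N r (q m)"
    and eq: "\<And>f m. \<lbrakk>f \<in> carrier (dual k M); m \<in> carrier M\<rbrakk> \<Longrightarrow>
      contract k N f (p m) = contract k N f (q m)"
    and m: "m \<in> carrier M"
  shows "p m = q m"
  using m
proof (induction rule: act_induct)
  case zero
  note ab = M.abelian_group_axioms abelian_group_of_module[OF module_MN]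
  show ?case using additive_zero[OF ab p(1,2)] additive_zero[OF ab q(1,2)] by simp
next
  case (add m n)
  then show ?case by (simp add: p q)
next
  case (act r m)
  have "tlift k (tensor k M N) (\<lambda>e f. e \<boxtimes>\<^bsub>tensor k M N\<^esub> contract k N f (p m)) (\<iota> r) =
      tlift k (tensor k M N) (\<lambda>e f. e \<boxtimes>\<^bsub>tensor k M N\<^esub> contract k N f (q m)) (\<iota> r)"
    by (rule tensor_tlift_cong[OF module_M module_Md _ module_MN
          tens_contract_bilinear[OF p(1)[OF act(2)]] iota_closed[OF act(1)]])
      (simp add: eq act)
  then show ?case using act by (simp add: p q tensor_act_eq)
qed

end

text \<open>The identifications of \<open>comatrix_module\<close>, named so that \<open>D\<close>
  becomes an instance of the general quotient construction.\<close>

definition balancing :: "((('m \<Rightarrow> 'k) \<times> 'm) \<times> ('m \<Rightarrow> 'k) \<times> 'm) set"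
  where "balancing = {((\<lambda>n\<in>carrier M. f (act r n), m), (f, act r m)) | f r m.
      f \<in> carrier (dual k M) \<and> r \<in> carrier R \<and> m \<in> carrier M}"

lemma dual_act_closed:
  assumes "f \<in> carrier (dual k M)" "r \<in> carrier R"
  shows "(\<lambda>n\<in>carrier M. f (act r n)) \<in> carrier (dual k M)"
  by (rule dual_restrict[OF module_M linear_comp[OF dual_linear[OF assms(1)] act_linear[OF assms(2)]]])

text \<open>The right action satisfies \<open>f \<cdot> r = f(e\<^sub>r) f\<^sub>r\<close>:
  evaluated at \<open>m\<close>, both sides are \<open>f(e\<^sub>r) f\<^sub>r(m)\<close>.\<close>

lemma dual_act_eq:
  assumes f: "f \<in> carrier (dual k M)" and r: "r \<in> carrier R"
  shows "(\<lambda>n\<in>carrier M. f (act r n)) = contract k (dual k M) f (\<iota> r)"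
proof (rule dual_eqI[OF dual_act_closed[OF f r]])
  show "contract k (dual k M) f (\<iota> r) \<in> carrier (dual k M)"
    by (rule linear_closed[OF contract_linear[OF module_M module_Md f] iota_closed[OF r]])
next
  fix m assume m: "m \<in> carrier M"
  note self = module_self[OF cring_of_module[OF module_M]]
  have "f (act r m) = tlift k (self_module k) (\<lambda>e g. f (g m \<odot>\<^bsub>M\<^esub> e)) (\<iota> r)"
    unfolding iota_act_def
    by (rule tensor_tlift_comp[OF module_M module_Md module_M self dual_linear[OF f]
          eval_smult_bilinear[OF m] iota_closed[OF r]])
  also have "\<dots> = tlift k (self_module k) (\<lambda>e g. (f e \<odot>\<^bsub>dual k M\<^esub> g) m) (\<iota> r)"
  proof (rule tensor_tlift_cong[OF module_M module_Md _ self
        bilinear_comp[OF dual_linear[OF f] eval_smult_bilinear[OF m]] iota_closed[OF r]])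
    fix e g assume e: "e \<in> carrier M" and g: "g \<in> carrier (dual k M)"
    show "f (g m \<odot>\<^bsub>M\<^esub> e) = (f e \<odot>\<^bsub>dual k M\<^esub> g) m"
      using linear_smult[OF dual_linear[OF f] dual_closed[OF g m] e] m
      by (simp add: R.m_comm dual_closed[OF f e] dual_closed[OF g m])
  qed
  also have "\<dots> = contract k (dual k M) f (\<iota> r) m"
    unfolding contract_def
    by (rule tensor_tlift_comp[OF module_M module_Md module_Md self
          bilinear_left[OF dual_eval_bilinear[OF module_M] m]
          bilinear_smult[OF module_Md dual_linear[OF f]] iota_closed[OF r], symmetric])
  finally show "(\<lambda>n\<in>carrier M. f (act r n)) m = contract k (dual k M) f (\<iota> r) m"
    using m by simp
qed

subsection \<open>From bilinear maps to coactions\<close>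

context
  fixes N :: "('k, 'n, 'w) module_scheme" and W :: "('m \<Rightarrow> 'k) \<Rightarrow> 'm \<Rightarrow> 'n"
  assumes N: "module k N"
    and W: "W \<in> bilinear_maps k (dual k M) M N" "balanced balancing W"
begin

interpretation N: module k N by (rule N)

private abbreviation "rep \<equiv> coact_rep k M \<iota> N W"
private abbreviation "\<rho> \<equiv> coact k M R \<iota> N W"

lemma W_act:
  "\<lbrakk>f \<in> carrier (dual k M); r \<in> carrier R; m \<in> carrier M\<rbrakk> \<Longrightarrow>
    W (\<lambda>n\<in>carrier M. f (act r n)) m = W f (act r m)"
  using W(2) unfolding balanced_def balancing_def by fast

lemma rep_bilinear:
  "v \<in> carrier M \<Longrightarrow> (\<lambda>e g. e \<boxtimes>\<^bsub>tensor k M N\<^esub> W g v) \<in> bilinear_maps k M (dual k M) (tensor k M N)"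
  by (rule bilinear_comp2[OF MN_bilinear[OF N] linear_id bilinear_left[OF W(1)]])

lemma rep_closed: "\<lbrakk>r \<in> carrier R; v \<in> carrier M\<rbrakk> \<Longrightarrow> rep r v \<in> carrier (tensor k M N)"
  unfolding coact_rep_def
  by (rule linear_closed[OF tensor_tlift_linear[OF module_M module_Md module_MN[OF N] rep_bilinear]
        iota_closed])

lemma rep_add_left:
  "\<lbrakk>r \<in> carrier R; s \<in> carrier R; v \<in> carrier M\<rbrakk> \<Longrightarrow> rep (r \<oplus>\<^bsub>R\<^esub> s) v = rep r v \<oplus>\<^bsub>tensor k M N\<^esub> rep s v"
  unfolding coact_rep_def iota_add
  by (rule linear_add[OF tensor_tlift_linear[OF module_M module_Md module_MN[OF N] rep_bilinear]
        iota_closed iota_closed])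

lemma rep_linear:
  assumes "r \<in> carrier R"
  shows "rep r \<in> linear_maps k M (tensor k M N)"
  unfolding coact_rep_def
  by (rule tensor_tlift_param_linear[OF module_M module_Md module_M module_MN[OF N] rep_bilinear _
        iota_closed[OF assms]])
    (auto intro: linear_bilinear_right[OF MN_bilinear[OF N] bilinear_right[OF W(1)]])

text \<open>Balancedness moves \<open>r\<close> onto the functional, where it becomes
  \<open>f(e\<^sub>r) f\<^sub>r\<close>; linearity of \<open>W\<close> in the functional then
  extracts the scalar.\<close>

lemma W_act_eq:
  assumes f: "f \<in> carrier (dual k M)" and r: "r \<in> carrier R" and v: "v \<in> carrier M"
  shows "W f (act r v) = tlift k N (\<lambda>e g. f e \<odot>\<^bsub>N\<^esub> W g v) (\<iota> r)"
proof -
  note bil = bilinear_smult[OF module_Md dual_linear[OF f]]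
  have "W f (act r v) = W (contract k (dual k M) f (\<iota> r)) v"
    using W_act[OF f r v] by (simp add: dual_act_eq f r)
  also have "\<dots> = tlift k N (\<lambda>e g. W (f e \<odot>\<^bsub>dual k M\<^esub> g) v) (\<iota> r)"
    unfolding contract_def
    by (rule tensor_tlift_comp[OF module_M module_Md module_Md N bilinear_left[OF W(1) v] bil
          iota_closed[OF r]])
  also have "\<dots> = tlift k N (\<lambda>e g. f e \<odot>\<^bsub>N\<^esub> W g v) (\<iota> r)"
    by (rule tensor_tlift_cong[OF module_M module_Md _ N bilinear_comp[OF bilinear_left[OF W(1) v] bil]
          iota_closed[OF r]])
      (rule linear_smult[OF bilinear_left[OF W(1) v] dual_closed[OF f]])
  finally show ?thesis .
qed

lemma contract_rep:
  assumes f: "f \<in> carrier (dual k M)" and r: "r \<in> carrier R" and v: "v \<in> carrier M"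
  shows "contract k N f (rep r v) = W f (act r v)"
proof -
  have "contract k N f (rep r v) = tlift k N (\<lambda>e g. contract k N f (e \<boxtimes>\<^bsub>tensor k M N\<^esub> W g v)) (\<iota> r)"
    unfolding coact_rep_def
    by (rule contract_comp[OF module_M N f rep_bilinear[OF v] module_M module_Md
          iota_closed[OF r]])
  also have "\<dots> = tlift k N (\<lambda>e g. f e \<odot>\<^bsub>N\<^esub> W g v) (\<iota> r)"
    by (rule tensor_tlift_cong[OF module_M module_Md _ N
          bilinear_comp[OF contract_linear[OF module_M N f] rep_bilinear[OF v]] iota_closed[OF r]])
      (simp add: contract_tens[OF module_M N f] bilinear_closed[OF W(1)] v)
  finally show ?thesis by (simp add: W_act_eq f r v)
qed

text \<open>Multiplicativity of \<open>\<iota>\<close> turns the left side into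
  \<open>e\<^sub>r f\<^sub>r(e\<^sub>s) \<otimes> W(f\<^sub>s, v)\<close>. Moving the scalar to the
  right gives \<open>e\<^sub>r \<otimes> f\<^sub>r(e\<^sub>s) W(f\<^sub>s, v)\<close>, and
  \<open>W_act_eq\<close> recognises \<open>W(f\<^sub>r, s \<cdot> v)\<close>. This is the balancing
  over \<open>R\<close> that lets \<open>rep\<close> descend to
  \<open>R \<otimes>\<^sub>R M\<close>.\<close>

lemma rep_mult:
  assumes r: "r \<in> carrier R" and s: "s \<in> carrier R" and v: "v \<in> carrier M"
  shows "rep (r \<otimes>\<^bsub>R\<^esub> s) v = rep r (act s v)"
proof -
  note mMN = module_MN[OF N] and MNb = MN_bilinear[OF N]
    and mMM = module_tensor[OF module_M module_Md]
    and MM = tensor_tens_bilinear[OF module_M module_Md]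
  \<comment> \<open>This is \<open>rep\<close> with \<open>\<iota> r\<close> replaced by an
    arbitrary element of \<open>M \<otimes> M\<^sup>*\<close>, so that it can be applied to a
    product in the matrix ring and pushed inside its two lifts.\<close>
  define \<phi> where "\<phi> = tlift k (tensor k M N) (\<lambda>e g. e \<boxtimes>\<^bsub>tensor k M N\<^esub> W g v)"
  have \<phi>: "\<phi> \<in> linear_maps k MM (tensor k M N)"
    unfolding \<phi>_def by (rule tensor_tlift_linear[OF module_M module_Md mMN rep_bilinear[OF v]])
  have inner: "(\<lambda>n g. (f n \<odot>\<^bsub>M\<^esub> e) \<boxtimes>\<^bsub>MM\<^esub> g) \<in> bilinear_maps k M (dual k M) MM"
    if "e \<in> carrier M" "f \<in> carrier (dual k M)" for e f
    by (rule bilinear_comp2[OF MM linear_smult_left[OF module_M dual_linear[OF that(2)] that(1)]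
          linear_id])
  have outer: "(\<lambda>e f. tlift k MM (\<lambda>n g. (f n \<odot>\<^bsub>M\<^esub> e) \<boxtimes>\<^bsub>MM\<^esub> g) (\<iota> s)) \<in>
      bilinear_maps k M (dual k M) MM"
  proof (rule bilinear_mapsI)
    fix e assume e: "e \<in> carrier M"
    show "(\<lambda>f. tlift k MM (\<lambda>n g. (f n \<odot>\<^bsub>M\<^esub> e) \<boxtimes>\<^bsub>MM\<^esub> g) (\<iota> s)) \<in> linear_maps k (dual k M) MM"
      by (rule tensor_tlift_param_linear[OF module_M module_Md module_Md mMM inner[OF e] _
            iota_closed[OF s]])
        (assumption, rule linear_bilinear_left[OF MM linear_smult_left[OF module_M
            bilinear_left[OF dual_eval_bilinear[OF module_M]] e]])
  next
    fix f assume f: "f \<in> carrier (dual k M)"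
    show "(\<lambda>e. tlift k MM (\<lambda>n g. (f n \<odot>\<^bsub>M\<^esub> e) \<boxtimes>\<^bsub>MM\<^esub> g) (\<iota> s)) \<in> linear_maps k M MM"
      by (rule tensor_tlift_param_linear[OF module_M module_Md module_M mMM inner[OF _ f] _
            iota_closed[OF s]])
        (assumption, rule linear_bilinear_left[OF MM linear_smult_right[OF module_M linear_id
            dual_closed[OF f]]])
  qed
  have "rep (r \<otimes>\<^bsub>R\<^esub> s) v = \<phi> (\<iota> (r \<otimes>\<^bsub>R\<^esub> s))" by (simp add: \<phi>_def coact_rep_def)
  also have "\<dots> = tlift k (tensor k M N) (\<lambda>e f. \<phi> (tlift k MM (\<lambda>n g. (f n \<odot>\<^bsub>M\<^esub> e) \<boxtimes>\<^bsub>MM\<^esub> g) (\<iota> s))) (\<iota> r)"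
    unfolding iota_mult[OF r s]
    by (rule tensor_tlift_comp[OF module_M module_Md mMM mMN \<phi> outer iota_closed[OF r]])
  also have "\<dots> = tlift k (tensor k M N) (\<lambda>e f. e \<boxtimes>\<^bsub>tensor k M N\<^esub> W f (act s v)) (\<iota> r)"
  proof (rule tensor_tlift_cong[OF module_M module_Md _ mMN bilinear_comp[OF \<phi> outer]
        iota_closed[OF r]])
    fix e f assume e: "e \<in> carrier M" and f: "f \<in> carrier (dual k M)"
    have "\<phi> (tlift k MM (\<lambda>n g. (f n \<odot>\<^bsub>M\<^esub> e) \<boxtimes>\<^bsub>MM\<^esub> g) (\<iota> s)) =
        tlift k (tensor k M N) (\<lambda>n g. \<phi> ((f n \<odot>\<^bsub>M\<^esub> e) \<boxtimes>\<^bsub>MM\<^esub> g)) (\<iota> s)"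
      by (rule tensor_tlift_comp[OF module_M module_Md mMM mMN \<phi> inner[OF e f] iota_closed[OF s]])
    also have "\<dots> = tlift k (tensor k M N) (\<lambda>n g. e \<boxtimes>\<^bsub>tensor k M N\<^esub> (f n \<odot>\<^bsub>N\<^esub> W g v)) (\<iota> s)"
    proof (rule tensor_tlift_cong[OF module_M module_Md _ mMN bilinear_comp[OF \<phi> inner[OF e f]]
          iota_closed[OF s]])
      fix n g assume n: "n \<in> carrier M" and g: "g \<in> carrier (dual k M)"
      have Wg: "W g v \<in> carrier N" by (rule bilinear_closed[OF W(1) g v])
      have "\<phi> ((f n \<odot>\<^bsub>M\<^esub> e) \<boxtimes>\<^bsub>MM\<^esub> g) = (f n \<odot>\<^bsub>M\<^esub> e) \<boxtimes>\<^bsub>tensor k M N\<^esub> W g v"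
        unfolding \<phi>_def
        by (rule tensor_tlift_tens[OF module_M module_Md mMN rep_bilinear[OF v]])
          (simp_all add: e g dual_closed[OF f n])
      then show "\<phi> ((f n \<odot>\<^bsub>M\<^esub> e) \<boxtimes>\<^bsub>MM\<^esub> g) = e \<boxtimes>\<^bsub>tensor k M N\<^esub> (f n \<odot>\<^bsub>N\<^esub> W g v)"
        using linear_smult[OF bilinear_left[OF MNb Wg] dual_closed[OF f n] e]
          linear_smult[OF bilinear_right[OF MNb e] dual_closed[OF f n] Wg] by simp
    qed
    also have "\<dots> = e \<boxtimes>\<^bsub>tensor k M N\<^esub> tlift k N (\<lambda>n g. f n \<odot>\<^bsub>N\<^esub> W g v) (\<iota> s)"
      by (rule tensor_tlift_comp[OF module_M module_Md N mMN bilinear_right[OF MNb e]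
            bilinear_comp2[OF bilinear_smult[OF N dual_linear[OF f]] linear_id bilinear_left[OF W(1) v]]
            iota_closed[OF s], symmetric])
    also have "\<dots> = e \<boxtimes>\<^bsub>tensor k M N\<^esub> W f (act s v)" by (simp add: W_act_eq f s v)
    finally show "\<phi> (tlift k MM (\<lambda>n g. (f n \<odot>\<^bsub>M\<^esub> e) \<boxtimes>\<^bsub>MM\<^esub> g) (\<iota> s)) = e \<boxtimes>\<^bsub>tensor k M N\<^esub> W f (act s v)" .
  qed
  finally show ?thesis by (simp add: coact_rep_def)
qed

lemma rep_int_bilinear:
  "rep \<in> bilinear_maps \<Z> (int_module R) (int_module M) (int_module (tensor k M N))"
  by (intro bilinear_mapsI int_linearI act.R.abelian_group_axioms M.abelian_group_axioms
      abelian_group_of_module[OF module_MN[OF N]])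
    (auto simp: rep_closed rep_add_left linear_add[OF rep_linear])

lemma rep_balanced:
  "balanced {((r \<otimes>\<^bsub>R\<^esub> s, m), (r, act s m)) | r s m.
    r \<in> carrier R \<and> s \<in> carrier R \<and> m \<in> carrier M} rep"
  by (auto simp: balanced_def rep_mult)

lemmas rep_lift = module_int_module[OF abelian_group_of_module[OF module_MN[OF N]]]
  rep_int_bilinear rep_balanced

lemma coact_closed: "m \<in> carrier M \<Longrightarrow> \<rho> m \<in> carrier (tensor k M N)"
  using tensor_product.tlift_closed[OF act.ring_tensor_product rep_lift, folded ring_tensor_def,
      OF act_inv_closed] by (simp add: coact_def)

lemma coact_add:
  "\<lbrakk>m \<in> carrier M; n \<in> carrier M\<rbrakk> \<Longrightarrow> \<rho> (m \<oplus>\<^bsub>M\<^esub> n) = \<rho> m \<oplus>\<^bsub>tensor k M N\<^esub> \<rho> n"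
  using tensor_product.tlift_add[OF act.ring_tensor_product rep_lift, folded ring_tensor_def,
      OF act_inv_closed act_inv_closed] by (simp add: coact_def act_inv_add)

lemma coact_act:
  "\<lbrakk>r \<in> carrier R; m \<in> carrier M\<rbrakk> \<Longrightarrow> \<rho> (act r m) = rep r m"
  using tensor_product.tlift_tens[OF act.ring_tensor_product rep_lift, folded ring_tensor_def]
  by (simp add: coact_def act_inv_act)

lemma coact_zero: "\<rho> \<zero>\<^bsub>M\<^esub> = \<zero>\<^bsub>tensor k M N\<^esub>"
  by (rule additive_zero[OF M.abelian_group_axioms abelian_group_of_module[OF module_MN[OF N]]
        coact_closed coact_add])

text \<open>The construction over the integers yields additivity only. Homogeneity is checked at
  \<open>r \<cdot> m\<close>, where \<open>a (r \<cdot> m) = r \<cdot> (a m)\<close> and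
  \<open>rep r\<close> is linear over \<open>k\<close>.\<close>

lemma coact_linear: "\<rho> \<in> linear_maps k M (tensor k M N)"
proof (rule linear_mapsI[OF coact_closed coact_add])
  interpret T: module k "tensor k M N" by (rule module_MN[OF N])
  fix a m assume a: "a \<in> carrier k" and m: "m \<in> carrier M"
  show "\<rho> (a \<odot>\<^bsub>M\<^esub> m) = a \<odot>\<^bsub>tensor k M N\<^esub> \<rho> m"
    using m
  proof (induction rule: act_induct)
    case zero
    then show ?case using a by (simp add: coact_zero)
  next
    case (add m n)
    then show ?case using a by (simp add: smult_r_distr T.smult_r_distr coact_add coact_closed)
  next
    case (act r m)
    then show ?case
      using a by (simp add: linear_smult[OF act_linear, symmetric] coact_act linear_smult[OF rep_linear])
  qed
qed

text \<open>At \<open>r \<cdot> m\<close> both sides equal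
  \<open>f(e\<^sub>r) W(f\<^sub>r, m)\<close>, and both are additive in \<open>m\<close>.\<close>

lemma contract_coact:
  assumes f: "f \<in> carrier (dual k M)" and m: "m \<in> carrier M"
  shows "contract k N f (\<rho> m) = W f m"
  using m
proof (induction rule: act_induct)
  case zero
  then show ?case
    using linear_zero[OF module_MN[OF N] N contract_linear[OF module_M N f]]
      linear_zero[OF module_M N bilinear_right[OF W(1) f]] by (simp add: coact_zero)
next
  case (add m n)
  then show ?case
    by (simp add: coact_add coact_closed linear_add[OF contract_linear[OF module_M N f]]
        linear_add[OF bilinear_right[OF W(1) f]])
next
  case (act r m)
  then show ?case by (simp add: coact_act contract_rep f)
qed

text \<open>The right side is \<open>e\<^sub>s \<otimes> contract f\<^sub>s (\<rho> m)\<close>,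
  hence \<open>e\<^sub>s \<otimes> W(f\<^sub>s, m)\<close> by \<open>contract_coact\<close>; this is
  the defining value of the coaction at \<open>s \<cdot> m\<close>.\<close>

lemma coact_R_linear:
  assumes s: "s \<in> carrier R" and m: "m \<in> carrier M"
  shows "\<rho> (act s m) = tensor_act k M \<iota> N s (\<rho> m)"
proof -
  have "tensor_act k M \<iota> N s (\<rho> m) = tlift k (tensor k M N) (\<lambda>e f. e \<boxtimes>\<^bsub>tensor k M N\<^esub> contract k N f (\<rho> m)) (\<iota> s)"
    by (rule tensor_act_eq[OF N s coact_closed[OF m]])
  also have "\<dots> = rep s m"
    unfolding coact_rep_def
    by (rule tensor_tlift_cong[OF module_M module_Md _ module_MN[OF N]
          tens_contract_bilinear[OF N coact_closed[OF m]] iota_closed[OF s]])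
      (simp add: contract_coact m)
  finally show ?thesis by (simp add: coact_act s m)
qed

end

end


section \<open>The comatrix coalgebra\<close>

context comatrix
begin

abbreviation "D \<equiv> comatrix_module k M R \<iota>"
abbreviation "DD \<equiv> tensor k D D"

lemma tensor_product_D: "tensor_product k (dual k M) M balancing"
  by (intro tensor_product.intro tensor_product_axioms.intro module_Md module_M)
    (auto simp: balancing_def act.act_closed intro: dual_act_closed)

lemma D_eq: "D = tensor_mod k (dual k M) M balancing"
  by (simp add: comatrix_module_def balancing_def)

lemmas module_D = tensor_product.module_T[OF tensor_product_D, folded D_eq]
lemmas D_bilinear = tensor_product.tens_bilinear[OF tensor_product_D, folded D_eq]
lemmas D_balanced = tensor_product.tens_balanced[OF tensor_product_D, folded D_eq]
lemmas D_tlift_linear = tensor_product.tlift_linear[OF tensor_product_D, folded D_eq]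
lemmas D_tlift_tens = tensor_product.tlift_tens[OF tensor_product_D, folded D_eq]
lemmas D_linear_eqI = tensor_product.linear_eqI[OF tensor_product_D, folded D_eq]
lemmas module_DD = module_tensor[OF module_D module_D]
lemmas DD_bilinear = tensor_tens_bilinear[OF module_D module_D]

lemma D_closed: "\<lbrakk>f \<in> carrier (dual k M); m \<in> carrier M\<rbrakk> \<Longrightarrow> f \<boxtimes>\<^bsub>D\<^esub> m \<in> carrier D"
  by (rule bilinear_closed[OF D_bilinear])

lemma D_act:
  assumes "f \<in> carrier (dual k M)" "r \<in> carrier R" "m \<in> carrier M"
  shows "(\<lambda>n\<in>carrier M. f (act r n)) \<boxtimes>\<^bsub>D\<^esub> m = f \<boxtimes>\<^bsub>D\<^esub> act r m"
  by (rule W_act[OF module_D D_bilinear D_balanced assms])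

text \<open>The comultiplication sends \<open>f \<otimes> u\<close> to the image of \<open>coact_D u\<close>, the coaction obtained from
  the identity of \<open>D\<close>, under the following map \<open>e \<otimes> d \<mapsto> (f \<otimes> e) \<otimes> d\<close>.\<close>

definition attach :: "('m \<Rightarrow> 'k) \<Rightarrow> ('m \<times> (('m \<Rightarrow> 'k) \<times> 'm \<Rightarrow> 'k) set \<Rightarrow> 'k) set \<Rightarrow>
    ((('m \<Rightarrow> 'k) \<times> 'm \<Rightarrow> 'k) set \<times> (('m \<Rightarrow> 'k) \<times> 'm \<Rightarrow> 'k) set \<Rightarrow> 'k) set"
  where "attach f = tlift k DD (\<lambda>e d. (f \<boxtimes>\<^bsub>D\<^esub> e) \<boxtimes>\<^bsub>DD\<^esub> d)"

abbreviation "coact_D \<equiv> coact k M R \<iota> D (tens D)"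
abbreviation "MD \<equiv> tensor k M D"

lemmas module_MD = module_tensor[OF module_M module_D]
lemmas coact_D_linear = coact_linear[OF module_D D_bilinear D_balanced]
lemmas coact_D_closed = coact_closed[OF module_D D_bilinear D_balanced]

lemma attach_bilinear:
  "f \<in> carrier (dual k M) \<Longrightarrow> (\<lambda>e d. (f \<boxtimes>\<^bsub>D\<^esub> e) \<boxtimes>\<^bsub>DD\<^esub> d) \<in> bilinear_maps k M D DD"
  by (rule bilinear_comp2[OF DD_bilinear bilinear_right[OF D_bilinear] linear_id])

lemma attach_linear: "f \<in> carrier (dual k M) \<Longrightarrow> attach f \<in> linear_maps k MD DD"
  unfolding attach_def by (rule tensor_tlift_linear[OF module_M module_D module_DD attach_bilinear])

lemma attach_tens:
  "\<lbrakk>f \<in> carrier (dual k M); e \<in> carrier M; d \<in> carrier D\<rbrakk> \<Longrightarrow>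
    attach f (e \<boxtimes>\<^bsub>MD\<^esub> d) = (f \<boxtimes>\<^bsub>D\<^esub> e) \<boxtimes>\<^bsub>DD\<^esub> d"
  unfolding attach_def by (rule tensor_tlift_tens[OF module_M module_D module_DD attach_bilinear])

lemma attach_linear_dual:
  assumes X: "X \<in> carrier MD"
  shows "(\<lambda>f. attach f X) \<in> linear_maps k (dual k M) DD"
  unfolding attach_def
  by (rule tensor_tlift_param_linear[OF module_M module_D module_Md module_DD attach_bilinear _ X])
    (assumption, rule linear_bilinear_left[OF DD_bilinear bilinear_left[OF D_bilinear]])

text \<open>On a pure tensor \<open>e \<otimes> d\<close> this is the balancing of \<open>D\<close>
  in its first factor: \<open>(f \<cdot> r) \<otimes> e = f \<otimes> (r \<cdot> e)\<close>.\<close>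

lemma attach_act:
  assumes f: "f \<in> carrier (dual k M)" and r: "r \<in> carrier R" and X: "X \<in> carrier MD"
  shows "attach (\<lambda>n\<in>carrier M. f (act r n)) X = attach f (tensor_act k M \<iota> D r X)"
  by (rule tensor_linear_eqI[OF module_M module_D module_DD X attach_linear[OF dual_act_closed[OF f r]]
        linear_comp[OF attach_linear[OF f] tensor_act_linear[OF module_D r]]])
    (simp add: attach_tens tensor_act_tens[OF module_D] dual_act_closed f r D_act act.act_closed)

abbreviation "comult_rep f u \<equiv> tlift \<Z> (int_module DD)
  (\<lambda>r v. tlift k DD (\<lambda>e g. (f \<boxtimes>\<^bsub>D\<^esub> e) \<boxtimes>\<^bsub>DD\<^esub> (g \<boxtimes>\<^bsub>D\<^esub> v)) (\<iota> r)) (act_inv R M act u)"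

lemma comult_rep_eq:
  assumes f: "f \<in> carrier (dual k M)" and u: "u \<in> carrier M"
  shows "comult_rep f u = attach f (coact_D u)"
proof -
  note lift = rep_lift[OF module_D D_bilinear D_balanced]
  \<comment> \<open>The outer lift lives on \<open>R \<otimes>\<^sub>R M\<close>, a module over the
    integers, so \<open>attach f\<close> is read as an integer-linear map in order to move inside
    it.\<close>
  note int_lin = int_linear_of_linear[OF module_MD module_DD attach_linear[OF f]]
  note zDD = module_int_module[OF abelian_group_of_module[OF module_DD]]
  let ?rep = "coact_rep k M \<iota> D (tens D)"
  note inv = act_inv_closed[OF u, unfolded ring_tensor_def]
  have "attach f (coact_D u) = tlift \<Z> (int_module DD) (\<lambda>r v. attach f (?rep r v)) (act_inv R M act u)"
    unfolding coact_def
    by (rule tensor_product.tlift_comp[OF act.ring_tensor_product lift(1) zDD int_lin lift(2,3) inv])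
  also have "\<dots> = comult_rep f u"
  proof (rule tensor_product.tlift_cong[OF act.ring_tensor_product _ zDD
        bilinear_comp[OF int_lin lift(2)] _ inv])
    show "balanced {((r \<otimes>\<^bsub>R\<^esub> s, m), (r, act s m)) | r s m.
        r \<in> carrier R \<and> s \<in> carrier R \<and> m \<in> carrier M} (\<lambda>r v. attach f (?rep r v))"
      using lift(3) by (auto simp: balanced_def)
    fix r v assume "r \<in> carrier (int_module R)" "v \<in> carrier (int_module M)"
    then have r: "r \<in> carrier R" and v: "v \<in> carrier M" by simp_all
    note bil = rep_bilinear[OF module_D D_bilinear D_balanced v]
    have "attach f (?rep r v) = tlift k DD (\<lambda>e g. attach f (e \<boxtimes>\<^bsub>MD\<^esub> (g \<boxtimes>\<^bsub>D\<^esub> v))) (\<iota> r)"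
      unfolding coact_rep_def
      by (rule tensor_tlift_comp[OF module_M module_Md module_MD module_DD attach_linear[OF f] bil
            iota_closed[OF r]])
    also have "\<dots> = tlift k DD (\<lambda>e g. (f \<boxtimes>\<^bsub>D\<^esub> e) \<boxtimes>\<^bsub>DD\<^esub> (g \<boxtimes>\<^bsub>D\<^esub> v)) (\<iota> r)"
      by (rule tensor_tlift_cong[OF module_M module_Md _ module_DD
            bilinear_comp[OF attach_linear[OF f] bil] iota_closed[OF r]])
        (simp add: attach_tens f v D_closed)
    finally show "attach f (?rep r v) =
        tlift k DD (\<lambda>e g. (f \<boxtimes>\<^bsub>D\<^esub> e) \<boxtimes>\<^bsub>DD\<^esub> (g \<boxtimes>\<^bsub>D\<^esub> v)) (\<iota> r)" .
  qed
  finally show ?thesis ..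
qed

lemma comult_rep_bilinear: "(\<lambda>f u. comult_rep f u) \<in> bilinear_maps k (dual k M) M DD"
proof (rule iffD2[OF bilinear_cong[OF comult_rep_eq module_Md module_M]])
  show "(\<lambda>f u. attach f (coact_D u)) \<in> bilinear_maps k (dual k M) M DD"
    by (intro bilinear_mapsI linear_comp[OF attach_linear coact_D_linear]
        attach_linear_dual[OF coact_D_closed])
qed

text \<open>The \<open>R\<close>-linearity of \<open>coact_D\<close> makes the comultiplication well
  defined: by \<open>attach_act\<close>, moving \<open>r\<close> from \<open>f\<close> to
  \<open>u\<close> moves it through \<open>coact_D\<close>.\<close>

lemma comult_rep_balanced: "balanced balancing (\<lambda>f u. comult_rep f u)"
  unfolding balanced_def balancing_def
  using coact_R_linear[OF module_D D_bilinear D_balanced]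
  by (auto simp: comult_rep_eq dual_act_closed act.act_closed attach_act coact_D_closed)

lemma comult_eq: "comatrix_comult k M R \<iota> = tlift k DD (\<lambda>f u. comult_rep f u)"
  by (simp add: comatrix_comult_def Let_def)

lemma comult_linear: "comatrix_comult k M R \<iota> \<in> linear_maps k D DD"
  unfolding comult_eq by (rule D_tlift_linear[OF module_DD comult_rep_bilinear comult_rep_balanced])

lemma comult_tens:
  "\<lbrakk>f \<in> carrier (dual k M); m \<in> carrier M\<rbrakk> \<Longrightarrow>
    comatrix_comult k M R \<iota> (f \<boxtimes>\<^bsub>D\<^esub> m) = attach f (coact_D m)"
  unfolding comult_eq
  by (simp only: D_tlift_tens[OF module_DD comult_rep_bilinear comult_rep_balanced] comult_rep_eq)


section \<open>Coactions and maps on the comatrix coalgebra\<close>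

text \<open>Normalisation off the carriers is deliberately left out, so that raw functions such as
  \<open>coact\<close> and composites with linear maps can take part.\<close>

definition corresponds ::
  "('k, 'n, 'w) module_scheme \<Rightarrow> ((('m \<Rightarrow> 'k) \<times> 'm \<Rightarrow> 'k) set \<Rightarrow> 'n) \<Rightarrow>
    ('m \<Rightarrow> ('m \<times> 'n \<Rightarrow> 'k) set) \<Rightarrow> bool"
  where "corresponds N \<chi> q \<longleftrightarrow> \<chi> \<in> linear_maps k D N \<and> q \<in> linear_maps k M (tensor k M N) \<and>
    (\<forall>r\<in>carrier R. \<forall>m\<in>carrier M. q (act r m) = tensor_act k M \<iota> N r (q m)) \<and>
    (\<forall>f\<in>carrier (dual k M). \<forall>m\<in>carrier M. contract k N f (q m) = \<chi> (f \<boxtimes>\<^bsub>D\<^esub> m))"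

lemma correspondsI:
  assumes "\<chi> \<in> linear_maps k D N" "q \<in> linear_maps k M (tensor k M N)"
    and "\<And>r m. \<lbrakk>r \<in> carrier R; m \<in> carrier M\<rbrakk> \<Longrightarrow> q (act r m) = tensor_act k M \<iota> N r (q m)"
    and "\<And>f m. \<lbrakk>f \<in> carrier (dual k M); m \<in> carrier M\<rbrakk> \<Longrightarrow>
      contract k N f (q m) = \<chi> (f \<boxtimes>\<^bsub>D\<^esub> m)"
  shows "corresponds N \<chi> q"
  using assms by (simp add: corresponds_def)

lemma correspondsD:
  assumes "corresponds N \<chi> q"
  shows "\<chi> \<in> linear_maps k D N" "q \<in> linear_maps k M (tensor k M N)"
    and "\<lbrakk>r \<in> carrier R; m \<in> carrier M\<rbrakk> \<Longrightarrow> q (act r m) = tensor_act k M \<iota> N r (q m)"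
    and "\<lbrakk>f \<in> carrier (dual k M); m \<in> carrier M\<rbrakk> \<Longrightarrow> contract k N f (q m) = \<chi> (f \<boxtimes>\<^bsub>D\<^esub> m)"
    and "m \<in> carrier M \<Longrightarrow> q m \<in> carrier (tensor k M N)"
  using assms by (auto simp: corresponds_def linear_closed)

lemma corresponds_cong:
  assumes "corresponds N \<chi> q" "\<And>m. m \<in> carrier M \<Longrightarrow> q' m = q m"
  shows "corresponds N \<chi> q'"
proof (rule correspondsI)
  show "q' \<in> linear_maps k M (tensor k M N)"
    by (rule iffD2[OF linear_cong[OF assms(2) module_M] correspondsD(2)[OF assms(1)]])
qed (simp_all add: assms(2) act.act_closed correspondsD[OF assms(1)])

lemma corresponds_coact:
  assumes N: "module k N" and \<chi>: "\<chi> \<in> linear_maps k D N"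
  shows "corresponds N \<chi> (coact k M R \<iota> N (\<lambda>f m. \<chi> (f \<boxtimes>\<^bsub>D\<^esub> m)))"
proof -
  note W = bilinear_comp[OF \<chi> D_bilinear]
  have bal: "balanced balancing (\<lambda>f m. \<chi> (f \<boxtimes>\<^bsub>D\<^esub> m))"
    using D_balanced by (auto simp: balanced_def)
  show ?thesis
    by (intro correspondsI \<chi> coact_linear[OF N W bal] coact_R_linear[OF N W bal]
        contract_coact[OF N W bal])
qed

lemma contract_tensor_act:
  assumes N: "module k N" and f: "f \<in> carrier (dual k M)" and r: "r \<in> carrier R"
    and X: "X \<in> carrier (tensor k M N)"
  shows "contract k N f (tensor_act k M \<iota> N r X) = contract k N (\<lambda>n\<in>carrier M. f (act r n)) X"
  by (rule tensor_linear_eqI[OF module_M N N X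
        linear_comp[OF contract_linear[OF module_M N f] tensor_act_linear[OF N r]]
        contract_linear[OF module_M N dual_act_closed[OF f r]]])
    (simp add: tensor_act_tens[OF N] contract_tens[OF module_M N] dual_act_closed f r act.act_closed)

text \<open>The passage from coactions to maps on \<open>D\<close>: \<open>contract f (q m)\<close>
  is balanced because contracting \<open>r \<cdot> X\<close> with \<open>f\<close> is contracting
  \<open>X\<close> with \<open>f \<cdot> r\<close>.\<close>

lemma corresponds_contract:
  assumes N: "module k N" and q: "q \<in> linear_maps k M (tensor k M N)"
    and R: "\<And>r m. \<lbrakk>r \<in> carrier R; m \<in> carrier M\<rbrakk> \<Longrightarrow> q (act r m) = tensor_act k M \<iota> N r (q m)"
  shows "corresponds N (tlift k N (\<lambda>f m. contract k N f (q m))) q"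
proof -
  have bil: "(\<lambda>f m. contract k N f (q m)) \<in> bilinear_maps k (dual k M) M N"
    by (intro bilinear_mapsI linear_comp[OF contract_linear[OF module_M N] q]
        contract_linear_dual[OF module_M N linear_closed[OF q]])
  have bal: "balanced balancing (\<lambda>f m. contract k N f (q m))"
    by (auto simp: balanced_def balancing_def R contract_tensor_act[OF N] linear_closed[OF q])
  show ?thesis
    by (intro correspondsI D_tlift_linear[OF N bil bal] q R)
      (simp_all add: D_tlift_tens[OF N bil bal])
qed

text \<open>Pure tensors span \<open>D\<close>, which gives one direction;
  \<open>contract_determines\<close> gives the other. Applied to the two sides of an axiom, this
  carries the axiom across.\<close>

lemma corresponds_eq_iff:
  assumes N: "module k N" and q: "corresponds N \<chi> q" and q': "corresponds N \<chi>' q'"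
  shows "(\<forall>m\<in>carrier M. q m = q' m) \<longleftrightarrow> (\<forall>c\<in>carrier D. \<chi> c = \<chi>' c)"
proof
  assume eq: "\<forall>m\<in>carrier M. q m = q' m"
  show "\<forall>c\<in>carrier D. \<chi> c = \<chi>' c"
  proof
    fix c assume c: "c \<in> carrier D"
    show "\<chi> c = \<chi>' c"
    proof (rule D_linear_eqI[OF N c correspondsD(1)[OF q] correspondsD(1)[OF q']])
      fix f m assume "f \<in> carrier (dual k M)" "m \<in> carrier M"
      then show "\<chi> (f \<boxtimes>\<^bsub>D\<^esub> m) = \<chi>' (f \<boxtimes>\<^bsub>D\<^esub> m)"
        using correspondsD(4)[OF q] correspondsD(4)[OF q'] eq by metis
    qed
  qed
next
  assume eq: "\<forall>c\<in>carrier D. \<chi> c = \<chi>' c"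
  show "\<forall>m\<in>carrier M. q m = q' m"
  proof
    fix m assume m: "m \<in> carrier M"
    note add = linear_add[OF correspondsD(2)[OF q]] linear_add[OF correspondsD(2)[OF q']]
    show "q m = q' m"
      by (rule contract_determines[OF N correspondsD(5)[OF q] add(1) correspondsD(3)[OF q]
            correspondsD(5)[OF q'] add(2) correspondsD(3)[OF q'] _ m])
        (simp_all add: correspondsD(4)[OF q] correspondsD(4)[OF q'] eq D_closed)
  qed
qed

lemma map_tensor_act:
  assumes N: "module k N" and P: "module k P" and r: "r \<in> carrier R"
    and B: "B \<in> bilinear_maps k M N (tensor k M P)"
    and act: "\<And>m n. \<lbrakk>m \<in> carrier M; n \<in> carrier N\<rbrakk> \<Longrightarrow> B (act r m) n = tensor_act k M \<iota> P r (B m n)"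
    and X: "X \<in> carrier (tensor k M N)"
  shows "tlift k (tensor k M P) B (tensor_act k M \<iota> N r X) =
    tensor_act k M \<iota> P r (tlift k (tensor k M P) B X)"
proof -
  note lin = tensor_tlift_linear[OF module_M N module_tensor[OF module_M P] B]
  show ?thesis
    by (rule tensor_linear_eqI[OF module_M N module_tensor[OF module_M P] X
          linear_comp[OF lin tensor_act_linear[OF N r]] linear_comp[OF tensor_act_linear[OF P r] lin]])
      (simp add: tensor_act_tens[OF N r] act act.act_closed r
        tensor_tlift_tens[OF module_M N module_tensor[OF module_M P] B])
qed

text \<open>Naturality in the coefficient module: contraction commutes with
  \<open>M \<otimes> g\<close> because \<open>f(n) g(h) = g(f(n) h)\<close>.\<close>

lemma corresponds_map:
  assumes H: "module k H" and N: "module k N" and \<rho>: "corresponds H \<omega> \<rho>"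
    and g: "g \<in> linear_maps k H N"
  shows "corresponds N (\<lambda>c. g (\<omega> c))
    (\<lambda>m. tlift k (tensor k M N) (\<lambda>n h. n \<boxtimes>\<^bsub>tensor k M N\<^esub> g h) (\<rho> m))"
proof -
  note MN = module_tensor[OF module_M N]
  note bil = bilinear_comp2[OF MN_bilinear[OF N] linear_id g]
  show ?thesis
  proof (rule correspondsI)
    show "(\<lambda>c. g (\<omega> c)) \<in> linear_maps k D N" by (rule linear_comp[OF g correspondsD(1)[OF \<rho>]])
    show "(\<lambda>m. tlift k (tensor k M N) (\<lambda>n h. n \<boxtimes>\<^bsub>tensor k M N\<^esub> g h) (\<rho> m)) \<in>
        linear_maps k M (tensor k M N)"
      by (rule linear_comp[OF tensor_tlift_linear[OF module_M H MN bil] correspondsD(2)[OF \<rho>]])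
  next
    fix r m assume r: "r \<in> carrier R" and m: "m \<in> carrier M"
    show "tlift k (tensor k M N) (\<lambda>n h. n \<boxtimes>\<^bsub>tensor k M N\<^esub> g h) (\<rho> (act r m)) =
        tensor_act k M \<iota> N r (tlift k (tensor k M N) (\<lambda>n h. n \<boxtimes>\<^bsub>tensor k M N\<^esub> g h) (\<rho> m))"
      unfolding correspondsD(3)[OF \<rho> r m]
      by (rule map_tensor_act[OF H N r bil _ correspondsD(5)[OF \<rho> m]])
        (simp add: tensor_act_tens[OF N r] linear_closed[OF g])
  next
    fix f m assume f: "f \<in> carrier (dual k M)" and m: "m \<in> carrier M"
    note X = correspondsD(5)[OF \<rho> m]
    have "contract k N f (tlift k (tensor k M N) (\<lambda>n h. n \<boxtimes>\<^bsub>tensor k M N\<^esub> g h) (\<rho> m)) =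
        tlift k N (\<lambda>n h. contract k N f (n \<boxtimes>\<^bsub>tensor k M N\<^esub> g h)) (\<rho> m)"
      by (rule tensor_tlift_comp[OF module_M H MN N contract_linear[OF module_M N f] bil X])
    also have "\<dots> = tlift k N (\<lambda>n h. g (f n \<odot>\<^bsub>H\<^esub> h)) (\<rho> m)"
      by (rule tensor_tlift_cong[OF module_M H _ N
            bilinear_comp[OF contract_linear[OF module_M N f] bil] X])
        (simp add: contract_tens[OF module_M N f] linear_closed[OF g] linear_smult[OF g] dual_closed[OF f])
    also have "\<dots> = g (contract k H f (\<rho> m))"
      unfolding contract_def
      by (rule tensor_tlift_comp[OF module_M H H N g bilinear_smult[OF H dual_linear[OF f]] X,
            symmetric])
    finally show "contract k N f (tlift k (tensor k M N) (\<lambda>n h. n \<boxtimes>\<^bsub>tensor k M N\<^esub> g h) (\<rho> m)) =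
        g (\<omega> (f \<boxtimes>\<^bsub>D\<^esub> m))"
      by (simp add: correspondsD(4)[OF \<rho> f m])
  qed
qed

lemma corresponds_id: "corresponds D (\<lambda>c. c) coact_D"
  using corresponds_coact[OF module_D linear_id] by simp

text \<open>Universality of \<open>coact_D\<close>: both sides correspond to
  \<open>\<omega>\<close>, the right one as the image of the identity of \<open>D\<close>, and a
  coaction is determined by its map on \<open>D\<close>.\<close>

lemma coact_D_map:
  assumes H: "module k H" and \<rho>: "corresponds H \<omega> \<rho>" and m: "m \<in> carrier M"
  shows "\<rho> m = tlift k (tensor k M H) (\<lambda>n d. n \<boxtimes>\<^bsub>tensor k M H\<^esub> \<omega> d) (coact_D m)"
  using corresponds_eq_iff[OF H \<rho> corresponds_map[OF module_D H corresponds_id correspondsD(1)[OF \<rho>]]]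
    m by simp

text \<open>The comultiplication attaches \<open>f\<close> to \<open>coact_D m\<close>, and
  \<open>\<omega>\<close> turns \<open>coact_D m\<close> into \<open>\<rho> m\<close>. Thus applying
  \<open>\<omega>\<close> to the right leg of \<open>\<Delta>(f \<otimes> m)\<close> leaves
  \<open>f\<close> attached to the \<open>M\<close>-leg of \<open>\<rho> m\<close>.\<close>

lemma tlift_comult_tens:
  assumes H: "module k H" and P: "module k P" and \<rho>: "corresponds H \<omega> \<rho>"
    and Q: "Q \<in> bilinear_maps k D H P"
    and f: "f \<in> carrier (dual k M)" and m: "m \<in> carrier M"
  shows "tlift k P (\<lambda>d c. Q d (\<omega> c)) (comatrix_comult k M R \<iota> (f \<boxtimes>\<^bsub>D\<^esub> m)) =
    tlift k P (\<lambda>n h. Q (f \<boxtimes>\<^bsub>D\<^esub> n) h) (\<rho> m)"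
proof -
  note X = coact_D_closed[OF m] and MH = module_tensor[OF module_M H]
    and \<omega> = correspondsD(1)[OF \<rho>]
  note Q1 = bilinear_comp2[OF Q linear_id \<omega>]
    and Q2 = bilinear_comp2[OF Q bilinear_right[OF D_bilinear f] linear_id]
  note bil = bilinear_comp2[OF MN_bilinear[OF H] linear_id \<omega>]
  note lin1 = tensor_tlift_linear[OF module_D module_D P Q1]
    and lin2 = tensor_tlift_linear[OF module_M H P Q2]
  have "tlift k P (\<lambda>d c. Q d (\<omega> c)) (attach f (coact_D m)) =
      tlift k P (\<lambda>n d. tlift k P (\<lambda>d c. Q d (\<omega> c)) ((f \<boxtimes>\<^bsub>D\<^esub> n) \<boxtimes>\<^bsub>DD\<^esub> d)) (coact_D m)"
    unfolding attach_def
    by (rule tensor_tlift_comp[OF module_M module_D module_DD P lin1 attach_bilinear[OF f] X])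
  also have "\<dots> = tlift k P (\<lambda>n d. tlift k P (\<lambda>n h. Q (f \<boxtimes>\<^bsub>D\<^esub> n) h) (n \<boxtimes>\<^bsub>tensor k M H\<^esub> \<omega> d))
      (coact_D m)"
    by (rule tensor_tlift_cong[OF module_M module_D _ P bilinear_comp[OF lin1 attach_bilinear[OF f]] X])
      (simp add: tensor_tlift_tens[OF module_D module_D P Q1] tensor_tlift_tens[OF module_M H P Q2]
        D_closed f linear_closed[OF \<omega>])
  also have "\<dots> = tlift k P (\<lambda>n h. Q (f \<boxtimes>\<^bsub>D\<^esub> n) h)
      (tlift k (tensor k M H) (\<lambda>n d. n \<boxtimes>\<^bsub>tensor k M H\<^esub> \<omega> d) (coact_D m))"
    by (rule tensor_tlift_comp[OF module_M module_D MH P lin2 bil X, symmetric])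
  finally show ?thesis by (simp add: comult_tens f m coact_D_map[OF H \<rho> m])
qed

text \<open>One more coaction on the side of \<open>M\<close> matches one more comultiplication on
  the side of \<open>D\<close>. For fixed \<open>h\<close> the families \<open>\<Theta>\<close> and
  \<open>\<Xi>\<close> are already matched; \<open>\<rho>\<close> splits off \<open>h\<close> just
  as \<open>\<Delta>\<close> splits off the right leg whose image under \<open>\<omega>\<close>
  plays the role of \<open>h\<close>.\<close>

lemma corresponds_iterate:
  assumes H: "module k H" and N: "module k N" and \<rho>: "corresponds H \<omega> \<rho>"
    and \<Theta>: "\<And>h. h \<in> carrier H \<Longrightarrow> corresponds N (\<lambda>d. \<Xi> d h) (\<lambda>m. \<Theta> m h)"
    and \<Theta>_lin: "\<And>m. m \<in> carrier M \<Longrightarrow> \<Theta> m \<in> linear_maps k H (tensor k M N)"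
    and \<Xi>_lin: "\<And>d. d \<in> carrier D \<Longrightarrow> \<Xi> d \<in> linear_maps k H N"
  shows "corresponds N (\<lambda>c. tlift k N (\<lambda>d c. \<Xi> d (\<omega> c)) (comatrix_comult k M R \<iota> c))
    (\<lambda>m. tlift k (tensor k M N) \<Theta> (\<rho> m))"
proof -
  note MN = module_tensor[OF module_M N] and \<omega> = correspondsD(1)[OF \<rho>]
  have bil\<Theta>: "\<Theta> \<in> bilinear_maps k M H (tensor k M N)"
    by (intro bilinear_mapsI \<Theta>_lin correspondsD(2)[OF \<Theta>])
  have bil\<Xi>: "\<Xi> \<in> bilinear_maps k D H N"
    by (intro bilinear_mapsI \<Xi>_lin correspondsD(1)[OF \<Theta>])
  show ?thesis
  proof (rule correspondsI)
    show "(\<lambda>c. tlift k N (\<lambda>d c. \<Xi> d (\<omega> c)) (comatrix_comult k M R \<iota> c)) \<in> linear_maps k D N"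
      by (rule linear_comp[OF tensor_tlift_linear[OF module_D module_D N
              bilinear_comp2[OF bil\<Xi> linear_id \<omega>]] comult_linear])
    show "(\<lambda>m. tlift k (tensor k M N) \<Theta> (\<rho> m)) \<in> linear_maps k M (tensor k M N)"
      by (rule linear_comp[OF tensor_tlift_linear[OF module_M H MN bil\<Theta>] correspondsD(2)[OF \<rho>]])
  next
    fix r m assume r: "r \<in> carrier R" and m: "m \<in> carrier M"
    show "tlift k (tensor k M N) \<Theta> (\<rho> (act r m)) =
        tensor_act k M \<iota> N r (tlift k (tensor k M N) \<Theta> (\<rho> m))"
      unfolding correspondsD(3)[OF \<rho> r m]
      by (rule map_tensor_act[OF H N r bil\<Theta> _ correspondsD(5)[OF \<rho> m]])
        (rule correspondsD(3)[OF \<Theta> r])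
  next
    fix f m assume f: "f \<in> carrier (dual k M)" and m: "m \<in> carrier M"
    note X = correspondsD(5)[OF \<rho> m]
    have "contract k N f (tlift k (tensor k M N) \<Theta> (\<rho> m)) =
        tlift k N (\<lambda>n h. contract k N f (\<Theta> n h)) (\<rho> m)"
      by (rule tensor_tlift_comp[OF module_M H MN N contract_linear[OF module_M N f] bil\<Theta> X])
    also have "\<dots> = tlift k N (\<lambda>n h. \<Xi> (f \<boxtimes>\<^bsub>D\<^esub> n) h) (\<rho> m)"
      by (rule tensor_tlift_cong[OF module_M H _ N
            bilinear_comp[OF contract_linear[OF module_M N f] bil\<Theta>] X])
        (rule correspondsD(4)[OF \<Theta> f])
    finally show "contract k N f (tlift k (tensor k M N) \<Theta> (\<rho> m)) =
        tlift k N (\<lambda>d c. \<Xi> d (\<omega> c)) (comatrix_comult k M R \<iota> (f \<boxtimes>\<^bsub>D\<^esub> m))"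
      by (simp add: tlift_comult_tens[OF H N \<rho> bil\<Xi> f m])
  qed
qed

section \<open>Double and triple coactions\<close>

context
  fixes H :: "('k, 'h, 'v) module_scheme" and N :: "('k, 'n, 'w) module_scheme" and \<omega> \<rho>
  assumes H: "module k H" and N: "module k N" and \<rho>: "corresponds H \<omega> \<rho>"
begin

private lemma MN: "module k (tensor k M N)"
  by (rule module_tensor[OF module_M N])

private lemma twice_inner_bilinear:
  assumes "G \<in> bilinear_maps k H H N" "h \<in> carrier H"
  shows "(\<lambda>n x. n \<boxtimes>\<^bsub>tensor k M N\<^esub> G x h) \<in> bilinear_maps k M H (tensor k M N)"
  by (rule bilinear_comp2[OF MN_bilinear[OF N] linear_id bilinear_left[OF assms]])

lemma twice_linear:
  assumes G: "G \<in> bilinear_maps k H H N" and m: "m \<in> carrier M"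
  shows "(\<lambda>h. tlift k (tensor k M N) (\<lambda>n x. n \<boxtimes>\<^bsub>tensor k M N\<^esub> G x h) (\<rho> m)) \<in>
    linear_maps k H (tensor k M N)"
  by (rule tensor_tlift_param_linear[OF module_M H H MN twice_inner_bilinear[OF G] _
        correspondsD(5)[OF \<rho> m]])
    (assumption, rule linear_bilinear_right[OF MN_bilinear[OF N] bilinear_right[OF G]])

lemma twice_bilinear:
  assumes G: "G \<in> bilinear_maps k H H N"
  shows "(\<lambda>m h. tlift k (tensor k M N) (\<lambda>n x. n \<boxtimes>\<^bsub>tensor k M N\<^esub> G x h) (\<rho> m)) \<in>
    bilinear_maps k M H (tensor k M N)"
  by (rule bilinear_mapsI[OF twice_linear[OF G]
        correspondsD(2)[OF corresponds_map[OF H N \<rho> bilinear_left[OF G]]]])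

lemma corresponds_twice:
  assumes G: "G \<in> bilinear_maps k H H N"
  shows "corresponds N
    (\<lambda>c. tlift k N (\<lambda>c1 c2. G (\<omega> c1) (\<omega> c2)) (comatrix_comult k M R \<iota> c))
    (\<lambda>m. tlift k (tensor k M N) (\<lambda>m0 m1.
      tlift k (tensor k M N) (\<lambda>m00 m01. m00 \<boxtimes>\<^bsub>tensor k M N\<^esub> G m01 m1) (\<rho> m0)) (\<rho> m))"
  by (rule corresponds_iterate[OF H N \<rho> corresponds_map[OF H N \<rho> bilinear_left[OF G]]
        twice_linear[OF G] bilinear_right[OF G linear_closed[OF correspondsD(1)[OF \<rho>]]]])

text \<open>The axioms for \<open>\<rho>\<close> carry \<open>n\<close> inside the lift over the
  comultiplication of \<open>H\<close>, whereas a correspondence has it outside, tensored with a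
  bilinear expression \<open>G\<close>; \<open>K\<close> stands for the first shape.\<close>

lemma twice_cong:
  assumes G: "G \<in> bilinear_maps k H H N" and m: "m \<in> carrier M"
    and eq: "\<And>n x y. \<lbrakk>n \<in> carrier M; x \<in> carrier H; y \<in> carrier H\<rbrakk> \<Longrightarrow>
      n \<boxtimes>\<^bsub>tensor k M N\<^esub> G x y = K n x y"
  shows "tlift k (tensor k M N) (\<lambda>m0 m1.
      tlift k (tensor k M N) (\<lambda>m00 m01. m00 \<boxtimes>\<^bsub>tensor k M N\<^esub> G m01 m1) (\<rho> m0)) (\<rho> m) =
    tlift k (tensor k M N) (\<lambda>m0 m1.
      tlift k (tensor k M N) (\<lambda>m00 m01. K m00 m01 m1) (\<rho> m0)) (\<rho> m)"
proof (rule tensor_tlift_cong[OF module_M H _ MN twice_bilinear[OF G] correspondsD(5)[OF \<rho> m]])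
  fix m0 m1 assume m0: "m0 \<in> carrier M" and m1: "m1 \<in> carrier H"
  show "tlift k (tensor k M N) (\<lambda>m00 m01. m00 \<boxtimes>\<^bsub>tensor k M N\<^esub> G m01 m1) (\<rho> m0) =
      tlift k (tensor k M N) (\<lambda>m00 m01. K m00 m01 m1) (\<rho> m0)"
    by (rule tensor_tlift_cong[OF module_M H eq MN twice_inner_bilinear[OF G m1]
          correspondsD(5)[OF \<rho> m0]]) (simp_all add: m1)
qed

text \<open>The iteration step is applied to \<open>corresponds_twice\<close>. It always splits the
  left factor again, which is the bracketing of the triple comultiplication in the axioms for
  \<open>\<omega>\<close>.\<close>

lemma corresponds_thrice:
  assumes G: "\<And>z. z \<in> carrier H \<Longrightarrow> (\<lambda>x y. G x y z) \<in> bilinear_maps k H H N"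
    and G3: "\<And>x y. \<lbrakk>x \<in> carrier H; y \<in> carrier H\<rbrakk> \<Longrightarrow> (\<lambda>z. G x y z) \<in> linear_maps k H N"
  shows "corresponds N
    (\<lambda>c. tlift k N (\<lambda>d c3. tlift k N (\<lambda>c1 c2. G (\<omega> c1) (\<omega> c2) (\<omega> c3)) (comatrix_comult k M R \<iota> d))
      (comatrix_comult k M R \<iota> c))
    (\<lambda>m. tlift k (tensor k M N) (\<lambda>m0 m1. tlift k (tensor k M N) (\<lambda>m00 m01.
      tlift k (tensor k M N) (\<lambda>m000 m001. m000 \<boxtimes>\<^bsub>tensor k M N\<^esub> G m001 m01 m1) (\<rho> m00)) (\<rho> m0)) (\<rho> m))"
proof (rule corresponds_iterate[OF H N \<rho> corresponds_twice[OF G]])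
  fix m assume m: "m \<in> carrier M"
  show "(\<lambda>h. tlift k (tensor k M N) (\<lambda>m00 m01.
      tlift k (tensor k M N) (\<lambda>m000 m001. m000 \<boxtimes>\<^bsub>tensor k M N\<^esub> G m001 m01 h) (\<rho> m00)) (\<rho> m)) \<in>
    linear_maps k H (tensor k M N)"
  proof (rule tensor_tlift_param_linear[OF module_M H H MN twice_bilinear[OF G] _
        correspondsD(5)[OF \<rho> m]])
    fix n x assume n: "n \<in> carrier M" and x: "x \<in> carrier H"
    show "(\<lambda>h. tlift k (tensor k M N) (\<lambda>m000 m001. m000 \<boxtimes>\<^bsub>tensor k M N\<^esub> G m001 x h) (\<rho> n)) \<in>
        linear_maps k H (tensor k M N)"
      by (rule tensor_tlift_param_linear[OF module_M H H MN twice_inner_bilinear[OF G x] _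
            correspondsD(5)[OF \<rho> n]])
        (assumption, rule linear_bilinear_right[OF MN_bilinear[OF N] G3[OF _ x]])
  qed
next
  note \<omega> = correspondsD(1)[OF \<rho>]
  fix d assume d: "d \<in> carrier D"
  show "(\<lambda>h. tlift k N (\<lambda>c1 c2. G (\<omega> c1) (\<omega> c2) h) (comatrix_comult k M R \<iota> d)) \<in> linear_maps k H N"
    by (rule tensor_tlift_param_linear[OF module_D module_D H N bilinear_comp2[OF G \<omega> \<omega>] _
          linear_closed[OF comult_linear d]])
      (assumption, rule G3[OF linear_closed[OF \<omega>] linear_closed[OF \<omega>]])
qed

end

section \<open>The counit axiom\<close>

definition counit_D :: "(('m \<Rightarrow> 'k) \<times> 'm \<Rightarrow> 'k) set \<Rightarrow> 'k"
  where "counit_D = tlift k (self_module k) (\<lambda>f m. f m)"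

lemma module_self_k: "module k (self_module k)"
  by (rule module_self[OF cring_of_module[OF module_M]])

text \<open>With \<open>k\<close> as coefficient module, contracting \<open>m \<otimes> 1\<close>
  with \<open>f\<close> gives \<open>f(m)\<close>, which is the counit at
  \<open>f \<otimes> m\<close>.\<close>

lemma corresponds_counit:
  "corresponds (self_module k) counit_D (\<lambda>m. m \<boxtimes>\<^bsub>tensor k M (self_module k)\<^esub> \<one>\<^bsub>k\<^esub>)"
proof (rule correspondsI)
  have bal: "balanced balancing (\<lambda>f m. f m)"
    by (auto simp: balanced_def balancing_def)
  note eval = dual_eval_bilinear[OF module_M]
  show "counit_D \<in> linear_maps k D (self_module k)"
    unfolding counit_D_def by (rule D_tlift_linear[OF module_self_k eval bal])
  show "(\<lambda>m. m \<boxtimes>\<^bsub>tensor k M (self_module k)\<^esub> \<one>\<^bsub>k\<^esub>) \<in> linear_maps k M (tensor k M (self_module k))"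
    by (rule bilinear_left[OF MN_bilinear[OF module_self_k]]) simp
  show "act r m \<boxtimes>\<^bsub>tensor k M (self_module k)\<^esub> \<one>\<^bsub>k\<^esub> = tensor_act k M \<iota> (self_module k) r
      (m \<boxtimes>\<^bsub>tensor k M (self_module k)\<^esub> \<one>\<^bsub>k\<^esub>)" if "r \<in> carrier R" "m \<in> carrier M" for r m
    by (rule tensor_act_tens[OF module_self_k that, symmetric]) simp
  show "contract k (self_module k) f (m \<boxtimes>\<^bsub>tensor k M (self_module k)\<^esub> \<one>\<^bsub>k\<^esub>) = counit_D (f \<boxtimes>\<^bsub>D\<^esub> m)"
    if "f \<in> carrier (dual k M)" "m \<in> carrier M" for f m
    using that by (simp add: counit_D_def D_tlift_tens[OF module_self_k eval bal]
        contract_tens[OF module_M module_self_k] dual_closed)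
qed

text \<open>Correspondence compares maps into \<open>M \<otimes> k\<close>, but the axiom for
  \<open>\<rho>\<close> is an equation in \<open>M\<close>. The two are exchanged by the canonical
  isomorphism \<open>\<theta>\<close>, whose inverse \<open>m \<mapsto> m \<otimes> 1\<close> is the
  coaction corresponding to the counit.\<close>

lemma counit_iff:
  assumes H: "module k H" and \<rho>: "corresponds H \<omega> \<rho>" and \<eta>: "\<eta> \<in> linear_maps k H (self_module k)"
  shows "(\<forall>c\<in>carrier D. \<eta> (\<omega> c) = counit_D c) \<longleftrightarrow>
    (\<forall>m\<in>carrier M. tlift k M (\<lambda>m0 m1. \<eta> m1 \<odot>\<^bsub>M\<^esub> m0) (\<rho> m) = m)"
proof -
  let ?K = "self_module k"
  let ?MK = "tensor k M ?K"
  let ?q = "\<lambda>m. tlift k ?MK (\<lambda>n h. n \<boxtimes>\<^bsub>?MK\<^esub> \<eta> h) (\<rho> m)"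
  note MK = module_tensor[OF module_M module_self_k]
  note bil\<eta> = bilinear_comp2[OF MN_bilinear[OF module_self_k] linear_id \<eta>]
  have smult: "(\<lambda>m a. a \<odot>\<^bsub>M\<^esub> m) \<in> bilinear_maps k M ?K M"
    by (rule bilinear_mapsI)
      (simp_all add: linear_smult_left[OF module_M linear_id] linear_smult_right[OF module_M linear_id])
  define \<theta> where "\<theta> = tlift k M (\<lambda>m a. a \<odot>\<^bsub>M\<^esub> m)"
  have \<theta>: "\<theta> \<in> linear_maps k ?MK M"
    unfolding \<theta>_def by (rule tensor_tlift_linear[OF module_M module_self_k module_M smult])
  have \<theta>_tens: "\<theta> (m \<boxtimes>\<^bsub>?MK\<^esub> a) = a \<odot>\<^bsub>M\<^esub> m" if "m \<in> carrier M" "a \<in> carrier k" for m a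
    unfolding \<theta>_def using that
    by (intro tensor_tlift_tens[OF module_M module_self_k module_M smult]) simp_all
  have \<theta>_inv: "\<theta> X \<boxtimes>\<^bsub>?MK\<^esub> \<one>\<^bsub>k\<^esub> = X" if X: "X \<in> carrier ?MK" for X
  proof (rule tensor_linear_eqI[OF module_M module_self_k MK X _ linear_id])
    show "(\<lambda>X. \<theta> X \<boxtimes>\<^bsub>?MK\<^esub> \<one>\<^bsub>k\<^esub>) \<in> linear_maps k ?MK ?MK"
      by (rule linear_bilinear_left[OF MN_bilinear[OF module_self_k] \<theta>]) simp
    fix m a assume m: "m \<in> carrier M" and "a \<in> carrier ?K"
    then have a: "a \<in> carrier k" by simp
    have one: "\<one>\<^bsub>k\<^esub> \<in> carrier ?K" by simp
    show "\<theta> (m \<boxtimes>\<^bsub>?MK\<^esub> a) \<boxtimes>\<^bsub>?MK\<^esub> \<one>\<^bsub>k\<^esub> = m \<boxtimes>\<^bsub>?MK\<^esub> a"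
      unfolding \<theta>_tens[OF m a]
      using linear_smult[OF bilinear_left[OF MN_bilinear[OF module_self_k] one] a m]
        linear_smult[OF bilinear_right[OF MN_bilinear[OF module_self_k] m] a one] a
      by simp
  qed
  have \<theta>_q: "\<theta> (?q m) = tlift k M (\<lambda>m0 m1. \<eta> m1 \<odot>\<^bsub>M\<^esub> m0) (\<rho> m)" if m: "m \<in> carrier M" for m
  proof -
    note X = correspondsD(5)[OF \<rho> m]
    have "\<theta> (?q m) = tlift k M (\<lambda>n h. \<theta> (n \<boxtimes>\<^bsub>?MK\<^esub> \<eta> h)) (\<rho> m)"
      by (rule tensor_tlift_comp[OF module_M H MK module_M \<theta> bil\<eta> X])
    also have "\<dots> = tlift k M (\<lambda>m0 m1. \<eta> m1 \<odot>\<^bsub>M\<^esub> m0) (\<rho> m)"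
      using linear_closed[OF \<eta>]
      by (intro tensor_tlift_cong[OF module_M H _ module_M bilinear_comp[OF \<theta> bil\<eta>] X])
        (simp add: \<theta>_tens)
    finally show ?thesis .
  qed
  have q: "corresponds ?K (\<lambda>c. \<eta> (\<omega> c)) ?q" by (rule corresponds_map[OF H module_self_k \<rho> \<eta>])
  have "?q m = m \<boxtimes>\<^bsub>?MK\<^esub> \<one>\<^bsub>k\<^esub> \<longleftrightarrow> tlift k M (\<lambda>m0 m1. \<eta> m1 \<odot>\<^bsub>M\<^esub> m0) (\<rho> m) = m"
    if m: "m \<in> carrier M" for m
  proof -
    have "\<theta> (m \<boxtimes>\<^bsub>?MK\<^esub> \<one>\<^bsub>k\<^esub>) = m" using m by (simp add: \<theta>_tens)
    then have "?q m = m \<boxtimes>\<^bsub>?MK\<^esub> \<one>\<^bsub>k\<^esub> \<longleftrightarrow> \<theta> (?q m) = m"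
      using \<theta>_inv[OF correspondsD(5)[OF q m]] by metis
    then show ?thesis by (simp only: \<theta>_q[OF m])
  qed
  then show ?thesis
    using corresponds_eq_iff[OF module_self_k q corresponds_counit] by simp
qed

end


section \<open>Partial corepresentations and partial comodules\<close>

locale comatrix_hopf = comatrix k M R \<iota> + H: hopf_algebra k H
  for k :: "('k, 'x) ring_scheme" and M :: "('k, 'm, 'y) module_scheme"
    and R :: "('r, 'u) ring_scheme" and \<iota> :: "'r \<Rightarrow> ('m \<times> ('m \<Rightarrow> 'k) \<Rightarrow> 'k) set"
    and H :: "('k, 'h, 'z) hopf_scheme"
begin

abbreviation "HH \<equiv> tensor k H H"

lemma module_H: "module k H" ..

lemmas module_HH = module_tensor[OF module_H module_H]
lemmas HH_bilinear = tensor_tens_bilinear[OF module_H module_H]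

lemma mult_bilinear: "mult H \<in> bilinear_maps k H H H"
  by (intro bilinear_mapsI linear_mapsI)
    (simp_all add: H.A.l_distr H.A.r_distr H.smult_mult_left H.smult_mult_right)

lemma mult_antipode_bilinear: "(\<lambda>x y. x \<otimes>\<^bsub>H\<^esub> \<S>\<^bsub>H\<^esub> y) \<in> bilinear_maps k H H H"
  by (rule bilinear_comp2[OF mult_bilinear linear_id H.antipode_linear])

lemma comult_closed: "x \<in> carrier H \<Longrightarrow> \<Delta>\<^bsub>H\<^esub> x \<in> carrier HH"
  by (rule linear_closed[OF H.comult_linear])

text \<open>The expression \<open>x\<^sub>1 \<otimes> x\<^sub>2 S(y)\<close>, isolated so that its
  bilinearity can be stated; with \<open>x = \<omega>(c\<^sub>1)\<close> and
  \<open>y = \<omega>(c\<^sub>2)\<close> it gives a left-hand side of the axioms.\<close>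

definition left_cond where
  "left_cond x y = tlift k HH (\<lambda>a b. a \<boxtimes>\<^bsub>HH\<^esub> (b \<otimes>\<^bsub>H\<^esub> \<S>\<^bsub>H\<^esub> y)) (\<Delta>\<^bsub>H\<^esub> x)"

text \<open>The mirror expression \<open>x S(y\<^sub>1) \<otimes> y\<^sub>2\<close>, for the other
  axiom.\<close>

definition right_cond where
  "right_cond x y = tlift k HH (\<lambda>a b. (x \<otimes>\<^bsub>H\<^esub> \<S>\<^bsub>H\<^esub> a) \<boxtimes>\<^bsub>HH\<^esub> b) (\<Delta>\<^bsub>H\<^esub> y)"

lemma left_inner: "y \<in> carrier H \<Longrightarrow>
    (\<lambda>a b. a \<boxtimes>\<^bsub>HH\<^esub> (b \<otimes>\<^bsub>H\<^esub> \<S>\<^bsub>H\<^esub> y)) \<in> bilinear_maps k H H HH"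
  by (rule bilinear_comp2[OF HH_bilinear linear_id bilinear_left[OF mult_antipode_bilinear]])

lemma right_inner: "x \<in> carrier H \<Longrightarrow>
    (\<lambda>a b. (x \<otimes>\<^bsub>H\<^esub> \<S>\<^bsub>H\<^esub> a) \<boxtimes>\<^bsub>HH\<^esub> b) \<in> bilinear_maps k H H HH"
  by (rule bilinear_comp2[OF HH_bilinear bilinear_right[OF mult_antipode_bilinear] linear_id])

lemma left_cond_bilinear: "left_cond \<in> bilinear_maps k H H HH"
  unfolding left_cond_def
proof (rule bilinear_mapsI)
  fix x assume x: "x \<in> carrier H"
  show "(\<lambda>y. tlift k HH (\<lambda>a b. a \<boxtimes>\<^bsub>HH\<^esub> (b \<otimes>\<^bsub>H\<^esub> \<S>\<^bsub>H\<^esub> y)) (\<Delta>\<^bsub>H\<^esub> x)) \<in> linear_maps k H HH"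
    by (rule tensor_tlift_param_linear[OF module_H module_H module_H module_HH left_inner _
          comult_closed[OF x]])
      (assumption, rule linear_bilinear_right[OF HH_bilinear bilinear_right[OF mult_antipode_bilinear]])
next
  fix y assume y: "y \<in> carrier H"
  show "(\<lambda>x. tlift k HH (\<lambda>a b. a \<boxtimes>\<^bsub>HH\<^esub> (b \<otimes>\<^bsub>H\<^esub> \<S>\<^bsub>H\<^esub> y)) (\<Delta>\<^bsub>H\<^esub> x)) \<in> linear_maps k H HH"
    by (rule linear_comp[OF tensor_tlift_linear[OF module_H module_H module_HH left_inner[OF y]]
          H.comult_linear])
qed

lemma right_cond_bilinear: "right_cond \<in> bilinear_maps k H H HH"
  unfolding right_cond_def
proof (rule bilinear_mapsI)
  fix y assume y: "y \<in> carrier H"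
  show "(\<lambda>x. tlift k HH (\<lambda>a b. (x \<otimes>\<^bsub>H\<^esub> \<S>\<^bsub>H\<^esub> a) \<boxtimes>\<^bsub>HH\<^esub> b) (\<Delta>\<^bsub>H\<^esub> y)) \<in> linear_maps k H HH"
    by (rule tensor_tlift_param_linear[OF module_H module_H module_H module_HH right_inner _
          comult_closed[OF y]])
      (assumption, rule linear_bilinear_left[OF HH_bilinear bilinear_left[OF mult_antipode_bilinear]])
next
  fix x assume x: "x \<in> carrier H"
  show "(\<lambda>y. tlift k HH (\<lambda>a b. (x \<otimes>\<^bsub>H\<^esub> \<S>\<^bsub>H\<^esub> a) \<boxtimes>\<^bsub>HH\<^esub> b) (\<Delta>\<^bsub>H\<^esub> y)) \<in> linear_maps k H HH"
    by (rule linear_comp[OF tensor_tlift_linear[OF module_H module_H module_HH right_inner[OF x]]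
          H.comult_linear])
qed

abbreviation "\<Delta>D \<equiv> comatrix_comult k M R \<iota>"
abbreviation "T3 \<equiv> tensor k M HH"

text \<open>In both axioms the left side uses two legs of the coaction and the right side three.
  \<open>L\<close> and \<open>G\<close> are these expressions, matched by
  \<open>corresponds_twice\<close> and \<open>corresponds_thrice\<close>, so that uniqueness with
  coefficients in \<open>H \<otimes> H\<close> gives the equivalence.\<close>

lemma condition_iff:
  assumes \<rho>: "corresponds H \<omega> \<rho>" and L: "L \<in> bilinear_maps k H H HH"
    and G: "\<And>z. z \<in> carrier H \<Longrightarrow> (\<lambda>x y. G x y z) \<in> bilinear_maps k H H HH"
    and G3: "\<And>x y. \<lbrakk>x \<in> carrier H; y \<in> carrier H\<rbrakk> \<Longrightarrow> (\<lambda>z. G x y z) \<in> linear_maps k H HH"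
    and K: "\<And>n x y. \<lbrakk>n \<in> carrier M; x \<in> carrier H; y \<in> carrier H\<rbrakk> \<Longrightarrow> n \<boxtimes>\<^bsub>T3\<^esub> L x y = K n x y"
  shows "(\<forall>c\<in>carrier D. tlift k HH (\<lambda>c1 c2. L (\<omega> c1) (\<omega> c2)) (\<Delta>D c) =
      tlift k HH (\<lambda>d c3. tlift k HH (\<lambda>c1 c2. G (\<omega> c1) (\<omega> c2) (\<omega> c3)) (\<Delta>D d)) (\<Delta>D c)) \<longleftrightarrow>
    (\<forall>m\<in>carrier M. tlift k T3 (\<lambda>m0 m1. tlift k T3 (\<lambda>m00 m01. K m00 m01 m1) (\<rho> m0)) (\<rho> m) =
      tlift k T3 (\<lambda>m0 m1. tlift k T3 (\<lambda>m00 m01. tlift k T3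
        (\<lambda>m000 m001. m000 \<boxtimes>\<^bsub>T3\<^esub> G m001 m01 m1) (\<rho> m00)) (\<rho> m0)) (\<rho> m))"
  using corresponds_eq_iff[OF module_HH corresponds_twice[OF module_H module_HH \<rho> L]
      corresponds_thrice[OF module_H module_HH \<rho> G G3]]
    twice_cong[OF module_H module_HH \<rho> L _ K] by simp

lemma left_condition_iff:
  assumes \<rho>: "corresponds H \<omega> \<rho>"
  shows "(\<forall>c\<in>carrier D. tlift k HH (\<lambda>c1 c2.
        tlift k HH (\<lambda>a b. a \<boxtimes>\<^bsub>HH\<^esub> (b \<otimes>\<^bsub>H\<^esub> \<S>\<^bsub>H\<^esub> (\<omega> c2))) (\<Delta>\<^bsub>H\<^esub> (\<omega> c1))) (\<Delta>D c) =
      tlift k HH (\<lambda>d c3. tlift k HH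
        (\<lambda>c1 c2. \<omega> c1 \<boxtimes>\<^bsub>HH\<^esub> (\<omega> c2 \<otimes>\<^bsub>H\<^esub> \<S>\<^bsub>H\<^esub> (\<omega> c3))) (\<Delta>D d)) (\<Delta>D c)) \<longleftrightarrow>
    (\<forall>m\<in>carrier M. tlift k T3 (\<lambda>m0 m1. tlift k T3 (\<lambda>m00 m01. tlift k T3
        (\<lambda>a b. m00 \<boxtimes>\<^bsub>T3\<^esub> (a \<boxtimes>\<^bsub>HH\<^esub> (b \<otimes>\<^bsub>H\<^esub> \<S>\<^bsub>H\<^esub> m1))) (\<Delta>\<^bsub>H\<^esub> m01)) (\<rho> m0)) (\<rho> m) =
      tlift k T3 (\<lambda>m0 m1. tlift k T3 (\<lambda>m00 m01. tlift k T3
        (\<lambda>m000 m001. m000 \<boxtimes>\<^bsub>T3\<^esub> (m001 \<boxtimes>\<^bsub>HH\<^esub> (m01 \<otimes>\<^bsub>H\<^esub> \<S>\<^bsub>H\<^esub> m1))) (\<rho> m00)) (\<rho> m0)) (\<rho> m))"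
proof (rule condition_iff[OF \<rho> left_cond_bilinear, unfolded left_cond_def])
  show "(\<lambda>z. x \<boxtimes>\<^bsub>HH\<^esub> (y \<otimes>\<^bsub>H\<^esub> \<S>\<^bsub>H\<^esub> z)) \<in> linear_maps k H HH"
    if "x \<in> carrier H" "y \<in> carrier H" for x y
    by (rule linear_bilinear_right[OF HH_bilinear bilinear_right[OF mult_antipode_bilinear that(2)] that(1)])
  show "n \<boxtimes>\<^bsub>T3\<^esub> tlift k HH (\<lambda>a b. a \<boxtimes>\<^bsub>HH\<^esub> (b \<otimes>\<^bsub>H\<^esub> \<S>\<^bsub>H\<^esub> y)) (\<Delta>\<^bsub>H\<^esub> x) =
      tlift k T3 (\<lambda>a b. n \<boxtimes>\<^bsub>T3\<^esub> (a \<boxtimes>\<^bsub>HH\<^esub> (b \<otimes>\<^bsub>H\<^esub> \<S>\<^bsub>H\<^esub> y))) (\<Delta>\<^bsub>H\<^esub> x)"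
    if "n \<in> carrier M" "x \<in> carrier H" "y \<in> carrier H" for n x y
    by (rule tensor_tlift_comp[OF module_H module_H module_HH module_tensor[OF module_M module_HH]
          bilinear_right[OF MN_bilinear[OF module_HH] that(1)] left_inner[OF that(3)]
          comult_closed[OF that(2)]])
qed (rule left_inner)

lemma right_condition_iff:
  assumes \<rho>: "corresponds H \<omega> \<rho>"
  shows "(\<forall>c\<in>carrier D. tlift k HH (\<lambda>c1 c2.
        tlift k HH (\<lambda>a b. (\<omega> c1 \<otimes>\<^bsub>H\<^esub> \<S>\<^bsub>H\<^esub> a) \<boxtimes>\<^bsub>HH\<^esub> b) (\<Delta>\<^bsub>H\<^esub> (\<omega> c2))) (\<Delta>D c) =
      tlift k HH (\<lambda>d c3. tlift k HH
        (\<lambda>c1 c2. (\<omega> c1 \<otimes>\<^bsub>H\<^esub> \<S>\<^bsub>H\<^esub> (\<omega> c2)) \<boxtimes>\<^bsub>HH\<^esub> \<omega> c3) (\<Delta>D d)) (\<Delta>D c)) \<longleftrightarrow>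
    (\<forall>m\<in>carrier M. tlift k T3 (\<lambda>m0 m1. tlift k T3 (\<lambda>m00 m01. tlift k T3
        (\<lambda>a b. m00 \<boxtimes>\<^bsub>T3\<^esub> ((m01 \<otimes>\<^bsub>H\<^esub> \<S>\<^bsub>H\<^esub> a) \<boxtimes>\<^bsub>HH\<^esub> b)) (\<Delta>\<^bsub>H\<^esub> m1)) (\<rho> m0)) (\<rho> m) =
      tlift k T3 (\<lambda>m0 m1. tlift k T3 (\<lambda>m00 m01. tlift k T3
        (\<lambda>m000 m001. m000 \<boxtimes>\<^bsub>T3\<^esub> ((m001 \<otimes>\<^bsub>H\<^esub> \<S>\<^bsub>H\<^esub> m01) \<boxtimes>\<^bsub>HH\<^esub> m1)) (\<rho> m00)) (\<rho> m0)) (\<rho> m))"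
proof (rule condition_iff[OF \<rho> right_cond_bilinear, unfolded right_cond_def])
  show "(\<lambda>x y. (x \<otimes>\<^bsub>H\<^esub> \<S>\<^bsub>H\<^esub> y) \<boxtimes>\<^bsub>HH\<^esub> z) \<in> bilinear_maps k H H HH" if "z \<in> carrier H" for z
    by (rule bilinear_comp[OF bilinear_left[OF HH_bilinear that] mult_antipode_bilinear])
  show "(\<lambda>z. (x \<otimes>\<^bsub>H\<^esub> \<S>\<^bsub>H\<^esub> y) \<boxtimes>\<^bsub>HH\<^esub> z) \<in> linear_maps k H HH"
    if "x \<in> carrier H" "y \<in> carrier H" for x y
    by (rule bilinear_right[OF HH_bilinear bilinear_closed[OF mult_antipode_bilinear that]])
  show "n \<boxtimes>\<^bsub>T3\<^esub> tlift k HH (\<lambda>a b. (x \<otimes>\<^bsub>H\<^esub> \<S>\<^bsub>H\<^esub> a) \<boxtimes>\<^bsub>HH\<^esub> b) (\<Delta>\<^bsub>H\<^esub> y) =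
      tlift k T3 (\<lambda>a b. n \<boxtimes>\<^bsub>T3\<^esub> ((x \<otimes>\<^bsub>H\<^esub> \<S>\<^bsub>H\<^esub> a) \<boxtimes>\<^bsub>HH\<^esub> b)) (\<Delta>\<^bsub>H\<^esub> y)"
    if "n \<in> carrier M" "x \<in> carrier H" "y \<in> carrier H" for n x y
    by (rule tensor_tlift_comp[OF module_H module_H module_HH module_tensor[OF module_M module_HH]
          bilinear_right[OF MN_bilinear[OF module_HH] that(1)] right_inner[OF that(2)]
          comult_closed[OF that(3)]])
qed

lemma comatrix_coalgebra_simps:
  "carrier (comatrix_coalgebra k M R \<iota>) = carrier D"
  "comult (comatrix_coalgebra k M R \<iota>) = \<Delta>D"
  "counit (comatrix_coalgebra k M R \<iota>) = counit_D"
  "Hom k (comatrix_coalgebra k M R \<iota>) H = Hom k D H"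
  by (simp_all add: comatrix_coalgebra_def Let_def counit_D_def Hom_def linear_maps_def)

text \<open>The extensionality assumptions supply membership in the two \<open>Hom\<close> sets; the
  axioms themselves transfer one by one through the correspondence.\<close>

lemma partial_corep_iff:
  assumes \<rho>: "corresponds H \<omega> \<rho>" and "\<omega> \<in> extensional (carrier D)" "\<rho> \<in> extensional (carrier M)"
  shows "\<omega> \<in> partial_coreps k (comatrix_coalgebra k M R \<iota>) H \<longleftrightarrow>
    \<rho> \<in> partial_comodule_structures k M H"
proof -
  have Hom: "\<omega> \<in> Hom k D H" "\<rho> \<in> Hom k M (tensor k M H)"
    using correspondsD[OF \<rho>] assms(2,3) by (simp_all add: Hom_def)
  show ?thesis
    using counit_iff[OF module_H \<rho> H.counit_linear] left_condition_iff[OF \<rho>] right_condition_iff[OF \<rho>]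
    unfolding partial_coreps_def partial_comodule_structures_def Let_def comatrix_coalgebra_simps
      mem_Collect_eq ball_conj_distrib
    using Hom by blast
qed

text \<open>The restriction normalises the coaction off the carrier, as \<open>Hom\<close>
  requires.\<close>

definition to_comodule where
  "to_comodule \<omega> = (\<lambda>m\<in>carrier M. coact k M R \<iota> H (\<lambda>f m. \<omega> (f \<boxtimes>\<^bsub>D\<^esub> m)) m)"

lemma corresponds_to_comodule:
  assumes "\<omega> \<in> linear_maps k D H"
  shows "corresponds H \<omega> (to_comodule \<omega>)"
  by (rule corresponds_cong[OF corresponds_coact[OF module_H assms]]) (simp add: to_comodule_def)

lemma partial_corep_Hom:
  assumes "\<omega> \<in> partial_coreps k (comatrix_coalgebra k M R \<iota>) H"
  shows "\<omega> \<in> linear_maps k D H" "\<omega> \<in> extensional (carrier D)"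
proof -
  have "\<omega> \<in> Hom k D H"
    using assms by (simp add: partial_coreps_def comatrix_coalgebra_simps)
  then show "\<omega> \<in> linear_maps k D H" "\<omega> \<in> extensional (carrier D)" by (simp_all add: Hom_def)
qed

lemma corresponds_left_R_linear:
  assumes "corresponds H \<omega> \<rho>"
  shows "left_R_linear k M R \<iota> H \<rho>"
  using linear_add[OF correspondsD(2)[OF assms]] correspondsD(3)[OF assms]
  by (simp add: left_R_linear_def Let_def tensor_act_def)

lemma to_comodule_bij: "bij_betw to_comodule (partial_coreps k (comatrix_coalgebra k M R \<iota>) H)
    {\<rho> \<in> partial_comodule_structures k M H. left_R_linear k M R \<iota> H \<rho>}"
proof (rule bij_betwI')
  fix \<omega> \<omega>' assume \<omega>: "\<omega> \<in> partial_coreps k (comatrix_coalgebra k M R \<iota>) H"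
    and \<omega>': "\<omega>' \<in> partial_coreps k (comatrix_coalgebra k M R \<iota>) H"
  note corr = corresponds_to_comodule[OF partial_corep_Hom(1)[OF \<omega>]]
    corresponds_to_comodule[OF partial_corep_Hom(1)[OF \<omega>']]
  \<comment> \<open>Equal coactions have equal contractions, so the maps agree on \<open>D\<close>;
    normalisation then gives equality of functions.\<close>
  have "\<omega> = \<omega>'" if "to_comodule \<omega> = to_comodule \<omega>'"
    using corresponds_eq_iff[OF module_H corr] that
    by (intro extensionalityI[OF partial_corep_Hom(2)[OF \<omega>] partial_corep_Hom(2)[OF \<omega>']]) simp
  then show "to_comodule \<omega> = to_comodule \<omega>' \<longleftrightarrow> \<omega> = \<omega>'" by blast
next
  fix \<omega> assume \<omega>: "\<omega> \<in> partial_coreps k (comatrix_coalgebra k M R \<iota>) H"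
  note corr = corresponds_to_comodule[OF partial_corep_Hom(1)[OF \<omega>]]
  show "to_comodule \<omega> \<in> {\<rho> \<in> partial_comodule_structures k M H. left_R_linear k M R \<iota> H \<rho>}"
    using partial_corep_iff[OF corr partial_corep_Hom(2)[OF \<omega>]] \<omega> corresponds_left_R_linear[OF corr]
    by (simp add: to_comodule_def)
next
  fix \<rho> assume "\<rho> \<in> {\<rho> \<in> partial_comodule_structures k M H. left_R_linear k M R \<iota> H \<rho>}"
  then have \<rho>: "\<rho> \<in> partial_comodule_structures k M H" and R: "left_R_linear k M R \<iota> H \<rho>" by auto
  then have lin: "\<rho> \<in> linear_maps k M (tensor k M H)" and ext: "\<rho> \<in> extensional (carrier M)"
    by (simp_all add: partial_comodule_structures_def Hom_def)
  have R': "\<rho> (act r m) = tensor_act k M \<iota> H r (\<rho> m)" if "r \<in> carrier R" "m \<in> carrier M" for r m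
    using R that by (simp add: left_R_linear_def Let_def tensor_act_def)
  \<comment> \<open>The preimage is \<open>f \<otimes> m \<mapsto> contract f (\<rho> m)\<close>,
    well defined because \<open>\<rho>\<close> is \<open>R\<close>-linear.\<close>
  define \<omega> where "\<omega> = (\<lambda>c\<in>carrier D. tlift k H (\<lambda>f m. contract k H f (\<rho> m)) c)"
  have "corresponds H (tlift k H (\<lambda>f m. contract k H f (\<rho> m))) \<rho>"
    by (rule corresponds_contract[OF module_H lin R'])
  then have corr: "corresponds H \<omega> \<rho>"
    using linear_cong[of D \<omega> "tlift k H (\<lambda>f m. contract k H f (\<rho> m))" k H, OF _ module_D]
    by (simp add: corresponds_def \<omega>_def D_closed)
  have "\<omega> \<in> extensional (carrier D)" by (simp add: \<omega>_def)
  then have mem: "\<omega> \<in> partial_coreps k (comatrix_coalgebra k M R \<iota>) H"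
    using partial_corep_iff[OF corr _ ext] \<rho> by blast
  \<comment> \<open>Both coactions correspond to the same \<open>\<omega>\<close>, so uniqueness
    identifies them on the carrier.\<close>
  have "\<rho> = to_comodule \<omega>"
    using corresponds_eq_iff[OF module_H corr corresponds_to_comodule[OF correspondsD(1)[OF corr]]]
    by (intro extensionalityI[OF ext, of "to_comodule \<omega>"]) (simp_all add: to_comodule_def)
  then show "\<exists>\<omega>\<in>partial_coreps k (comatrix_coalgebra k M R \<iota>) H. \<rho> = to_comodule \<omega>"
    using mem by blast
qed

end

theorem theorem4p3:
  fixes k :: "'k ring" and H :: "('k, 'h) hopf" and M :: "('k, 'm) module"
    and R :: "'r ring" and \<iota> :: "'r \<Rightarrow> ('m \<times> ('m \<Rightarrow> 'k) \<Rightarrow> 'k) set"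
  assumes "hopf_algebra k H"
    and "firmly_projective k M R \<iota>"
  shows "\<exists>\<Phi>. bij_betw \<Phi>
      (partial_coreps k (comatrix_coalgebra k M R \<iota>) H)
      {\<rho> \<in> partial_comodule_structures k M H. left_R_linear k M R \<iota> H \<rho>} \<and>
    (\<forall>\<omega> \<in> partial_coreps k (comatrix_coalgebra k M R \<iota>) H.
      \<forall>f \<in> carrier (dual k M). \<forall>m \<in> carrier M.
        \<omega> (f \<boxtimes>\<^bsub>comatrix_module k M R \<iota>\<^esub> m) = tlift k H (\<lambda>m0 m1. f m0 \<odot>\<^bsub>H\<^esub> m1) (\<Phi> \<omega> m))"
proof -
  interpret comatrix_hopf k M R \<iota> H
    by (intro comatrix_hopf.intro comatrix.intro assms)
  show ?thesis
    \<comment> \<open>The formula for \<open>\<omega>\<close> is the contraction identity of the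
      correspondence with \<open>contract\<close> unfolded.\<close>
    using to_comodule_bij correspondsD(4)[OF corresponds_to_comodule[OF partial_corep_Hom(1)]]
    by (intro exI[of _ to_comodule]) (simp add: contract_def)
qed

end
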